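(* The family $$\{C\in\mathcal{C}_{ev}:\mathrm{supp}(\mu_C^{dis})=\mathrm{supp}(\mu_C^{sing})=\mathrm{supp}(\mu_C^{abs})=\mathbb{I}^2\}$$ is dense in $(\mathcal{C}_{ev},d_\infty)$.
   Context: $\mathbb{I}=[0,1]$; $\lambda$ is Lebesgue measure on $\mathbb{I}$. A bivariate copula $C$ is the restriction to $\mathbb{I}^2$ of a bivariate distribution function with uniform marginals on $\mathbb{I}$; $\mu_C$ is its doubly stochastic measure, $\mu_C([0,x]\times[0,y])=C(x,y)$. $\mathcal{C}_{ev}$ is the set of Extreme Value copulas: copulas $C$ for which there is a copula $B$ with $C(x,y)=\lim_{n\to\infty}B^n(x^{1/n},y^{1/n})$ for all $x,y\in\mathbb{I}$. $d_\infty$ is the uniform metric. A finite measure is called singular if it has no point masses and is concentrated on a Lebesgue null set. Let $K_C$ be the Markov kernel of $C$ (regular conditional distribution of $Y$ given $X$ for $(X,Y)\sim C$, so $\mu_C(E\times F)=\int_EK_C(x,F)\,d\lambda(x)$), and decompose $K_C(x,\cdot)=K_C^{abs}(x,\cdot)+K_C^{dis}(x,\cdot)+K_C^{sing}(x,\cdot)$ into absolutely continuous, discrete and singular sub-Markov kernels. For $\ast\in\{abs,dis,sing\}$, $\mu_C^{\ast}$ is the measure on $\mathbb{I}^2$ with $\mu_C^{\ast}(E\times F)=\int_EK_C^{\ast}(x,F)\,d\lambda(x)$. The support of a measure is the complement of the union of all open sets of measure zero. *)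

theory Defs
  imports "HOL-Probability.Probability"
begin

text \<open>All measures live on the Borel sets of the real line or the plane and are concentrated
  on the unit interval or the unit square.\<close>

abbreviation unit_square :: "(real \<times> real) set" where
  "unit_square \<equiv> {0..1} \<times> {0..1}"

definition unit_leb :: "real measure" where
  "unit_leb = uniform_measure lborel {0..1}"

definition doubly_stochastic :: "(real \<times> real) measure \<Rightarrow> bool" where
  "doubly_stochastic M \<longleftrightarrow>
     sets M = sets borel \<and> distr M borel fst = unit_leb \<and> distr M borel snd = unit_leb"

text \<open>Being a restriction to the unit square is rendered by extensionality (\<^const>\<open>restrict\<close>),
  so that two copulas are equal iff they agree on the unit square.\<close>

definition copula :: "(real \<times> real \<Rightarrow> real) \<Rightarrow> bool" where
  "copula C \<longleftrightarrow>
     (\<exists>M. doubly_stochastic M \<and>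
          C = restrict (\<lambda>(x, y). measure M ({..x} \<times> {..y})) unit_square)"

definition copula_measure :: "(real \<times> real \<Rightarrow> real) \<Rightarrow> (real \<times> real) measure" where
  "copula_measure C =
     (THE M. doubly_stochastic M \<and>
             (\<forall>x\<in>{0..1}. \<forall>y\<in>{0..1}. measure M ({0..x} \<times> {0..y}) = C (x, y)))"

definition ev_copulas :: "(real \<times> real \<Rightarrow> real) set" where
  "ev_copulas =
     {C. copula C \<and>
         (\<exists>B. copula B \<and>
              (\<forall>x\<in>{0..1}. \<forall>y\<in>{0..1}.
                 (\<lambda>n. B (x powr (1 / real n), y powr (1 / real n)) ^ n) \<longlonglongrightarrow> C (x, y)))}"

definition ev_metric :: "(real \<times> real \<Rightarrow> real) metric" where
  "ev_metric = submetric (funspace unit_square euclidean_metric) ev_copulas"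

definition is_markov_kernel :: "(real \<times> real \<Rightarrow> real) \<Rightarrow> (real \<Rightarrow> real measure) \<Rightarrow> bool" where
  "is_markov_kernel C K \<longleftrightarrow>
     K \<in> borel \<rightarrow>\<^sub>M prob_algebra borel \<and>
     (\<forall>x\<in>{0..1}. emeasure (K x) {0..1} = 1) \<and>
     (\<forall>E\<in>sets borel. \<forall>F\<in>sets borel.
        emeasure (copula_measure C) (E \<times> F) = (\<integral>\<^sup>+x\<in>E. emeasure (K x) F \<partial>unit_leb))"

text \<open>The kernel is unique only up to a Lebesgue null set of first coordinates; the measures
  defined from it below do not depend on the version chosen.\<close>

definition markov_kernel :: "(real \<times> real \<Rightarrow> real) \<Rightarrow> real \<Rightarrow> real measure" where
  "markov_kernel C = (SOME K. is_markov_kernel C K)"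

definition discrete_measure :: "real measure \<Rightarrow> bool" where
  "discrete_measure M \<longleftrightarrow> (\<exists>N. countable N \<and> emeasure M (- N) = 0)"

definition singular_measure :: "real measure \<Rightarrow> bool" where
  "singular_measure M \<longleftrightarrow>
     (\<forall>y. emeasure M {y} = 0) \<and> (\<exists>N\<in>null_sets lborel. emeasure M (- N) = 0)"

definition lebesgue_decomposition ::
  "real measure \<Rightarrow> real measure \<Rightarrow> real measure \<Rightarrow> real measure \<Rightarrow> bool" where
  "lebesgue_decomposition M A D S \<longleftrightarrow>
     sets A = sets borel \<and> sets D = sets borel \<and> sets S = sets borel \<and>
     finite_measure A \<and> finite_measure D \<and> finite_measure S \<and>
     absolutely_continuous lborel A \<and> discrete_measure D \<and> singular_measure S \<and>
     (\<forall>F\<in>sets borel. emeasure M F = emeasure A F + emeasure D F + emeasure S F)"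

text \<open>The three parts of a finite measure are uniquely determined (see
  \<open>lebesgue_decomposition_unique\<close> below), so the decomposition of a kernel into an absolutely
  continuous, a discrete and a singular sub-Markov kernel is necessarily the pointwise one.\<close>

definition abs_part :: "real measure \<Rightarrow> real measure" where
  "abs_part M = (THE A. \<exists>D S. lebesgue_decomposition M A D S)"

definition dis_part :: "real measure \<Rightarrow> real measure" where
  "dis_part M = (THE D. \<exists>A S. lebesgue_decomposition M A D S)"

definition sing_part :: "real measure \<Rightarrow> real measure" where
  "sing_part M = (THE S. \<exists>A D. lebesgue_decomposition M A D S)"

definition kernel_measure :: "(real \<Rightarrow> real measure) \<Rightarrow> (real \<times> real) measure" where
  "kernel_measure K =
     (THE M. sets M = sets borel \<and>
             (\<forall>E\<in>sets borel. \<forall>F\<in>sets borel.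
                emeasure M (E \<times> F) = (\<integral>\<^sup>+x\<in>E. emeasure (K x) F \<partial>unit_leb)))"

definition mu_abs :: "(real \<times> real \<Rightarrow> real) \<Rightarrow> (real \<times> real) measure" where
  "mu_abs C = kernel_measure (\<lambda>x. abs_part (markov_kernel C x))"

definition mu_dis :: "(real \<times> real \<Rightarrow> real) \<Rightarrow> (real \<times> real) measure" where
  "mu_dis C = kernel_measure (\<lambda>x. dis_part (markov_kernel C x))"

definition mu_sing :: "(real \<times> real \<Rightarrow> real) \<Rightarrow> (real \<times> real) measure" where
  "mu_sing C = kernel_measure (\<lambda>x. sing_part (markov_kernel C x))"

definition supp :: "'a::topological_space measure \<Rightarrow> 'a set" where
  "supp M = - \<Union>{U. open U \<and> emeasure M U = 0}"

lemma prob_space_unit_leb: "prob_space unit_leb"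
  unfolding unit_leb_def by (rule prob_space_uniform_measure) auto

lemma doubly_stochastic_imp_prob_space:
  assumes "doubly_stochastic M"
  shows "prob_space M"
proof -
  have s: "sets M = sets borel" and d: "distr M borel fst = unit_leb"
    using assms by (auto simp: doubly_stochastic_def)
  have f: "fst \<in> M \<rightarrow>\<^sub>M (borel :: real measure)"
    unfolding measurable_cong_sets[OF s refl] by (intro borel_measurable_continuous_onI continuous_intros)
  show ?thesis
    by (rule prob_space_distrD[OF f]) (simp add: d prob_space_unit_leb)
qed

lemma copula_bounds:
  assumes "copula C"
  shows "C \<in> extensional unit_square" and "p \<in> unit_square \<Longrightarrow> 0 \<le> C p \<and> C p \<le> 1"
  using assms doubly_stochastic_imp_prob_space
  by (auto simp: copula_def prob_space.prob_le_1)

lemma ev_copulas_subset_funspace: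
  "ev_copulas \<subseteq> mspace (funspace unit_square (euclidean_metric :: real metric))"
proof
  fix C assume "C \<in> ev_copulas"
  then have C: "copula C"
    by (simp add: ev_copulas_def)
  have "bounded (C ` unit_square)"
  proof (rule boundedI)
    fix v assume "v \<in> C ` unit_square"
    then show "norm v \<le> 1"
      using copula_bounds(2)[OF C] by auto
  qed
  with copula_bounds(1)[OF C]
  show "C \<in> mspace (funspace unit_square (euclidean_metric :: real metric))"
    by (simp add: Met_TC.fspace_def)
qed

lemma mspace_ev_metric: "mspace ev_metric = ev_copulas"
  using ev_copulas_subset_funspace by (auto simp: ev_metric_def)

lemma mdist_ev_metric:
  assumes "C \<in> ev_copulas" "D \<in> ev_copulas"
  shows "mdist ev_metric C D = (SUP p\<in>unit_square. \<bar>C p - D p\<bar>)"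
  using assms ev_copulas_subset_funspace
  by (auto simp: ev_metric_def Met_TC.fdist_def dist_real_def)

text \<open>Uniqueness of the objects introduced by definite descriptions above.\<close>

lemma doubly_stochastic_outside:
  assumes "doubly_stochastic M"
  shows "AE p in M. p \<in> unit_square"
proof -
  have s: "sets M = sets borel" and d: "distr M borel fst = unit_leb" "distr M borel snd = unit_leb"
    using assms by (auto simp: doubly_stochastic_def)
  have f: "fst \<in> M \<rightarrow>\<^sub>M (borel :: real measure)" "snd \<in> M \<rightarrow>\<^sub>M (borel :: real measure)"
    unfolding measurable_cong_sets[OF s refl]
    by (intro borel_measurable_continuous_onI continuous_intros)+
  have "AE x in unit_leb. x \<in> {0..1}"
    unfolding unit_leb_def by (rule AE_uniform_measureI) auto
  then have "AE p in M. fst p \<in> {0..1}" "AE p in M. snd p \<in> {0..1}"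
    using AE_distrD[OF f(1)] AE_distrD[OF f(2)] unfolding d by blast+
  then show ?thesis
    by eventually_elim (auto simp: mem_Times_iff)
qed

lemma copula_measure_eqI:
  assumes M: "doubly_stochastic M" and N: "doubly_stochastic N"
    and eq: "\<And>x y. x \<in> {0..1} \<Longrightarrow> y \<in> {0..1} \<Longrightarrow>
               measure M ({0..x} \<times> {0..y}) = measure N ({0..x} \<times> {0..y})"
  shows "M = N"
proof -
  interpret M: prob_space M using M by (rule doubly_stochastic_imp_prob_space)
  interpret N: prob_space N using N by (rule doubly_stochastic_imp_prob_space)
  have sM: "sets M = sets borel" and sN: "sets N = sets borel"
    using M N by (auto simp: doubly_stochastic_def)
  have spM: "space M = UNIV" using sets_eq_imp_space_eq[OF sM] by simp
  have box: "{..x} \<times> {..y} \<in> sets borel" for x y :: real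
    by (intro borel_closed closed_Times) auto
  have box': "{0..x} \<times> {0..y} \<in> sets borel" for x y :: real
    by (intro borel_closed closed_Times) auto
  have sub: "emeasure L ({..x} \<times> {..y}) = emeasure L ({0..min x 1} \<times> {0..min y 1})"
    if L: "doubly_stochastic L" for L and x y :: real
  proof (rule emeasure_eq_AE)
    show "AE p in L. (p \<in> {..x} \<times> {..y}) = (p \<in> {0..min x 1} \<times> {0..min y 1})"
      using doubly_stochastic_outside[OF L] by eventually_elim auto
    show "{..x} \<times> {..y} \<in> sets L" "{0..min x 1} \<times> {0..min y 1} \<in> sets L"
      using L box box' by (auto simp: doubly_stochastic_def)
  qed
  have *: "emeasure M ({..x} \<times> {..y}) = emeasure N ({..x} \<times> {..y})" for x y :: real
  proof (cases "0 \<le> x \<and> 0 \<le> y")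
    case True
    then show ?thesis
      unfolding sub[OF M, of x y] sub[OF N, of x y]
      using eq[of "min x 1" "min y 1"]
      by (simp add: M.emeasure_eq_measure N.emeasure_eq_measure)
  next
    case False
    then have "{0..min x 1} \<times> {0..min y 1} = ({} :: (real \<times> real) set)" by auto
    then show ?thesis unfolding sub[OF M, of x y] sub[OF N, of x y] by (simp only: emeasure_empty)
  qed
  let ?E = "range (\<lambda>p :: real \<times> real. {..p})"
  have atM: "{..p} = {..fst p} \<times> {..snd p}" for p :: "real \<times> real"
    by (auto simp: less_eq_prod_def)
  show ?thesis
  proof (rule measure_eqI_generator_eq[where E = ?E and \<Omega> = UNIV and A = "\<lambda>n. {..(real n, real n)}"])
    show "Int_stable ?E"
    proof (rule Int_stableI)
      fix a b assume "a \<in> ?E" "b \<in> ?E"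
      then obtain p q where "a = {..p}" "b = {..q}" by auto
      then have "a \<inter> b = {..(min (fst p) (fst q), min (snd p) (snd q))}"
        by (auto simp: less_eq_prod_def)
      then show "a \<inter> b \<in> ?E" by blast
    qed
    show "emeasure M X = emeasure N X" if "X \<in> ?E" for X
      using that * atM by auto
    show "sets M = sigma_sets UNIV ?E" "sets N = sigma_sets UNIV ?E"
      unfolding sM sN
      by (auto simp: borel_eq_atMost image_def intro!: arg_cong[where f = "sigma_sets UNIV"])
    show "(\<Union>n. {..(real n, real n)}) = UNIV"
    proof -
      have "\<exists>n. p \<le> (real n, real n)" for p :: "real \<times> real"
      proof -
        obtain n where "max (fst p) (snd p) \<le> real n" using real_arch_simple by blast
        then show ?thesis by (auto simp: less_eq_prod_def)
      qed
      then show ?thesis by auto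
    qed
  qed auto
qed

lemma lebesgue_decomposition_unique:
  assumes 1: "lebesgue_decomposition M A D S" and 2: "lebesgue_decomposition M A' D' S'"
  shows "A = A' \<and> D = D' \<and> S = S'"
proof -
  have atom: "emeasure D {y} = emeasure M {y}"
    if "lebesgue_decomposition M A D S" for A D S :: "real measure" and y
  proof -
    have "{y} \<in> null_sets lborel" by (auto simp: null_sets_def)
    then have "{y} \<in> null_sets A"
      using that unfolding lebesgue_decomposition_def absolutely_continuous_def by blast
    with that show ?thesis
      by (simp add: lebesgue_decomposition_def singular_measure_def null_sets_def)
  qed
  have fin: "emeasure X F \<noteq> \<infinity>" if "X \<in> {A, D, S, A', D', S'}" for X F
  proof -
    have "finite_measure X"
      using that 1 2 unfolding lebesgue_decomposition_def by blast
    then show ?thesis by (simp add: finite_measure.emeasure_finite)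
  qed
  obtain N N' where N: "countable N" "emeasure D (- N) = 0" "countable N'" "emeasure D' (- N') = 0"
    using 1 2 unfolding lebesgue_decomposition_def discrete_measure_def by blast
  have sets: "sets A = sets borel" "sets D = sets borel" "sets S = sets borel"
    "sets A' = sets borel" "sets D' = sets borel" "sets S' = sets borel"
    using 1 2 by (auto simp: lebesgue_decomposition_def)
  have restr: "emeasure X F = emeasure X (F \<inter> (U \<union> V))"
    if "emeasure X (- U) = 0 \<or> emeasure X (- V) = 0" "sets X = sets borel" "F \<in> sets borel"
       "U \<in> sets borel" "V \<in> sets borel" for X :: "real measure" and F U V
  proof (rule emeasure_eq_AE)
    have "- (U \<union> V) \<in> null_sets X"
    proof (cases "emeasure X (- U) = 0")
      case True
      then have "- U \<in> null_sets X" using that by (auto simp: null_sets_def)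
      then show ?thesis by (rule null_sets_subset) (use that in auto)
    next
      case False
      then have "- V \<in> null_sets X" using that by (auto simp: null_sets_def)
      then show ?thesis by (rule null_sets_subset) (use that in auto)
    qed
    then have "AE x in X. x \<notin> - (U \<union> V)" by (rule AE_not_in)
    then show "AE x in X. (x \<in> F) = (x \<in> F \<inter> (U \<union> V))" by eventually_elim auto
  qed (use that in auto)
  have cb: "N \<in> sets borel" "N' \<in> sets borel"
    using N by (auto intro: sets.countable)
  have DD: "D = D'"
  proof (rule measure_eqI)
    fix F assume "F \<in> sets D"
    then have F: "F \<in> sets borel" using sets by simp
    have c: "countable (F \<inter> (N \<union> N'))" using N by auto
    have "emeasure D F = emeasure D (F \<inter> (N \<union> N'))"
      using restr[of D N N' F] N cb F sets by auto
    also have "\<dots> = (\<integral>\<^sup>+x. emeasure D {x} \<partial>count_space (F \<inter> (N \<union> N')))"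
      using c by (intro emeasure_countable_singleton) (auto simp: sets)
    also have "\<dots> = (\<integral>\<^sup>+x. emeasure D' {x} \<partial>count_space (F \<inter> (N \<union> N')))"
      using atom[OF 1] atom[OF 2] by simp
    also have "\<dots> = emeasure D' (F \<inter> (N \<union> N'))"
      using c by (intro emeasure_countable_singleton[symmetric]) (auto simp: sets)
    also have "\<dots> = emeasure D' F"
      using restr[of D' N N' F] N cb F sets by auto
    finally show "emeasure D F = emeasure D' F" .
  qed (simp add: sets)
  have AS: "emeasure A F + emeasure S F = emeasure A' F + emeasure S' F" if "F \<in> sets borel" for F
  proof -
    have "emeasure D F + (emeasure A F + emeasure S F) = emeasure D F + (emeasure A' F + emeasure S' F)"
      using 1 2 that unfolding lebesgue_decomposition_def DD by (metis add.assoc add.commute)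
    then show ?thesis using fin[of D F] by (simp add: ennreal_add_left_cancel)
  qed
  obtain U V where UV: "U \<in> null_sets lborel" "emeasure S (- U) = 0"
      "V \<in> null_sets lborel" "emeasure S' (- V) = 0"
    using 1 2 unfolding lebesgue_decomposition_def singular_measure_def by blast
  then have UVb: "U \<in> sets borel" "V \<in> sets borel" by (auto simp: null_sets_def)
  have SS: "S = S'"
  proof (rule measure_eqI)
    fix F assume "F \<in> sets S"
    then have F: "F \<in> sets borel" using sets by simp
    let ?G = "F \<inter> (U \<union> V)"
    have G: "?G \<in> sets borel" using F UVb by auto
    have "?G \<in> null_sets lborel"
      by (rule null_sets_subset[OF null_sets.Un[OF UV(1,3)]]) (use G in auto)
    then have "?G \<in> null_sets A" "?G \<in> null_sets A'"
      using 1 2 unfolding lebesgue_decomposition_def absolutely_continuous_def by blast+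
    then have "emeasure S ?G = emeasure S' ?G"
      using AS[OF G] by (auto simp: null_sets_def)
    moreover have "emeasure S F = emeasure S ?G" "emeasure S' F = emeasure S' ?G"
      using restr[of S U V F] restr[of S' U V F] UV UVb F sets by auto
    ultimately show "emeasure S F = emeasure S' F" by simp
  qed (simp add: sets)
  have "A = A'"
  proof (rule measure_eqI)
    fix F assume "F \<in> sets A"
    then have "emeasure S F + emeasure A F = emeasure S F + emeasure A' F"
      using AS[of F] sets unfolding SS by (simp add: add.commute)
    then show "emeasure A F = emeasure A' F"
      using fin[of S F] by (simp add: ennreal_add_left_cancel)
  qed (simp add: sets)
  with DD SS show ?thesis by simp
qed

end

theory Submission imports Defs begin

text \<open>Idea. Let \<open>C0\<close> be the extreme value copula
  \<open>C0 (x, y) = exp (- E (max (- ln x) (- ln y / T)))\<close> for a positive random variable \<open>T\<close> with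
  \<open>E (1 / T) = 1\<close>. Given \<open>X = x\<close>, the second coordinate under \<open>C0\<close> is the maximum of \<open>x powr T\<close> and an
  independent variable charging every interval at \<open>0\<close>; hence a set that is null for \<open>C0\<close> is missed,
  almost surely, by the random curve \<open>y = x powr T\<close>. The law of \<open>T\<close> is a mixture of multiples of
  atoms, of a singular law and of an absolutely continuous law, the multiples being all positive
  rationals, so that each of the three kinds of curves fills the square densely.

  An arbitrary extreme value copula \<open>C\<close> is approximated by the geometric mean
  \<open>D = C powr (1 - 1 / k) * C0 powr (1 / k)\<close>. By max-stability, \<open>D\<close> is the distribution function of
  the coordinatewise maximum of suitable powers of independent pairs distributed according to \<open>C\<close>
  and \<open>C0\<close>, and since \<open>C > 0\<close> on \<open>{0<..1}\<^sup>2\<close>, the pair from \<open>C0\<close> is the larger one with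
  positive probability: null sets of \<open>D\<close> are still missed by almost every curve. On the other hand
  the three parts of \<open>D\<close> are restrictions of its measure to Borel sets \<open>H\<close>, \<open>N - H\<close>, \<open>- N\<close>, where
  \<open>H\<close> is maximal with countable and \<open>N\<close> maximal with Lebesgue null vertical sections. The three kinds
  of curves lie almost surely in the respective sets, so each part charges every open rectangle.\<close>

section \<open>Kernels and semidirect products\<close>

text \<open>The kernel of \<open>D\<close> is not explicit, so nothing is computed from it;
  everything is phrased through Borel sets of measure zero. Such statements survive each
  construction: an equivalent change of measure, which achieves \<open>E (1 / T) = 1\<close>; taking
  a maximum, since the curve is attained with positive conditional probability; and the powers in
  \<open>D\<close>, since (x, y) -> (x^k, y^k) maps every curve y = x^t to itself and only moves x.
  Uniform closeness rests on \<open>x * y \<le> C0 (x, y)\<close>: with c and d the values of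
  \<open>C\<close> and \<open>C0\<close> at the k-th roots, max-stability gives C = c^k and D =
  c^(k-1) d, and c^2 \<le> d bounds the difference by 1/k. The singular law is that of c(u) for
  uniform u, where c is strictly increasing with range in a Lebesgue null set: injectivity rules out
  atoms, the range gives singularity. Rational multiples make each kind of curve dense for every
  fixed u, whatever the law itself looks like.\<close>

lemma unit_leb_eq_density: "unit_leb = density lborel (indicator {0..1})"
proof -
  have "indicator {0..1} x / 1 = (indicator {0..1} x :: ennreal)" for x :: real
    by (auto simp: indicator_def)
  then show ?thesis
    unfolding unit_leb_def uniform_measure_def by (intro density_cong) auto
qed

lemma sets_unit_leb [simp, measurable_cong]: "sets unit_leb = sets borel"
  by (simp add: unit_leb_eq_density)

lemma space_unit_leb [simp]: "space unit_leb = UNIV"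
  by (simp add: unit_leb_eq_density)

lemma AE_unit_leb: "(AE x in unit_leb. P x) \<longleftrightarrow> (AE x in lborel. x \<in> {0..1} \<longrightarrow> P x)"
  unfolding unit_leb_eq_density by (subst AE_density) (auto simp: indicator_def)

lemma nn_integral_unit_leb:
  assumes [measurable]: "f \<in> borel_measurable borel"
  shows "(\<integral>\<^sup>+x. f x \<partial>unit_leb) = (\<integral>\<^sup>+x\<in>{0..1}. f x \<partial>lborel)"
  unfolding unit_leb_eq_density by (subst nn_integral_density) (auto simp: mult.commute)

lemma emeasure_unit_leb:
  assumes "A \<in> sets borel"
  shows "emeasure unit_leb A = emeasure lborel (A \<inter> {0..1})"
  unfolding unit_leb_eq_density using assms
  by (simp add: emeasure_restricted Int_commute)

lemma emeasure_unit_leb_atMost: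
  assumes "0 \<le> x" "x \<le> 1"
  shows "emeasure unit_leb {..x} = ennreal x"
proof -
  have "{..x} \<inter> {0..1} = {0..x}" using assms by auto
  then show ?thesis using assms by (simp add: emeasure_unit_leb)
qed

lemma AE_unit_leb_interior: "AE x in unit_leb. x \<in> {0<..<1}"
proof -
  have "AE x in lborel. x \<noteq> (0::real)" "AE x in lborel. x \<noteq> (1::real)"
    by (rule AE_lborel_singleton)+
  then show ?thesis unfolding AE_unit_leb by eventually_elim auto
qed

lemma null_sets_lborel_imp_unit_leb: "N \<in> null_sets lborel \<Longrightarrow> N \<in> null_sets unit_leb"
  unfolding unit_leb_eq_density
  using absolutely_continuousI_density[of "indicator {0..1::real} :: real \<Rightarrow> ennreal" lborel]
  unfolding absolutely_continuous_def by auto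

lemma borel_Times: "A \<in> sets borel \<Longrightarrow> B \<in> sets borel \<Longrightarrow> A \<times> B \<in> sets borel"
  for A :: "'a :: second_countable_topology set" and B :: "'b :: second_countable_topology set"
  by (metis borel_prod pair_measureI)

lemma borel_section: "B \<in> sets borel \<Longrightarrow> Pair x -` B \<in> sets borel"
  for B :: "('a :: second_countable_topology \<times> 'b :: second_countable_topology) set"
  by (metis borel_prod sets_Pair1)

lemma borel_eq_sigma_rectangles:
  "sets (borel :: (real \<times> real) measure) =
     sigma_sets UNIV {A \<times> B |A B. A \<in> sets borel \<and> B \<in> sets borel}"
  using sets_pair_measure[of "borel :: real measure" "borel :: real measure"]
  unfolding borel_prod space_borel UNIV_Times_UNIV .

lemma measure_eqI_rectangles:
  fixes M N :: "(real \<times> real) measure"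
  assumes "sets M = sets borel" "sets N = sets borel" "finite_measure M"
    and eq: "\<And>E F. E \<in> sets borel \<Longrightarrow> F \<in> sets borel \<Longrightarrow> emeasure M (E \<times> F) = emeasure N (E \<times> F)"
  shows "M = N"
proof (rule measure_eqI_generator_eq)
  show "Int_stable {A \<times> B |A B. A \<in> sets (borel :: real measure) \<and> B \<in> sets (borel :: real measure)}"
    by (rule Int_stable_pair_measure_generator)
  show "emeasure M X = emeasure N X"
    if "X \<in> {A \<times> B |A B. A \<in> sets borel \<and> B \<in> sets borel}" for X
    using that eq by auto
  show "range (\<lambda>n::nat. UNIV) \<subseteq> {A \<times> B |A B. A \<in> sets (borel :: real measure) \<and> B \<in> sets (borel :: real measure)}"
    by (auto intro!: exI[of _ UNIV])
  show "emeasure M UNIV \<noteq> \<infinity>" for n :: nat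
    using finite_measure.emeasure_finite[OF assms(3)] by simp
qed (auto simp: assms borel_eq_sigma_rectangles)

text \<open>The joint law of a uniform first coordinate and a second one drawn from
  \<open>K x\<close>. As a monadic bind it is a probability measure by construction.\<close>

definition semidirect :: "(real \<Rightarrow> real measure) \<Rightarrow> (real \<times> real) measure" where
  "semidirect K = unit_leb \<bind> (\<lambda>x. distr (K x) borel (Pair x))"

lemma unit_leb_in_prob_algebra: "unit_leb \<in> space (prob_algebra borel)"
  by (simp add: space_prob_algebra prob_space_unit_leb)

context
  fixes K :: "real \<Rightarrow> real measure"
  assumes K [measurable]: "K \<in> borel \<rightarrow>\<^sub>M prob_algebra borel"
begin

lemma kernel_sets [simp]: "sets (K x) = sets borel"
  and kernel_space [simp]: "space (K x) = UNIV"
  and kernel_prob_space: "prob_space (K x)"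
  using measurable_space[OF K, of x] sets_eq_imp_space_eq[of "K x" borel]
  by (auto simp: space_prob_algebra)

lemma semidirect_kernel: "(\<lambda>x. distr (K x) borel (Pair x)) \<in> borel \<rightarrow>\<^sub>M prob_algebra borel"
proof (rule measurable_distr_prob_space2)
  show "case_prod Pair \<in> borel \<Otimes>\<^sub>M (borel :: real measure) \<rightarrow>\<^sub>M (borel :: (real \<times> real) measure)"
    by (simp add: borel_prod)
qed (rule K)

lemma sets_semidirect [simp, measurable_cong]: "sets (semidirect K) = sets borel"
  unfolding semidirect_def
  by (rule sets_bind) auto

lemma space_semidirect [simp]: "space (semidirect K) = UNIV"
  using sets_eq_imp_space_eq[OF sets_semidirect] by simp

lemma prob_space_semidirect: "prob_space (semidirect K)"
  unfolding semidirect_def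
  by (rule prob_space_bind'[OF unit_leb_in_prob_algebra semidirect_kernel])

lemma measurable_kernel_section:
  "B \<in> sets borel \<Longrightarrow> (\<lambda>x. emeasure (K x) (Pair x -` B)) \<in> borel_measurable borel"
  for B :: "(real \<times> real) set"
proof (rule emeasure_measurable_subprob_algebra2)
  assume "B \<in> sets borel"
  moreover have "(SIGMA x:space borel. Pair x -` B) = B" by auto
  ultimately show "(SIGMA x:space borel. Pair x -` B) \<in> sets (borel \<Otimes>\<^sub>M borel)"
    unfolding borel_prod by simp
  show "K \<in> borel \<rightarrow>\<^sub>M subprob_algebra borel"
    by (rule measurable_prob_algebraD[OF K])
qed

lemma emeasure_semidirect:
  assumes B: "B \<in> sets borel"
  shows "emeasure (semidirect K) B = (\<integral>\<^sup>+x. emeasure (K x) (Pair x -` B) \<partial>unit_leb)"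
proof -
  have "emeasure (semidirect K) B = (\<integral>\<^sup>+x. emeasure (distr (K x) borel (Pair x)) B \<partial>unit_leb)"
    unfolding semidirect_def
    by (rule emeasure_bind_prob_algebra[OF unit_leb_in_prob_algebra semidirect_kernel B])
  also have "\<dots> = (\<integral>\<^sup>+x. emeasure (K x) (Pair x -` B) \<partial>unit_leb)"
  proof (rule nn_integral_cong)
    fix x :: real
    have "Pair x \<in> borel \<rightarrow>\<^sub>M (borel :: (real \<times> real) measure)"
      using measurable_Pair1'[of x "borel :: real measure" "borel :: real measure"] by (simp add: borel_prod)
    then have "Pair x \<in> K x \<rightarrow>\<^sub>M (borel :: (real \<times> real) measure)"
      by (simp cong: measurable_cong_sets)
    then show "emeasure (distr (K x) borel (Pair x)) B = emeasure (K x) (Pair x -` B)"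
      using B by (subst emeasure_distr) auto
  qed
  finally show ?thesis .
qed

lemma emeasure_semidirect_Times:
  assumes "E \<in> sets borel" "F \<in> sets borel"
  shows "emeasure (semidirect K) (E \<times> F) = (\<integral>\<^sup>+x\<in>E. emeasure (K x) F \<partial>unit_leb)"
  using assms
  by (subst emeasure_semidirect) (auto intro!: borel_Times nn_integral_cong simp: indicator_def)

lemma distr_fst_semidirect: "distr (semidirect K) borel fst = unit_leb"
proof (rule measure_eqI)
  fix A assume "A \<in> sets (distr (semidirect K) borel fst)"
  then have A: "A \<in> sets borel" by simp
  have fst: "fst \<in> semidirect K \<rightarrow>\<^sub>M (borel :: real measure)"
    by (simp cong: measurable_cong_sets add: borel_prod[symmetric])
  have "emeasure (distr (semidirect K) borel fst) A = emeasure (semidirect K) (A \<times> UNIV)"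
    using A fst by (subst emeasure_distr) (auto intro!: arg_cong[where f="emeasure (semidirect K)"])
  also have "\<dots> = (\<integral>\<^sup>+x\<in>A. 1 \<partial>unit_leb)"
    using A prob_space.emeasure_space_1[OF kernel_prob_space]
    by (subst emeasure_semidirect_Times) auto
  finally show "emeasure (distr (semidirect K) borel fst) A = emeasure unit_leb A"
    using A by simp
qed simp

end

section \<open>Disintegration of doubly stochastic measures\<close>

text \<open>If \<open>g < f\<close> held on a set of positive measure, the integral of
  \<open>g\<close> over that set would be strictly smaller. Finiteness of the integral of
  \<open>f\<close> keeps this inequality strict.\<close>

lemma AE_le_of_set_nn_integral_le:
  fixes f g :: "'a \<Rightarrow> ennreal"
  assumes [measurable]: "f \<in> borel_measurable M" "g \<in> borel_measurable M"
    and fin: "(\<integral>\<^sup>+x. f x \<partial>M) \<noteq> \<infinity>"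
    and le: "\<And>E. E \<in> sets M \<Longrightarrow> (\<integral>\<^sup>+x\<in>E. f x \<partial>M) \<le> (\<integral>\<^sup>+x\<in>E. g x \<partial>M)"
  shows "AE x in M. f x \<le> g x"
proof -
  let ?E = "{x \<in> space M. g x < f x}"
  have E [measurable]: "?E \<in> sets M" by measurable
  have g_le: "(\<integral>\<^sup>+x\<in>?E. g x \<partial>M) \<le> (\<integral>\<^sup>+x. f x \<partial>M)"
    by (intro nn_integral_mono) (auto simp: indicator_def)
  have "AE x in M. f x * indicator ?E x \<le> g x * indicator ?E x"
  proof (rule ccontr)
    assume "\<not> ?thesis"
    moreover have "AE x in M. g x * indicator ?E x \<le> f x * indicator ?E x"
      by (auto simp: indicator_def)
    ultimately have "(\<integral>\<^sup>+x\<in>?E. g x \<partial>M) < (\<integral>\<^sup>+x\<in>?E. f x \<partial>M)"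
      using g_le fin by (intro nn_integral_less) (auto simp: top.extremum_unique)
    with le[OF E] show False by simp
  qed
  with AE_space show ?thesis
    by eventually_elim (metis (no_types, lifting) indicator_simps(1) mem_Collect_eq mult.right_neutral not_le_imp_less)
qed

lemma AE_eq_of_set_nn_integral_eq:
  fixes f g :: "'a \<Rightarrow> ennreal"
  assumes [measurable]: "f \<in> borel_measurable M" "g \<in> borel_measurable M"
    and fin: "(\<integral>\<^sup>+x. f x \<partial>M) \<noteq> \<infinity>"
    and eq: "\<And>E. E \<in> sets M \<Longrightarrow> (\<integral>\<^sup>+x\<in>E. f x \<partial>M) = (\<integral>\<^sup>+x\<in>E. g x \<partial>M)"
  shows "AE x in M. f x = g x"
proof -
  have *: "(\<integral>\<^sup>+x\<in>space M. h x \<partial>M) = (\<integral>\<^sup>+x. h x \<partial>M)" for h :: "'a \<Rightarrow> ennreal"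
    by (intro nn_integral_cong) auto
  have "(\<integral>\<^sup>+x. g x \<partial>M) \<noteq> \<infinity>"
    using fin eq[of "space M"] by (simp add: *)
  then have "AE x in M. f x \<le> g x" "AE x in M. g x \<le> f x"
    using eq fin by (auto intro!: AE_le_of_set_nn_integral_le)
  then show ?thesis by eventually_elim auto
qed

text \<open>Distribution functions are right continuous, so their values at rationals determine
  them. Countably many half-lines matter where equalities hold only for almost every
  \<open>x\<close> and must share one exceptional set.\<close>

lemma finite_borel_measure_eqI:
  assumes "finite_borel_measure M" "finite_borel_measure N"
    and eq: "\<And>q. q \<in> \<rat> \<Longrightarrow> emeasure M {..q} = emeasure N {..q}"
  shows "M = N"
proof (rule cdf_unique'[OF assms(1,2)], rule ext)
  fix y
  interpret M: finite_borel_measure M by fact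
  interpret N: finite_borel_measure N by fact
  obtain q :: "nat \<Rightarrow> real" where q: "\<And>n. q n \<in> \<rat>" "\<And>n. y < q n" "q \<longlonglongrightarrow> y"
  proof -
    have "\<exists>q\<in>\<rat>. y < q \<and> q < y + 1 / real (Suc n)" for n
      by (intro Rats_dense_in_real) auto
    then obtain q where q: "\<And>n. q n \<in> \<rat> \<and> y < q n \<and> q n < y + 1 / real (Suc n)" by metis
    have "(\<lambda>n. y + 1 / real (Suc n)) \<longlonglongrightarrow> y + 0"
      by (intro tendsto_intros LIMSEQ_Suc[OF lim_1_over_n])
    then have "q \<longlonglongrightarrow> y"
      by (intro tendsto_sandwich[of "\<lambda>_. y" q _ "\<lambda>n. y + 1 / real (Suc n)"])
         (use q in \<open>auto intro!: always_eventually less_imp_le\<close>)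
    with q that show thesis by blast
  qed
  have "filterlim q (at_right y) sequentially"
    using q by (auto simp: filterlim_at intro!: always_eventually)
  moreover have "(cdf M \<longlongrightarrow> cdf M y) (at_right y)" "(cdf N \<longlongrightarrow> cdf N y) (at_right y)"
    using M.cdf_is_right_cont N.cdf_is_right_cont by (auto simp: continuous_within)
  ultimately have "(\<lambda>n. cdf M (q n)) \<longlonglongrightarrow> cdf M y" "(\<lambda>n. cdf N (q n)) \<longlonglongrightarrow> cdf N y"
    by (auto intro: filterlim_compose)
  moreover have "cdf M (q n) = cdf N (q n)" for n
    using eq[OF q(1)] by (simp add: cdf_def measure_def)
  ultimately show "cdf M y = cdf N y"
    using LIMSEQ_unique by auto
qed

lemma measurable_fst_snd_borel [measurable]:
  "fst \<in> (borel :: (real \<times> real) measure) \<rightarrow>\<^sub>M (borel :: real measure)"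
  "snd \<in> (borel :: (real \<times> real) measure) \<rightarrow>\<^sub>M (borel :: real measure)"
  by (intro borel_measurable_continuous_onI continuous_intros)+

lemma doubly_stochasticD:
  assumes "doubly_stochastic M"
  shows "sets M = sets borel" "space M = UNIV" "prob_space M"
    and "A \<in> sets borel \<Longrightarrow> emeasure M (A \<times> UNIV) = emeasure unit_leb A"
    and "A \<in> sets borel \<Longrightarrow> emeasure M (UNIV \<times> A) = emeasure unit_leb A"
proof -
  show s: "sets M = sets borel" and "prob_space M"
    using assms doubly_stochastic_imp_prob_space by (auto simp: doubly_stochastic_def)
  show sp: "space M = UNIV"
    using sets_eq_imp_space_eq[OF s] by simp
  have m: "fst \<in> M \<rightarrow>\<^sub>M (borel :: real measure)" "snd \<in> M \<rightarrow>\<^sub>M (borel :: real measure)"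
    by (simp_all cong: measurable_cong_sets[OF s refl])
  have *: "fst -` A = A \<times> UNIV" "snd -` A = UNIV \<times> A" for A :: "real set" by auto
  show "A \<in> sets borel \<Longrightarrow> emeasure M (A \<times> UNIV) = emeasure unit_leb A"
    "A \<in> sets borel \<Longrightarrow> emeasure M (UNIV \<times> A) = emeasure unit_leb A"
    using assms emeasure_distr[OF m(1), of A] emeasure_distr[OF m(2), of A]
    by (auto simp: doubly_stochastic_def sp *)
qed

lemma doubly_stochasticI:
  assumes s: "sets M = sets borel" and "prob_space M"
    and 1: "\<And>x. 0 \<le> x \<Longrightarrow> x \<le> 1 \<Longrightarrow> emeasure M ({..x} \<times> UNIV) = ennreal x"
    and 2: "\<And>x. 0 \<le> x \<Longrightarrow> x \<le> 1 \<Longrightarrow> emeasure M (UNIV \<times> {..x}) = ennreal x"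
  shows "doubly_stochastic M"
proof -
  interpret M: prob_space M by fact
  have sp: "space M = UNIV"
    using sets_eq_imp_space_eq[OF s] by simp
  have m: "fst \<in> M \<rightarrow>\<^sub>M (borel :: real measure)" "snd \<in> M \<rightarrow>\<^sub>M (borel :: real measure)"
    by (simp_all cong: measurable_cong_sets[OF s refl])
  have *: "fst -` A = A \<times> UNIV" "snd -` A = UNIV \<times> A" for A :: "real set" by auto
  have uni: "N = unit_leb" if N: "sets N = sets borel" "prob_space N"
    and e: "\<And>x. 0 \<le> x \<Longrightarrow> x \<le> 1 \<Longrightarrow> emeasure N {..x} = ennreal x" for N :: "real measure"
  proof (rule finite_borel_measure_eqI)
    interpret N: prob_space N by fact
    show "finite_borel_measure N" "finite_borel_measure unit_leb"
      using N(1) prob_space_unit_leb N.finite_measure_axioms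
      by (auto simp: finite_borel_measure_def finite_borel_measure_axioms_def prob_space.finite_measure)
    fix q :: real
    have "emeasure N {..q} = 0" "emeasure unit_leb {..q} = 0" if "q < 0"
    proof -
      have "emeasure N {..q} \<le> emeasure N {..0}"
        by (rule emeasure_mono) (use that N in auto)
      with e[of 0] show "emeasure N {..q} = 0" by simp
      have "{..q} \<inter> {0..1} = {}" using that by auto
      then show "emeasure unit_leb {..q} = 0" by (simp add: emeasure_unit_leb)
    qed
    moreover have "emeasure N {..q} = 1" "emeasure unit_leb {..q} = 1" if "1 < q"
    proof -
      have "emeasure N {..1} \<le> emeasure N {..q}"
        by (rule emeasure_mono) (use that N in auto)
      with e[of 1] N.emeasure_le_1[of "{..q}"] show "emeasure N {..q} = 1" by auto
      have "{..q} \<inter> {0..1} = {0..1}" using that by auto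
      then show "emeasure unit_leb {..q} = 1" by (simp add: emeasure_unit_leb)
    qed
    ultimately show "emeasure N {..q} = emeasure unit_leb {..q}"
      using e[of q] emeasure_unit_leb_atMost[of q] by (cases "q < 0"; cases "1 < q") auto
  qed
  show ?thesis
    unfolding doubly_stochastic_def
  proof (intro conjI)
    show "distr M borel fst = unit_leb" "distr M borel snd = unit_leb"
      using m 1 2 by (auto intro!: uni M.prob_space_distr simp: emeasure_distr sp *)
  qed (rule s)
qed

text \<open>Serves both constructions of kernels: the regularised densities in
  \<open>disintegration\<close> and the explicit \<open>cop_cdf\<close>. The hypotheses are required
  for every \<open>x\<close>, hence the effort there to remove exceptional points.\<close>

lemma interval_measure_kernel:
  fixes F :: "real \<Rightarrow> real \<Rightarrow> real"
  assumes F_mono: "\<And>x y y'. y \<le> y' \<Longrightarrow> F x y \<le> F x y'"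
    and F_cont: "\<And>x a. continuous (at_right a) (F x)"
    and F_neg: "\<And>x y. y < 0 \<Longrightarrow> F x y = 0"
    and F_ge1: "\<And>x y. 1 \<le> y \<Longrightarrow> F x y = 1"
    and F_meas: "\<And>y. (\<lambda>x. F x y) \<in> borel_measurable borel"
  shows "(\<lambda>x. interval_measure (F x)) \<in> borel \<rightarrow>\<^sub>M prob_algebra borel"
    and "emeasure (interval_measure (F x)) {..y} = ennreal (F x y)"
    and "emeasure (interval_measure (F x)) {0..1} = 1"
proof -
  let ?K = "\<lambda>x. interval_measure (F x)"
  have F_bot: "(F x \<longlongrightarrow> 0) at_bot" for x
    by (rule tendsto_eventually) (auto intro!: eventually_at_bot_linorderI[of "-1"] F_neg)
  have F_top: "(F x \<longlongrightarrow> 1) at_top" for x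
    by (rule tendsto_eventually) (auto intro!: eventually_at_top_linorderI[of 1] F_ge1)
  have K_dist: "real_distribution (?K x)" for x
    by (rule real_distribution_interval_measure) (use F_mono F_cont F_bot F_top in auto)
  have K_F: "emeasure (?K x) {..y} = ennreal (F x y)" for x y
  proof -
    interpret real_distribution "?K x" by (rule K_dist)
    have "cdf (?K x) = F x"
      by (rule cdf_interval_measure) (use F_mono F_cont F_bot in auto)
    then show ?thesis by (simp add: cdf_def emeasure_eq_measure fun_eq_iff)
  qed
  have K_meas: "?K \<in> borel \<rightarrow>\<^sub>M prob_algebra borel"
  proof (rule measurable_prob_algebra_generated)
    show "sets borel = sigma_sets UNIV (range (\<lambda>a::real. {..a}))"
      by (simp add: borel_eq_atMost)
    show "Int_stable (range (\<lambda>a::real. {..a}))"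
      by (auto simp: Int_stable_def)
    show "range (\<lambda>a::real. {..a}) \<subseteq> Pow UNIV" by simp
    show "prob_space (?K a)" "sets (?K a) = sets borel" for a
      using K_dist[of a] by (auto simp: real_distribution_def)
    show "(\<lambda>a. emeasure (?K a) A) \<in> borel_measurable borel" if "A \<in> range (\<lambda>a::real. {..a})" for A
      using that F_meas by (auto simp: K_F)
  qed
  have K_unit: "emeasure (?K x) {0..1} = 1" for x
  proof -
    interpret real_distribution "?K x" by (rule K_dist)
    have "{..<0} = (\<Union>n. {..- (1 / real (Suc n))})"
    proof -
      have "\<exists>n. v \<le> - (1 / real (Suc n))" if "v < 0" for v :: real
      proof -
        have "0 < - v" using that by simp
        then obtain n where "1 / real (Suc n) < - v" by (rule nat_approx_posE)
        then have "v \<le> - (1 / real (Suc n))" by linarith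
        then show ?thesis ..
      qed
      moreover have "v < 0" if "v \<le> - (1 / real (Suc n))" for v :: real and n
        by (rule le_less_trans[OF that]) simp
      ultimately show ?thesis by blast
    qed
    moreover have "emeasure (?K x) (\<Union>n. {..- (1 / real (Suc n))}) = 0"
      by (rule emeasure_UN_eq_0) (auto simp: K_F F_neg)
    ultimately have z: "{..<0} \<in> null_sets (?K x)" by auto
    have "emeasure (?K x) {0..1} = emeasure (?K x) ({..1} - {..<0})"
      by (rule arg_cong[where f="emeasure (?K x)"]) auto
    also have "\<dots> = emeasure (?K x) {..1}"
      by (rule emeasure_Diff_null_set[OF z]) auto
    finally show ?thesis by (simp add: K_F F_ge1)
  qed
  from K_meas K_F K_unit show "?K \<in> borel \<rightarrow>\<^sub>M prob_algebra borel"
    "emeasure (?K x) {..y} = ennreal (F x y)" "emeasure (?K x) {0..1} = 1"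
    by auto
qed

text \<open>For each \<open>y\<close> the conditional distribution function at \<open>y\<close> is a
  Radon-Nikodym density, determined only up to a null set depending on \<open>y\<close>. Infima over
  rationals to the right yield versions that are monotone and right continuous for every
  \<open>x\<close>.\<close>

lemma disintegration:
  assumes M: "doubly_stochastic M"
  obtains K where "K \<in> borel \<rightarrow>\<^sub>M prob_algebra borel" "\<And>x. emeasure (K x) {0..1} = 1"
    "semidirect K = M"
proof -
  note s [simp, measurable_cong] = doubly_stochasticD(1)[OF M] and sp [simp] = doubly_stochasticD(2)[OF M]
  interpret M: prob_space M by (rule doubly_stochasticD[OF M])
  interpret U: prob_space unit_leb by (rule prob_space_unit_leb)
  have fst [measurable]: "fst \<in> M \<rightarrow>\<^sub>M (borel :: real measure)" and snd [measurable]: "snd \<in> M \<rightarrow>\<^sub>M (borel :: real measure)"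
    by (simp_all cong: measurable_cong_sets[OF s refl])
  have rect [measurable]: "A \<times> B \<in> sets M" if "A \<in> sets borel" "B \<in> sets borel" for A B :: "real set"
    using that by (simp add: borel_Times)
  \<comment> \<open>The measure sending \<open>E\<close> to the mass of
    \<open>E \<times> {..y}\<close>; its density is the conditional distribution function at
    \<open>y\<close>.\<close>
  define N where "N y = distr (density M (indicator (UNIV \<times> {..y}))) borel fst" for y :: real
  have N: "emeasure (N y) E = emeasure M (E \<times> {..y})" if "E \<in> sets borel" for y E
  proof -
    have "UNIV \<times> {..y} \<inter> fst -` E = E \<times> {..y}" by auto
    moreover have "(fst -` E :: (real \<times> real) set) \<in> sets borel"
      using measurable_sets[OF fst, of E] that by simp
    ultimately show ?thesis unfolding N_def using that
      by (subst emeasure_distr) (auto simp: emeasure_restricted borel_Times)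
  qed
  have "\<exists>f\<in>borel_measurable borel. density unit_leb f = N y" for y
  proof -
    have "absolutely_continuous unit_leb (N y)"
      unfolding absolutely_continuous_def
    proof
      fix E assume E: "E \<in> null_sets unit_leb"
      then have "emeasure M (E \<times> UNIV) = 0"
        using doubly_stochasticD(4)[OF M, of E] by (auto simp: null_sets_def)
      moreover have "emeasure (N y) E \<le> emeasure M (E \<times> UNIV)"
        using E by (subst N) (auto intro!: emeasure_mono simp: null_sets_def borel_Times)
      ultimately show "E \<in> null_sets (N y)" using E by (auto simp: null_sets_def N_def)
    qed
    then show ?thesis
      using U.Radon_Nikodym[of "N y"] by (auto simp: N_def cong: measurable_cong_sets)
  qed
  then obtain f where f [measurable]: "\<And>y. f y \<in> borel_measurable borel" and "\<And>y. density unit_leb (f y) = N y"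
    by metis
  then have f_int: "(\<integral>\<^sup>+x\<in>E. f y x \<partial>unit_leb) = emeasure M (E \<times> {..y})" if "E \<in> sets borel" for E y
    using emeasure_density[of "f y" unit_leb E] N[OF that] that by simp
  have fin: "(\<integral>\<^sup>+x. f y x \<partial>unit_leb) \<noteq> \<infinity>" for y
    using f_int[of UNIV y] by simp
  have one_int: "(\<integral>\<^sup>+x\<in>E. 1 \<partial>unit_leb) = emeasure M (E \<times> UNIV)" if "E \<in> sets borel" for E
    using that doubly_stochasticD(4)[OF M] by simp
  have AE_mono: "AE x in unit_leb. f y x \<le> f y' x" if "y \<le> y'" for y y'
    using that fin by (intro AE_le_of_set_nn_integral_le) (auto simp: f_int intro!: emeasure_mono borel_Times)
  have AE_le1: "AE x in unit_leb. f y x \<le> 1" for y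
  proof (rule AE_le_of_set_nn_integral_le)
    fix E assume "E \<in> sets unit_leb"
    then have E: "E \<in> sets borel" by simp
    show "(\<integral>\<^sup>+x\<in>E. f y x \<partial>unit_leb) \<le> (\<integral>\<^sup>+x\<in>E. 1 \<partial>unit_leb)"
      unfolding f_int[OF E] one_int[OF E] by (rule emeasure_mono) (use E in \<open>auto intro: borel_Times\<close>)
  qed (use fin in auto)
  note out = doubly_stochastic_outside[OF M]
  have AE_ge1: "AE x in unit_leb. 1 \<le> f y x" if "1 < y" for y
  proof (rule AE_le_of_set_nn_integral_le)
    fix E assume "E \<in> sets unit_leb"
    then have E: "E \<in> sets borel" by simp
    have "emeasure M (E \<times> UNIV) = emeasure M (E \<times> {..y})"
      by (rule emeasure_eq_AE) (use E out that in \<open>auto intro: borel_Times elim!: eventually_mono\<close>)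
    then show "(\<integral>\<^sup>+x\<in>E. 1 \<partial>unit_leb) \<le> (\<integral>\<^sup>+x\<in>E. f y x \<partial>unit_leb)"
      unfolding f_int[OF E] one_int[OF E] by simp
  qed (use U.emeasure_space_1 in auto)
  have AE_le0: "AE x in unit_leb. f y x \<le> 0" if "y < 0" for y
  proof (rule AE_le_of_set_nn_integral_le)
    fix E assume "E \<in> sets unit_leb"
    then have E: "E \<in> sets borel" by simp
    have "emeasure M (E \<times> {..y}) = emeasure M {}"
      by (rule emeasure_eq_AE) (use E out that in \<open>auto intro: borel_Times elim!: eventually_mono\<close>)
    then show "(\<integral>\<^sup>+x\<in>E. f y x \<partial>unit_leb) \<le> (\<integral>\<^sup>+x\<in>E. 0 \<partial>unit_leb)"
      unfolding f_int[OF E] by simp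
  qed (use fin in auto)
  \<comment> \<open>\<open>f q\<close> is changed on a null set so that the values 0 and 1 outside
    the unit interval are exact for every \<open>x\<close>. The value 1 is not forced at
    \<open>q = 1\<close>: for \<open>y \<ge> 1\<close> the infimum below only sees
    \<open>q > 1\<close>.\<close>
  define G where "G q x = (if q < 0 then 0 else if q > 1 then 1 else min 1 (f q x))" for q x
  have G_meas [measurable]: "G q \<in> borel_measurable borel" for q
    unfolding G_def by measurable
  have G_le1: "G q x \<le> 1" for q x by (auto simp: G_def)
  have AE_G: "AE x in unit_leb. G q x = f q x" for q
  proof -
    consider "q < 0" | "q > 1" | "0 \<le> q" "q \<le> 1" by linarith
    then show ?thesis
    proof cases
      case 1
      show ?thesis using AE_le0[OF 1] by eventually_elim (use 1 in \<open>auto simp: G_def\<close>)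
    next
      case 2
      show ?thesis using AE_ge1[OF 2] AE_le1[of q] by eventually_elim (use 2 in \<open>auto simp: G_def\<close>)
    next
      case 3
      show ?thesis using AE_le1[of q] by eventually_elim (use 3 in \<open>auto simp: G_def min_def\<close>)
    qed
  qed
  \<comment> \<open>An infimum over countably many \<open>q\<close> stays measurable, and since
    \<open>q\<close> runs strictly to the right of \<open>y\<close>, it is right continuous in
    \<open>y\<close> at every \<open>x\<close>.\<close>
  define g where "g y x = (INF q\<in>{q\<in>\<rat>. y < q}. G q x)" for y x
  have ctb: "countable {q\<in>\<rat>. y < q}" for y :: real
    by (rule countable_subset[OF _ countable_rat]) auto
  have g_meas [measurable]: "g y \<in> borel_measurable borel" for y
    unfolding g_def using ctb by measurable
  have ne: "{q\<in>\<rat>. y < q} \<noteq> {}" for y :: real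
    using Rats_dense_in_real[of y "y + 1"] by auto
  have g_le: "g y x \<le> G q x" if "q \<in> \<rat>" "y < q" for q x y
    unfolding g_def using that by (intro INF_lower) auto
  have g_le1: "g y x \<le> 1" for y x
    using ne[of y] g_le[of _ y x] G_le1[of _ x] by (blast intro: order_trans)
  have g_mono: "g y x \<le> g y' x" if "y \<le> y'" for y y' x
    unfolding g_def by (rule INF_superset_mono) (use that in auto)
  \<comment> \<open>Almost everywhere \<open>g y\<close> lies between \<open>f y\<close> and every
    \<open>f q\<close> with rational \<open>q > y\<close>; letting \<open>z\<close> decrease to
    \<open>y\<close> closes the gap by continuity of \<open>M\<close> from above.\<close>
  have g_int: "(\<integral>\<^sup>+x\<in>E. g y x \<partial>unit_leb) = emeasure M (E \<times> {..y})" if E: "E \<in> sets borel" for E y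
  proof (rule antisym)
    have "AE x in unit_leb. \<forall>q\<in>{q\<in>\<rat>. y < q}. f y x \<le> G q x"
    proof (subst AE_ball_countable[OF ctb], intro ballI)
      fix q assume "q \<in> {q\<in>\<rat>. y < q}"
      then show "AE x in unit_leb. f y x \<le> G q x"
        using AE_mono[of y q] AE_G[of q] by auto
    qed
    then have "AE x in unit_leb. f y x \<le> g y x"
      by eventually_elim (auto simp: g_def intro!: INF_greatest)
    then have "(\<integral>\<^sup>+x\<in>E. f y x \<partial>unit_leb) \<le> (\<integral>\<^sup>+x\<in>E. g y x \<partial>unit_leb)"
      by (intro nn_integral_mono_AE) (auto elim!: eventually_mono simp: indicator_def)
    then show "emeasure M (E \<times> {..y}) \<le> (\<integral>\<^sup>+x\<in>E. g y x \<partial>unit_leb)"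
      by (simp add: f_int E)
    have upper: "(\<integral>\<^sup>+x\<in>E. g y x \<partial>unit_leb) \<le> emeasure M (E \<times> {..z})" if "y < z" for z
    proof -
      obtain q where q: "q \<in> \<rat>" "y < q" "q < z" using Rats_dense_in_real[OF \<open>y < z\<close>] by auto
      have "(\<integral>\<^sup>+x\<in>E. g y x \<partial>unit_leb) \<le> (\<integral>\<^sup>+x\<in>E. f q x \<partial>unit_leb)"
        using AE_G[of q]
        by (intro nn_integral_mono_AE) (auto elim!: eventually_mono simp: indicator_def intro!: order_trans[OF g_le[OF q(1,2)]])
      also have "\<dots> \<le> emeasure M (E \<times> {..z})"
        unfolding f_int[OF E] by (rule emeasure_mono) (use q E in \<open>auto intro: borel_Times\<close>)
      finally show ?thesis .
    qed
    have "(\<lambda>n. emeasure M (E \<times> {..y + 1 / real (Suc n)})) \<longlonglongrightarrow> emeasure M (\<Inter>n. E \<times> {..y + 1 / real (Suc n)})"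
    proof (rule Lim_emeasure_decseq)
      show "decseq (\<lambda>n. E \<times> {..y + 1 / real (Suc n)})"
        by (auto simp: decseq_def frac_le intro: order_trans)
    qed (use E in \<open>auto intro: borel_Times\<close>)
    moreover have "(\<Inter>n. E \<times> {..y + 1 / real (Suc n)}) = E \<times> {..y}"
    proof -
      have "v \<le> y" if "\<And>n. v \<le> y + 1 / real (Suc n)" for v
      proof (rule field_le_epsilon)
        fix e :: real assume "e > 0"
        then obtain n where "1 / real (Suc n) < e" by (metis nat_approx_posE)
        with that[of n] show "v \<le> y + e" by linarith
      qed
      then show ?thesis by (auto intro: order_trans)
    qed
    ultimately have "(\<lambda>n. emeasure M (E \<times> {..y + 1 / real (Suc n)})) \<longlonglongrightarrow> emeasure M (E \<times> {..y})"
      by simp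
    then show "(\<integral>\<^sup>+x\<in>E. g y x \<partial>unit_leb) \<le> emeasure M (E \<times> {..y})"
      by (rule LIMSEQ_le_const) (auto intro!: exI upper)
  qed
  define F where "F x y = enn2real (g y x)" for x y
  have gF: "g y x = ennreal (F x y)" for x y
    unfolding F_def using g_le1[of y x] by (subst ennreal_enn2real) (auto simp: less_top[symmetric] top_unique)
  have F_nonneg: "0 \<le> F x y" for x y by (simp add: F_def)
  have F_mono: "F x y \<le> F x y'" if "y \<le> y'" for x y y'
    using g_mono[OF that, of x] by (simp add: gF F_nonneg)
  have F_neg: "F x y = 0" if neg: "y < 0" for x y
  proof -
    obtain q where "q \<in> \<rat>" "y < q" "q < 0" using Rats_dense_in_real[OF neg] by auto
    then have "g y x \<le> 0" using g_le[of q y x] by (simp add: G_def)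
    then show ?thesis by (simp add: F_def)
  qed
  have F_ge1: "F x y = 1" if "1 \<le> y" for x y
  proof -
    have "1 \<le> g y x" unfolding g_def using that by (intro INF_greatest) (auto simp: G_def)
    with g_le1[of y x] have "g y x = 1" by simp
    then show ?thesis by (simp add: F_def)
  qed
  have F_cont: "continuous (at_right a) (F x)" for a x
  proof (subst continuous_at_right_real_increasing)
    show "F x u \<le> F x v" if "u \<le> v" for u v using F_mono[OF that] .
    show "\<forall>e>0. \<exists>d>0. F x (a + d) - F x a < e"
    proof (intro allI impI)
      fix e :: real assume "0 < e"
      then have "g a x < ennreal (F x a + e)" by (simp add: gF F_nonneg ennreal_less_iff)
      then obtain q where q: "q \<in> \<rat>" "a < q" "G q x < ennreal (F x a + e)"
        unfolding g_def INF_less_iff by auto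
      obtain z where z: "a < z" "z < q" using dense[OF q(2)] by auto
      have "ennreal (F x z) \<le> G q x" using g_le[OF q(1) z(2)] by (simp add: gF)
      with q have "ennreal (F x z) < ennreal (F x a + e)" by simp
      then have "F x z < F x a + e" by (simp add: ennreal_less_iff F_nonneg)
      then show "\<exists>d>0. F x (a + d) - F x a < e"
        by (intro exI[of _ "z - a"]) (use z in auto)
    qed
  qed
  define K where "K x = interval_measure (F x)" for x
  have "(\<lambda>x. F x y) \<in> borel_measurable borel" for y
    unfolding F_def by measurable
  note K = interval_measure_kernel[of F, OF F_mono F_cont F_neg F_ge1 this, folded K_def]
  have K_meas: "K \<in> borel \<rightarrow>\<^sub>M prob_algebra borel" and K_unit: "\<And>x. emeasure (K x) {0..1} = 1"
    and K_F: "\<And>x y. emeasure (K x) {..y} = g y x"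
    using K by (simp_all add: gF)
  have "semidirect K = M"
  proof (rule measure_eqI_rectangles)
    note [simp] = sets_semidirect[OF K_meas] space_semidirect[OF K_meas]
    show "finite_measure (semidirect K)"
      using prob_space_semidirect[OF K_meas] by (rule prob_space.finite_measure)
    fix E B :: "real set" assume E: "E \<in> sets borel" and B: "B \<in> sets borel"
    \<comment> \<open>For fixed \<open>E\<close> both sides are finite measures in the second
      coordinate, so agreement on half-lines, which is what \<open>g_int\<close> gives, extends to
      Borel sets.\<close>
    define slice where "slice L = distr (density L (indicator (E \<times> UNIV))) borel snd" for L :: "(real \<times> real) measure"
    have slice: "emeasure (slice L) B = emeasure L (E \<times> B)"
      if "sets L = sets borel" "B \<in> sets borel" for L and B
    proof -
      have "space L = UNIV" using sets_eq_imp_space_eq[OF that(1)] by simp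
      moreover have "snd \<in> L \<rightarrow>\<^sub>M (borel :: real measure)"
        by (simp cong: measurable_cong_sets[OF that(1) refl])
      moreover have "E \<times> UNIV \<inter> snd -` B = E \<times> B" by auto
      moreover have "snd -` B \<in> sets L"
        using measurable_sets[OF \<open>snd \<in> L \<rightarrow>\<^sub>M borel\<close> that(2)] \<open>space L = UNIV\<close> by simp
      ultimately show ?thesis
        unfolding slice_def using E that
        by (subst emeasure_distr) (auto simp: emeasure_restricted borel_Times)
    qed
    have fb: "finite_borel_measure (slice L)" if "sets L = sets borel" "prob_space L" for L
    proof -
      interpret prob_space L by fact
      have "emeasure (slice L) UNIV \<noteq> \<infinity>" using slice[OF that(1), of UNIV] by simp
      then have "finite_measure (slice L)" by (intro finite_measureI) (simp add: slice_def)
      then show ?thesis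
        by (simp add: finite_borel_measure_def finite_borel_measure_axioms_def slice_def)
    qed
    have "slice (semidirect K) = slice M"
    proof (rule finite_borel_measure_eqI)
      fix q :: real
      show "emeasure (slice (semidirect K)) {..q} = emeasure (slice M) {..q}"
        using E by (simp add: slice emeasure_semidirect_Times[OF K_meas] K_F g_int)
    qed (use fb prob_space_semidirect[OF K_meas] M.prob_space_axioms in auto)
    then show "emeasure (semidirect K) (E \<times> B) = emeasure M (E \<times> B)"
      using slice[of "semidirect K" B] slice[of M B] B by simp
  qed (simp_all add: sets_semidirect[OF K_meas])
  with K_meas K_unit that show thesis by blast
qed

section \<open>The three parts as restrictions of the copula measure\<close>

text \<open>Exhaustion: the union of a sequence whose measures approach the supremum attains it, so
  adjoining a further member \<open>W\<close> adds no mass.\<close>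

lemma (in finite_measure) ex_maximal_of_sigma_ideal:
  assumes sub: "\<N> \<subseteq> sets M" and ne: "\<N> \<noteq> {}"
    and UN: "\<And>A :: nat \<Rightarrow> 'a set. range A \<subseteq> \<N> \<Longrightarrow> (\<Union>i. A i) \<in> \<N>"
  obtains N where "N \<in> \<N>" "\<And>W. W \<in> \<N> \<Longrightarrow> emeasure M (W - N) = 0"
proof -
  obtain e :: "nat \<Rightarrow> ennreal" where e: "range e \<subseteq> emeasure M ` \<N>" "(SUP W\<in>\<N>. emeasure M W) = (SUP n. e n)"
    using ennreal_SUP_countable_SUP[OF ne, of "emeasure M"] by metis
  then have "\<forall>n. \<exists>W\<in>\<N>. e n = emeasure M W" by blast
  then obtain A where A: "\<And>n. A n \<in> \<N>" "\<And>n. e n = emeasure M (A n)" by metis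
  let ?N = "\<Union>n. A n"
  have N: "?N \<in> \<N>" by (rule UN) (use A in auto)
  show thesis
  proof (rule that[OF N])
    fix W assume W: "W \<in> \<N>"
    \<comment> \<open>Closure is assumed for sequences, so the union of \<open>W\<close> and
      \<open>?N\<close> is written as the union of one.\<close>
    let ?A = "\<lambda>i::nat. if i = 0 then W else ?N"
    have "(\<Union>i. ?A i) = W \<union> ?N" by (auto split: if_splits intro: exI[of _ "Suc 0"])
    moreover have "(\<Union>i. ?A i) \<in> \<N>" by (rule UN) (use W N in auto)
    ultimately have "emeasure M (W \<union> ?N) \<le> (SUP W\<in>\<N>. emeasure M W)" by (auto intro: SUP_upper)
    also have "\<dots> \<le> emeasure M ?N"
      unfolding e(2) A(2) by (rule SUP_least, rule emeasure_mono) (use sub N in auto)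
    finally have le: "emeasure M (W \<union> ?N) \<le> emeasure M ?N" .
    have "emeasure M (W \<union> ?N) = emeasure M (?N \<union> (W - ?N))" by (rule arg_cong[where f="emeasure M"]) auto
    also have "\<dots> = emeasure M ?N + emeasure M (W - ?N)"
      by (rule plus_emeasure[symmetric]) (use sub W N in auto)
    finally have "emeasure M ?N + emeasure M (W - ?N) \<le> emeasure M ?N + 0" using le by simp
    then show "emeasure M (W - ?N) = 0"
      by (subst (asm) ennreal_add_left_cancel_le) auto
  qed
qed

section \<open>Identification of the objects behind the definite descriptions\<close>

lemma lebesgue_decomposition_parts:
  assumes "lebesgue_decomposition M A D S"
  shows "abs_part M = A" "dis_part M = D" "sing_part M = S"
  unfolding abs_part_def dis_part_def sing_part_def
  using assms lebesgue_decomposition_unique by (blast intro!: the_equality)+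

lemma copula_measure_eq:
  assumes M: "doubly_stochastic M" and C: "C = restrict (\<lambda>(x, y). measure M ({..x} \<times> {..y})) unit_square"
  shows "copula_measure C = M"
proof -
  have eq: "measure M ({0..x} \<times> {0..y}) = C (x, y)" if "x \<in> {0..1}" "y \<in> {0..1}" for x y
  proof -
    have "measure M ({0..x} \<times> {0..y}) = measure M ({..x} \<times> {..y})"
      unfolding measure_def
      by (intro arg_cong[where f=enn2real] emeasure_eq_AE)
         (use doubly_stochastic_outside[OF M] in \<open>auto elim!: eventually_mono intro!: borel_Times simp: doubly_stochasticD(1)[OF M]\<close>)
    with that show ?thesis by (simp add: C)
  qed
  show ?thesis unfolding copula_measure_def
  proof (rule the_equality)
    fix M' assume "doubly_stochastic M' \<and> (\<forall>x\<in>{0..1}. \<forall>y\<in>{0..1}. measure M' ({0..x} \<times> {0..y}) = C (x, y))"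
    then show "M' = M" using M eq by (intro copula_measure_eqI) auto
  qed (use M eq in auto)
qed

lemma markov_kernel_props:
  assumes M: "doubly_stochastic M" and C: "C = restrict (\<lambda>(x, y). measure M ({..x} \<times> {..y})) unit_square"
  shows "markov_kernel C \<in> borel \<rightarrow>\<^sub>M prob_algebra borel" "semidirect (markov_kernel C) = M"
proof -
  note eq = copula_measure_eq[OF M C]
  obtain K where "K \<in> borel \<rightarrow>\<^sub>M prob_algebra borel" "\<And>x. emeasure (K x) {0..1} = 1" "semidirect K = M"
    using disintegration[OF M] by blast
  then have "is_markov_kernel C K"
    using emeasure_semidirect_Times[of K] by (auto simp: is_markov_kernel_def eq)
  then have mk: "is_markov_kernel C (markov_kernel C)"
    unfolding markov_kernel_def by (rule someI[of "is_markov_kernel C"])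
  then show K: "markov_kernel C \<in> borel \<rightarrow>\<^sub>M prob_algebra borel"
    by (simp add: is_markov_kernel_def)
  show "semidirect (markov_kernel C) = M"
  proof (rule measure_eqI_rectangles)
    show "finite_measure (semidirect (markov_kernel C))"
      using prob_space_semidirect[OF K] by (rule prob_space.finite_measure)
  qed (use mk eq in \<open>auto simp: is_markov_kernel_def emeasure_semidirect_Times[OF K]
         sets_semidirect[OF K] doubly_stochasticD(1)[OF M]\<close>)
qed

text \<open>The description in \<open>kernel_measure\<close> is settled by rectangles because the
  candidate is finite. \<open>L\<close> itself need not be shown measurable: its integrands agree
  almost everywhere with those of the restricted kernel.\<close>

lemma kernel_measure_eq_restriction:
  assumes K: "K \<in> borel \<rightarrow>\<^sub>M prob_algebra borel" and S: "S \<in> sets borel"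
    and L: "AE x in unit_leb. L x = density (K x) (indicator (Pair x -` S))"
  shows "kernel_measure L = density (semidirect K) (indicator S)"
proof -
  note [simp] = kernel_sets[OF K] sets_semidirect[OF K]
  have rect: "emeasure (density (semidirect K) (indicator S)) (E \<times> F) = (\<integral>\<^sup>+x\<in>E. emeasure (L x) F \<partial>unit_leb)"
    if E: "E \<in> sets borel" and F: "F \<in> sets borel" for E F
  proof -
    have "emeasure (density (semidirect K) (indicator S)) (E \<times> F) = emeasure (semidirect K) (S \<inter> E \<times> F)"
      using S E F by (intro emeasure_restricted) (auto intro: borel_Times)
    also have "\<dots> = (\<integral>\<^sup>+x. emeasure (K x) (Pair x -` (S \<inter> E \<times> F)) \<partial>unit_leb)"
      using S E F by (intro emeasure_semidirect[OF K]) (auto intro: borel_Times)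
    also have "\<dots> = (\<integral>\<^sup>+x\<in>E. emeasure (L x) F \<partial>unit_leb)"
    proof (rule nn_integral_cong_AE)
      show "AE x in unit_leb. emeasure (K x) (Pair x -` (S \<inter> E \<times> F)) = emeasure (L x) F * indicator E x"
        using L
      proof eventually_elim
        case (elim x)
        have "Pair x -` (S \<inter> E \<times> F) = (if x \<in> E then Pair x -` S \<inter> F else {})" by auto
        then show ?case
          using F borel_section[OF S, of x] by (auto simp: elim emeasure_restricted)
      qed
    qed
    finally show ?thesis .
  qed
  show ?thesis
    unfolding kernel_measure_def
  proof (rule the_equality)
    fix M assume M: "sets M = sets borel \<and> (\<forall>E\<in>sets borel. \<forall>F\<in>sets borel.
                emeasure M (E \<times> F) = (\<integral>\<^sup>+x\<in>E. emeasure (L x) F \<partial>unit_leb))"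
    interpret prob_space "semidirect K" by (rule prob_space_semidirect[OF K])
    have "finite_measure (density (semidirect K) (indicator S))"
      using S by (intro finite_measure_restricted) simp
    then show "M = density (semidirect K) (indicator S)"
      using M rect by (intro measure_eqI_rectangles[symmetric]) auto
  qed (use rect in auto)
qed

text \<open>Off \<open>N\<close> the joint measure is absolutely continuous with respect to the
  product of \<open>unit_leb\<close> and \<open>lborel\<close>: a set null for the product has null
  sections for almost every \<open>x\<close>, so \<open>null\<close> applies. The joint
  Radon-Nikodym density then restricts to densities of the individual kernels.\<close>

lemma AE_restricted_kernel_absolutely_continuous:
  assumes K: "K \<in> borel \<rightarrow>\<^sub>M prob_algebra borel" and N: "N \<in> sets borel"
    and null: "\<And>W. W \<in> sets borel \<Longrightarrow> AE x in unit_leb. Pair x -` W \<in> null_sets lborel \<Longrightarrow>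
                 emeasure (semidirect K) (W - N) = 0"
  shows "AE x in unit_leb. absolutely_continuous lborel (density (K x) (indicator (Pair x -` (- N))))"
proof -
  note [simp] = kernel_sets[OF K] kernel_space[OF K] sets_semidirect[OF K] space_semidirect[OF K]
  interpret U: prob_space unit_leb by (rule prob_space_unit_leb)
  interpret P: pair_sigma_finite unit_leb lborel ..
  let ?P = "unit_leb \<Otimes>\<^sub>M (lborel :: real measure)"
  let ?\<nu> = "density (semidirect K) (indicator (- N))"
  have sP: "sets ?P = sets borel"
  proof -
    have "sets ?P = sets (borel \<Otimes>\<^sub>M (borel :: real measure))"
      by (rule sets_pair_measure_cong) simp_all
    then show ?thesis unfolding borel_prod .
  qed
  have \<nu>: "emeasure ?\<nu> W = emeasure (semidirect K) (W - N)" if "W \<in> sets borel" for W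
    using that N by (subst emeasure_restricted) (auto simp: Diff_eq Int_commute)
  have "absolutely_continuous ?P ?\<nu>"
    unfolding absolutely_continuous_def
  proof
    fix W assume W: "W \<in> null_sets ?P"
    have Wb: "W \<in> sets borel" using null_setsD2[OF W] unfolding sP .
    have "(\<integral>\<^sup>+x. emeasure lborel (Pair x -` W) \<partial>unit_leb) = 0"
      using null_setsD1[OF W] lborel.emeasure_pair_measure_alt[OF null_setsD2[OF W]] by simp
    moreover have "(\<lambda>x. emeasure lborel (Pair x -` W)) \<in> borel_measurable unit_leb"
      by (rule lborel.measurable_emeasure_Pair[OF null_setsD2[OF W]])
    ultimately have "AE x in unit_leb. emeasure lborel (Pair x -` W) = 0"
      by (simp add: nn_integral_0_iff_AE)
    then have "AE x in unit_leb. Pair x -` W \<in> null_sets lborel"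
      using borel_section[OF Wb] by (auto simp: null_sets_def elim!: eventually_mono)
    then show "W \<in> null_sets ?\<nu>"
      using null[OF Wb] Wb by (auto simp: null_sets_def \<nu>)
  qed
  moreover have "sigma_finite_measure ?P" ..
  ultimately obtain f where f: "f \<in> borel_measurable ?P" "density ?P f = ?\<nu>"
    using sigma_finite_measure.Radon_Nikodym[of ?P ?\<nu>] by (metis sP sets_density sets_semidirect[OF K])
  note f(1)[measurable]
  have f_borel: "(\<lambda>y. f (x, y)) \<in> borel_measurable borel" for x
    using measurable_compose[OF measurable_Pair1'[of x unit_leb lborel] f(1)] by simp
  have rect: "(\<integral>\<^sup>+x\<in>E. emeasure (density (K x) (indicator (Pair x -` (- N)))) F \<partial>unit_leb) =
      (\<integral>\<^sup>+x\<in>E. (\<integral>\<^sup>+y\<in>F. f (x, y) \<partial>lborel) \<partial>unit_leb)"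
    if E: "E \<in> sets borel" and F: "F \<in> sets borel" for E F
  proof -
    have EF: "E \<times> F \<in> sets ?P" using E F by auto
    have "(\<integral>\<^sup>+x\<in>E. (\<integral>\<^sup>+y\<in>F. f (x, y) \<partial>lborel) \<partial>unit_leb) =
        (\<integral>\<^sup>+x. (\<integral>\<^sup>+y. f (x, y) * indicator (E \<times> F) (x, y) \<partial>lborel) \<partial>unit_leb)"
      by (intro nn_integral_cong) (auto simp: indicator_def)
    also have "\<dots> = (\<integral>\<^sup>+z. f z * indicator (E \<times> F) z \<partial>?P)"
      using E F EF by (subst lborel.nn_integral_fst[symmetric]) auto
    also have "\<dots> = emeasure ?\<nu> (E \<times> F)"
      using EF by (subst f(2)[symmetric], subst emeasure_density) auto
    also have "\<dots> = emeasure (semidirect K) (E \<times> F - N)"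
      using E F by (intro \<nu> borel_Times)
    also have "\<dots> = (\<integral>\<^sup>+x. emeasure (K x) (Pair x -` (E \<times> F - N)) \<partial>unit_leb)"
      using E F N by (intro emeasure_semidirect[OF K]) (auto intro!: borel_Times)
    also have "\<dots> = (\<integral>\<^sup>+x\<in>E. emeasure (density (K x) (indicator (Pair x -` (- N)))) F \<partial>unit_leb)"
    proof (rule nn_integral_cong)
      fix x
      have "Pair x -` (E \<times> F - N) = (if x \<in> E then Pair x -` (- N) \<inter> F else {})" by auto
      then show "emeasure (K x) (Pair x -` (E \<times> F - N)) =
          emeasure (density (K x) (indicator (Pair x -` (- N)))) F * indicator E x"
        using F borel_section[of "- N" x] N by (auto simp: emeasure_restricted)
    qed
    finally show ?thesis by simp
  qed
  have meas: "(\<lambda>x. emeasure (density (K x) (indicator (Pair x -` (- N)))) F) \<in> borel_measurable borel"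
    if F: "F \<in> sets borel" for F
  proof -
    have "(- N \<inter> UNIV \<times> F) \<in> sets borel" using N F by (auto intro!: sets.Int borel_Times)
    then have "(\<lambda>x. emeasure (K x) (Pair x -` (- N \<inter> UNIV \<times> F))) \<in> borel_measurable borel"
      by (rule measurable_kernel_section[OF K])
    moreover have "emeasure (density (K x) (indicator (Pair x -` (- N)))) F = emeasure (K x) (Pair x -` (- N \<inter> UNIV \<times> F))" for x
    proof -
      have "Pair x -` (- N \<inter> UNIV \<times> F) = Pair x -` (- N) \<inter> F" by auto
      then show ?thesis
        using F borel_section[of "- N" x] N by (auto simp: emeasure_restricted)
    qed
    ultimately show ?thesis by simp
  qed
  have le1: "emeasure (density (K x) (indicator (Pair x -` (- N)))) F \<le> 1" if "F \<in> sets borel" for x F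
    using that borel_section[of "- N" x] N prob_space.emeasure_le_1[OF kernel_prob_space[OF K]]
    by (subst emeasure_restricted) auto
  have meas2: "(\<lambda>x. \<integral>\<^sup>+y\<in>F. f (x, y) \<partial>lborel) \<in> borel_measurable unit_leb" if [measurable]: "F \<in> sets borel" for F
  proof -
    have "(\<lambda>z. f z * indicator F (snd z)) \<in> borel_measurable ?P" by measurable
    from lborel.borel_measurable_nn_integral_fst[OF this] show ?thesis by simp
  qed
  have AE_F: "AE x in unit_leb. emeasure (density (K x) (indicator (Pair x -` (- N)))) F = (\<integral>\<^sup>+y\<in>F. f (x, y) \<partial>lborel)"
    if F: "F \<in> sets borel" for F
  proof (rule AE_eq_of_set_nn_integral_eq)
    have "(\<integral>\<^sup>+x. emeasure (density (K x) (indicator (Pair x -` (- N)))) F \<partial>unit_leb) \<le> (\<integral>\<^sup>+x. 1 \<partial>unit_leb)"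
      by (rule nn_integral_mono) (rule le1[OF F])
    also have "\<dots> < \<infinity>" using U.emeasure_space_1 by simp
    finally show "(\<integral>\<^sup>+x. emeasure (density (K x) (indicator (Pair x -` (- N)))) F \<partial>unit_leb) \<noteq> \<infinity>" by simp
  qed (use meas[OF F] meas2[OF F] rect F in auto)
  \<comment> \<open>Each \<open>F\<close> has its own exceptional null set; all rational half-lines
    together still need only one. The separate equality for \<open>UNIV\<close> bounds the total
    mass of the measure with density \<open>f (x, y)\<close> in \<open>y\<close>.\<close>
  have "AE x in unit_leb. \<forall>q\<in>\<rat>. emeasure (density (K x) (indicator (Pair x -` (- N)))) {..q} = (\<integral>\<^sup>+y\<in>{..q}. f (x, y) \<partial>lborel)"
    by (subst AE_ball_countable[OF countable_rat]) (auto intro: AE_F)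
  moreover have "AE x in unit_leb. emeasure (density (K x) (indicator (Pair x -` (- N)))) UNIV = (\<integral>\<^sup>+y\<in>UNIV. f (x, y) \<partial>lborel)"
    by (rule AE_F) simp
  ultimately show ?thesis
  proof eventually_elim
    case (elim x)
    let ?b = "density lborel (\<lambda>y. f (x, y))"
    have em: "emeasure ?b F = (\<integral>\<^sup>+y\<in>F. f (x, y) \<partial>lborel)" if "F \<in> sets borel" for F
      using that f_borel by (intro emeasure_density) auto
    have "density (K x) (indicator (Pair x -` (- N))) = ?b"
    proof (rule finite_borel_measure_eqI)
      have fin: "finite_borel_measure L" if "sets L = sets borel" "emeasure L UNIV \<le> 1" for L :: "real measure"
      proof -
        have "space L = UNIV" using sets_eq_imp_space_eq[OF that(1)] by simp
        then have "finite_measure L" using that(2) by (intro finite_measureI) (auto simp: top_unique)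
        then show ?thesis using that(1) by (simp add: finite_borel_measure_def finite_borel_measure_axioms_def)
      qed
      show "finite_borel_measure (density (K x) (indicator (Pair x -` (- N))))" "finite_borel_measure ?b"
        using le1[of UNIV x] elim(2) by (auto intro!: fin simp: em)
    qed (use elim(1) in \<open>auto simp: em\<close>)
    moreover have "absolutely_continuous lborel ?b"
      using f_borel by (intro absolutely_continuousI_density) simp
    ultimately show ?case by simp
  qed
qed

text \<open>The mass of an atom is jointly measurable: it is the kernel at \<open>fst z\<close>
  evaluated on the section over \<open>z\<close> of the measurable set where the last coordinate
  equals \<open>snd z\<close>.\<close>

lemma atoms_of_kernel_measurable:
  fixes K :: "real \<Rightarrow> real measure"
  assumes K: "K \<in> borel \<rightarrow>\<^sub>M prob_algebra borel"
  shows "{(x, y). 0 < emeasure (K x) {y :: real}} \<in> sets borel"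
proof -
  have "(\<lambda>z. emeasure (K (fst z)) {snd z}) \<in> borel_measurable (borel \<Otimes>\<^sub>M borel :: (real \<times> real) measure)"
  proof (rule emeasure_measurable_subprob_algebra2)
    have "{w \<in> space ((borel \<Otimes>\<^sub>M borel) \<Otimes>\<^sub>M borel). snd w = snd (fst w :: real \<times> real)} \<in> sets ((borel \<Otimes>\<^sub>M borel) \<Otimes>\<^sub>M borel)"
      by measurable
    also have "{w \<in> space ((borel \<Otimes>\<^sub>M borel) \<Otimes>\<^sub>M borel). snd w = snd (fst w :: real \<times> real)} = (SIGMA z:space (borel \<Otimes>\<^sub>M (borel :: real measure)). {snd z})"
      by (auto simp: space_pair_measure)
    finally show "(SIGMA z:space (borel \<Otimes>\<^sub>M borel :: (real \<times> real) measure). {snd z}) \<in> sets ((borel \<Otimes>\<^sub>M borel) \<Otimes>\<^sub>M (borel :: real measure))"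
      by simp
    show "(\<lambda>z. K (fst z)) \<in> (borel \<Otimes>\<^sub>M borel :: (real \<times> real) measure) \<rightarrow>\<^sub>M subprob_algebra borel"
      by (rule measurable_compose[OF measurable_fst measurable_prob_algebraD[OF K]])
  qed
  then have [measurable]: "(\<lambda>z. emeasure (K (fst z)) {snd z}) \<in> borel_measurable borel"
    unfolding borel_prod .
  have "{z \<in> space borel. 0 < emeasure (K (fst z)) {snd z}} \<in> sets borel"
    by measurable
  then show ?thesis by (simp add: case_prod_beta')
qed

text \<open>\<open>H\<close> is the set of atoms of the kernel: a countable section avoiding it has
  mass zero, which is its maximality. \<open>N\<close> comes from exhaustion instead. The sets
  \<open>- N\<close>, \<open>H\<close> and \<open>N - H\<close> split almost every
  \<open>K x\<close> into its three parts, so that restrictions of \<open>M\<close> replace the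
  decomposed kernels.\<close>

lemma copula_parts:
  assumes M: "doubly_stochastic M" and C: "C = restrict (\<lambda>(x, y). measure M ({..x} \<times> {..y})) unit_square"
  obtains H N where "H \<subseteq> N" "H \<in> sets borel" "N \<in> sets borel"
    "\<And>x. countable (Pair x -` H)" "AE x in unit_leb. Pair x -` N \<in> null_sets lborel"
    "\<And>W. W \<in> sets borel \<Longrightarrow> \<forall>x. countable (Pair x -` W) \<Longrightarrow> emeasure M (W - H) = 0"
    "\<And>W. W \<in> sets borel \<Longrightarrow> AE x in unit_leb. Pair x -` W \<in> null_sets lborel \<Longrightarrow> emeasure M (W - N) = 0"
    "mu_dis C = density M (indicator H)" "mu_sing C = density M (indicator (N - H))"
    "mu_abs C = density M (indicator (- N))"
proof -
  define K where "K = markov_kernel C"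
  have K: "K \<in> borel \<rightarrow>\<^sub>M prob_algebra borel" and KM: "semidirect K = M"
    using markov_kernel_props[OF M C] by (auto simp: K_def)
  interpret M: prob_space M by (rule doubly_stochasticD[OF M])
  note sM [simp] = doubly_stochasticD(1)[OF M]
  note [simp] = kernel_sets[OF K] kernel_space[OF K]
  interpret Kp: prob_space "K x" for x by (rule kernel_prob_space[OF K])
  define H where "H = {(x, y). 0 < emeasure (K x) {y}}"
  have Hb: "H \<in> sets borel" unfolding H_def by (rule atoms_of_kernel_measurable[OF K])
  have H_section: "Pair x -` H = {y. 0 < emeasure (K x) {y}}" for x by (auto simp: H_def)
  have Hc: "countable (Pair x -` H)" for x
  proof -
    interpret finite_borel_measure "K x"
      by (simp add: finite_borel_measure_def finite_borel_measure_axioms_def Kp.finite_measure_axioms)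
    show ?thesis using countable_atoms by (simp add: H_section Kp.emeasure_eq_measure)
  qed
  have Hmax: "emeasure M (W - H) = 0" if W: "W \<in> sets borel" "\<And>x. countable (Pair x -` W)" for W
  proof -
    have "emeasure M (W - H) = (\<integral>\<^sup>+x. emeasure (K x) (Pair x -` (W - H)) \<partial>unit_leb)"
      unfolding KM[symmetric] using W Hb by (intro emeasure_semidirect[OF K]) auto
    also have "\<dots> = (\<integral>\<^sup>+x. 0 \<partial>unit_leb)"
    proof (rule nn_integral_cong)
      fix x
      have "countable (Pair x -` (W - H))" by (rule countable_subset[OF _ W(2)[of x]]) auto
      moreover have "{y} \<in> null_sets (K x)" if "y \<in> Pair x -` (W - H)" for y
        using that by (auto simp: H_def null_sets_def)
      ultimately have "(\<Union>y\<in>Pair x -` (W - H). {y}) \<in> null_sets (K x)"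
        by (intro null_sets_UN')
      then show "emeasure (K x) (Pair x -` (W - H)) = 0" by auto
    qed
    finally show ?thesis by simp
  qed
  let ?\<N> = "{W \<in> sets borel. AE x in unit_leb. Pair x -` W \<in> null_sets lborel}"
  obtain N0 where N0: "N0 \<in> ?\<N>" "\<And>W. W \<in> ?\<N> \<Longrightarrow> emeasure M (W - N0) = 0"
  proof (rule M.ex_maximal_of_sigma_ideal[of ?\<N>])
    show "?\<N> \<subseteq> sets M" by auto
    have "{} \<in> ?\<N>" by simp
    then show "?\<N> \<noteq> {}" by blast
    fix A :: "nat \<Rightarrow> (real \<times> real) set" assume A: "range A \<subseteq> ?\<N>"
    then have "AE x in unit_leb. \<forall>i. Pair x -` A i \<in> null_sets lborel"
      by (subst AE_all_countable) auto
    then have "AE x in unit_leb. Pair x -` (\<Union>i. A i) \<in> null_sets lborel"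
      by eventually_elim (auto simp: vimage_UN)
    with A show "(\<Union>i. A i) \<in> ?\<N>" by auto
  qed blast
  \<comment> \<open>Adjoining \<open>H\<close> makes the three sets \<open>- N\<close>,
    \<open>H\<close> and \<open>N - H\<close> a partition; almost all sections of \<open>N\<close>
    stay null because those of \<open>H\<close> are countable.\<close>
  define N where "N = N0 \<union> H"
  have Nb: "N \<in> sets borel" using N0 Hb by (auto simp: N_def)
  have HN: "H \<subseteq> N" by (auto simp: N_def)
  have Hnull: "Pair x -` H \<in> null_sets lborel" for x
    by (rule countable_imp_null_set_lborel[OF Hc])
  have N_null: "AE x in unit_leb. Pair x -` N \<in> null_sets lborel"
    using N0(1) Hnull by (auto simp: N_def elim!: eventually_mono)
  have Nmax: "emeasure M (W - N) = 0" if "W \<in> sets borel" "AE x in unit_leb. Pair x -` W \<in> null_sets lborel" for W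
  proof -
    have "emeasure M (W - N) \<le> emeasure M (W - N0)"
      by (rule emeasure_mono) (use that N0 in \<open>auto simp: N_def\<close>)
    with N0(2)[of W] that show ?thesis by simp
  qed
  have "AE x in unit_leb. absolutely_continuous lborel (density (K x) (indicator (Pair x -` (- N))))"
    by (rule AE_restricted_kernel_absolutely_continuous[OF K Nb]) (simp add: KM Nmax)
  then have decomp: "AE x in unit_leb. lebesgue_decomposition (K x)
      (density (K x) (indicator (Pair x -` (- N)))) (density (K x) (indicator (Pair x -` H)))
      (density (K x) (indicator (Pair x -` (N - H))))"
    using N_null
  proof eventually_elim
    case (elim x)
    have b: "Pair x -` (- N) \<in> sets borel" "Pair x -` H \<in> sets borel" "Pair x -` (N - H) \<in> sets borel"
      using Nb Hb by (auto intro: borel_section simp del: vimage_Compl vimage_Diff)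
    note r = emeasure_restricted[of _ "K x", simplified]
    have D: "discrete_measure (density (K x) (indicator (Pair x -` H)))"
      unfolding discrete_measure_def
      using Hc[of x] b by (intro exI[of _ "Pair x -` H"]) (auto simp: r)
    have S: "singular_measure (density (K x) (indicator (Pair x -` (N - H))))"
      unfolding singular_measure_def
    proof (intro conjI allI bexI)
      show "emeasure (density (K x) (indicator (Pair x -` (N - H)))) {y} = 0" for y
      proof (cases "y \<in> Pair x -` (N - H)")
        case True
        then show ?thesis using b(3) by (auto simp: r H_def simp del: vimage_Diff)
      qed (use b(3) in \<open>auto simp: r simp del: vimage_Diff\<close>)
      show "Pair x -` N \<in> null_sets lborel" by fact
      have "Pair x -` (N - H) \<inter> - (Pair x -` N) = {}" by auto
      then show "emeasure (density (K x) (indicator (Pair x -` (N - H)))) (- (Pair x -` N)) = 0"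
        using b(3) borel_section[OF Nb, of x] by (simp add: r del: vimage_Diff)
    qed
    have split: "emeasure (K x) F = emeasure (K x) (Pair x -` (- N) \<inter> F) + emeasure (K x) (Pair x -` H \<inter> F)
        + emeasure (K x) (Pair x -` (N - H) \<inter> F)" if F: "F \<in> sets borel" for F
    proof -
      have "emeasure (K x) F = emeasure (K x) ((Pair x -` (- N) \<inter> F \<union> Pair x -` H \<inter> F) \<union> Pair x -` (N - H) \<inter> F)"
        using HN by (intro arg_cong[where f="emeasure (K x)"]) auto
      also have "\<dots> = emeasure (K x) (Pair x -` (- N) \<inter> F \<union> Pair x -` H \<inter> F) + emeasure (K x) (Pair x -` (N - H) \<inter> F)"
        using HN b F by (intro plus_emeasure[symmetric]) (auto simp del: vimage_Compl vimage_Diff)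
      also have "emeasure (K x) (Pair x -` (- N) \<inter> F \<union> Pair x -` H \<inter> F) = emeasure (K x) (Pair x -` (- N) \<inter> F) + emeasure (K x) (Pair x -` H \<inter> F)"
        using HN b F by (intro plus_emeasure[symmetric]) (auto simp del: vimage_Compl vimage_Diff)
      finally show ?thesis .
    qed
    have fin: "finite_measure (density (K x) (indicator B))" if "B \<in> sets borel" for B
      using that by (intro Kp.finite_measure_restricted) simp
    show ?case
      unfolding lebesgue_decomposition_def
    proof (intro conjI ballI)
      show "emeasure (K x) F = emeasure (density (K x) (indicator (Pair x -` (- N)))) F +
          emeasure (density (K x) (indicator (Pair x -` H))) F + emeasure (density (K x) (indicator (Pair x -` (N - H)))) F"
        if "F \<in> sets borel" for F
        using split[OF that] by (simp only: r[OF b(1) that] r[OF b(2) that] r[OF b(3) that])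
    qed (use elim(1) D S fin[OF b(1)] fin[OF b(2)] fin[OF b(3)] in simp_all)
  qed
  have parts: "AE x in unit_leb. abs_part (K x) = density (K x) (indicator (Pair x -` (- N)))"
    "AE x in unit_leb. dis_part (K x) = density (K x) (indicator (Pair x -` H))"
    "AE x in unit_leb. sing_part (K x) = density (K x) (indicator (Pair x -` (N - H)))"
    by (rule eventually_mono[OF decomp], erule lebesgue_decomposition_parts)+
  have "mu_dis C = density M (indicator H)" "mu_sing C = density M (indicator (N - H))"
    "mu_abs C = density M (indicator (- N))"
    unfolding mu_dis_def mu_sing_def mu_abs_def K_def[symmetric] KM[symmetric]
    using Hb Nb parts by (auto intro!: kernel_measure_eq_restriction[OF K] simp del: vimage_Compl vimage_Diff)
  note mu = this
  show thesis
  proof (rule that[of H N])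
    show "emeasure M (W - H) = 0" if "W \<in> sets borel" "\<forall>x. countable (Pair x -` W)" for W
      using that by (auto intro: Hmax)
    show "emeasure M (W - N) = 0"
      if "W \<in> sets borel" "AE x in unit_leb. Pair x -` W \<in> null_sets lborel" for W
      using that by (rule Nmax)
  qed (fact Hb Nb HN Hc N_null mu)+
qed

section \<open>Max-stability and geometric means\<close>

lemma copulaE:
  assumes "copula C"
  obtains M where "doubly_stochastic M" "C = restrict (\<lambda>(x, y). measure M ({..x} \<times> {..y})) unit_square"
    "\<And>x y. x \<in> {0..1} \<Longrightarrow> y \<in> {0..1} \<Longrightarrow> emeasure M ({..x} \<times> {..y}) = ennreal (C (x, y))"
proof -
  obtain M where M: "doubly_stochastic M" and C: "C = restrict (\<lambda>(x, y). measure M ({..x} \<times> {..y})) unit_square"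
    using assms unfolding copula_def by blast
  interpret prob_space M by (rule doubly_stochasticD[OF M])
  show thesis
    by (rule that[OF M C]) (simp add: C emeasure_eq_measure)
qed

text \<open>The Frechet-Hoeffding bounds. The lower one yields positivity of extreme value copulas,
  the upper one enters the uniform estimate in \<open>ev_copula_perturbation\<close>.\<close>

lemma
  assumes C: "copula C" and x: "x \<in> {0..1}" and y: "y \<in> {0..1}"
  shows copula_le_min: "C (x, y) \<le> min x y"
    and copula_ge: "x + y - 1 \<le> C (x, y)"
proof -
  obtain M where M: "doubly_stochastic M" "C = restrict (\<lambda>(x, y). measure M ({..x} \<times> {..y})) unit_square"
    and C: "\<And>x y. x \<in> {0..1} \<Longrightarrow> y \<in> {0..1} \<Longrightarrow> emeasure M ({..x} \<times> {..y}) = ennreal (C (x, y))"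
    by (rule copulaE[OF C]) (rule that)
  note [simp] = doubly_stochasticD(1,2)[OF M(1)]
  interpret prob_space M by (rule doubly_stochasticD[OF M(1)])
  have nn: "0 \<le> C (x, y)" using copula_bounds(2)[OF assms(1), of "(x, y)"] x y by auto
  have m: "measure M ({..x} \<times> UNIV) = x" "measure M (UNIV \<times> {..y}) = y" "measure M ({..x} \<times> {..y}) = C (x, y)"
    using doubly_stochasticD(4,5)[OF M(1)] x y C[OF x y] nn by (auto simp: measure_def emeasure_unit_leb_atMost)
  have s: "{..x} \<times> UNIV \<in> sets M" "UNIV \<times> {..y} \<in> sets M" "{..x} \<times> {..y} \<in> sets M"
    by (auto intro: borel_Times)
  have "measure M ({..x} \<times> {..y}) \<le> measure M ({..x} \<times> UNIV)" "measure M ({..x} \<times> {..y}) \<le> measure M (UNIV \<times> {..y})"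
    using s by (auto intro!: finite_measure_mono)
  then show "C (x, y) \<le> min x y" by (simp add: m)
  have "measure M ({..x} \<times> UNIV \<union> UNIV \<times> {..y}) = measure M ({..x} \<times> UNIV) + measure M (UNIV \<times> {..y} - {..x} \<times> UNIV)"
    using s by (intro finite_measure_Union') auto
  also have "measure M (UNIV \<times> {..y} - {..x} \<times> UNIV) = measure M (UNIV \<times> {..y}) - measure M (UNIV \<times> {..y} \<inter> {..x} \<times> UNIV)"
    using s by (intro finite_measure_Diff') auto
  also have "UNIV \<times> {..y} \<inter> {..x} \<times> UNIV = {..x} \<times> {..y}" by auto
  finally have "x + y - C (x, y) = measure M ({..x} \<times> UNIV \<union> UNIV \<times> {..y})" by (simp add: m)
  then show "x + y - 1 \<le> C (x, y)" using prob_le_1[of "{..x} \<times> UNIV \<union> UNIV \<times> {..y}"] by linarith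
qed

lemma powr_unit_interval: "x powr a \<in> {0..1}" if "x \<in> {0..1}" "0 \<le> a" for x a :: real
  using that powr_mono2[of a x 1] by auto

text \<open>Along the multiples of \<open>k\<close>, the sequence with limit \<open>C (x, y)\<close>
  is the \<open>k\<close>-th power of the one whose limit is the value of \<open>C\<close> at the
  \<open>k\<close>-th roots.\<close>

lemma ev_copula_max_stable:
  assumes C: "C \<in> ev_copulas" and x: "x \<in> {0..1}" and y: "y \<in> {0..1}" and k: "0 < k"
  shows "C (x powr (1 / real k), y powr (1 / real k)) ^ k = C (x, y)"
proof -
  obtain B where B: "\<And>x y. x \<in> {0..1} \<Longrightarrow> y \<in> {0..1} \<Longrightarrow>
      (\<lambda>n. B (x powr (1 / real n), y powr (1 / real n)) ^ n) \<longlonglongrightarrow> C (x, y)"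
    using C unfolding ev_copulas_def by blast
  let ?x = "x powr (1 / real k)" and ?y = "y powr (1 / real k)"
  have "(\<lambda>n. (B (?x powr (1 / real n), ?y powr (1 / real n)) ^ n) ^ k) \<longlonglongrightarrow> C (?x, ?y) ^ k"
    by (intro tendsto_power B powr_unit_interval x y) auto
  moreover have "(\<lambda>n. B (x powr (1 / real (n * k)), y powr (1 / real (n * k))) ^ (n * k)) \<longlonglongrightarrow> C (x, y)"
  proof -
    have "filterlim (\<lambda>n. n * k) sequentially sequentially"
      using k by (intro filterlim_subseq) (auto simp: strict_mono_def)
    from filterlim_compose[OF B[OF x y] this] show ?thesis by simp
  qed
  moreover have "(B (?x powr (1 / real n), ?y powr (1 / real n)) ^ n) ^ k =
      B (x powr (1 / real (n * k)), y powr (1 / real (n * k))) ^ (n * k)" for n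
    by (simp add: powr_powr power_mult[symmetric] mult.commute)
  ultimately show ?thesis using LIMSEQ_unique by simp
qed

text \<open>Max-stability read at the \<open>m\<close>-th powers; the case \<open>m = 0\<close>
  amounts to \<open>C (1, 1) = 1\<close>.\<close>

lemma ev_copula_power:
  assumes C: "C \<in> ev_copulas" and x: "x \<in> {0..1}" and y: "y \<in> {0..1}"
  shows "C (x ^ m, y ^ m) = C (x, y) ^ m"
proof (cases "m = 0")
  case True
  have "copula C" using C by (simp add: ev_copulas_def)
  then have "C (1, 1) = 1" using copula_le_min[of C 1 1] copula_ge[of C 1 1] by simp
  with True show ?thesis by simp
next
  case False
  have "(z ^ m) powr (1 / real m) = z" if "z \<in> {0..1}" for z :: real
    using that False by (cases "z = 0") (auto simp: powr_realpow[symmetric] powr_powr)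
  with ev_copula_max_stable[OF C, of "x ^ m" "y ^ m" m] x y False show ?thesis
    by (auto simp: power_le_one)
qed

text \<open>Max-stability moves the point to its \<open>k\<close>-th roots, which tend to
  \<open>(1, 1)\<close>, where the lower bound \<open>x + y - 1\<close> becomes positive.\<close>

lemma ev_copula_pos:
  assumes C: "C \<in> ev_copulas" and x: "x \<in> {0<..1}" and y: "y \<in> {0<..1}"
  shows "0 < C (x, y)"
proof -
  have lim: "(\<lambda>n. z powr (1 / real n)) \<longlonglongrightarrow> 1" if "z \<in> {0<..1}" for z :: real
  proof -
    have "(\<lambda>n. z powr (1 / real n)) \<longlonglongrightarrow> z powr 0"
      using that by (intro tendsto_intros lim_1_over_n) auto
    with that show ?thesis by simp
  qed
  have "(\<lambda>n. x powr (1 / real n) + y powr (1 / real n)) \<longlonglongrightarrow> 1 + 1"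
    by (intro tendsto_intros lim x y)
  then have "\<forall>\<^sub>F n in sequentially. 1 < x powr (1 / real n) + y powr (1 / real n)"
    by (rule order_tendstoD) simp
  then have "\<forall>\<^sub>F n in sequentially. 1 < x powr (1 / real n) + y powr (1 / real n) \<and> 0 < n"
    using eventually_gt_at_top[of 0] by eventually_elim auto
  then obtain k where k: "1 < x powr (1 / real k) + y powr (1 / real k)" "0 < k"
    using eventually_happens'[OF sequentially_bot] by blast
  have "copula C" using C by (simp add: ev_copulas_def)
  then have "x powr (1 / real k) + y powr (1 / real k) - 1 \<le> C (x powr (1 / real k), y powr (1 / real k))"
    using x y by (intro copula_ge powr_unit_interval) auto
  with k have "0 < C (x powr (1 / real k), y powr (1 / real k)) ^ k" by simp
  then show ?thesis using x y k by (subst (asm) ev_copula_max_stable[OF C]) auto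
qed

section \<open>Coordinatewise maxima of powers of independent pairs\<close>

lemma powr_inverse_le_iff:
  fixes u v a :: real
  assumes "0 \<le> u" "0 \<le> v" "0 < a"
  shows "u powr (1 / a) \<le> v \<longleftrightarrow> u \<le> v powr a"
proof
  assume "u powr (1 / a) \<le> v"
  then have "(u powr (1 / a)) powr a \<le> v powr a" using assms by (intro powr_mono2) auto
  then show "u \<le> v powr a" using assms by (simp add: powr_powr)
next
  assume "u \<le> v powr a"
  then have "u powr (1 / a) \<le> (v powr a) powr (1 / a)" using assms by (intro powr_mono2) auto
  then show "u powr (1 / a) \<le> v" using assms by (simp add: powr_powr)
qed

text \<open>The exponents are inverted so that \<open>u powr (1 / a) \<le> x\<close> reads
  \<open>u \<le> x powr a\<close>, which turns the distribution function of the maximum into a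
  geometric mean. The pair \<open>q\<close> drawn from \<open>M0\<close> stands first, because
  Fubini is applied with \<open>q\<close> fixed.\<close>

definition max_pow :: "real \<Rightarrow> real \<Rightarrow> (real \<times> real) \<times> (real \<times> real) \<Rightarrow> real \<times> real" where
  "max_pow a b = (\<lambda>(q, p). (max (fst p powr (1 / a)) (fst q powr (1 / b)), max (snd p powr (1 / a)) (snd q powr (1 / b))))"

context
  fixes M M0 :: "(real \<times> real) measure" and a b :: real
  assumes M: "doubly_stochastic M" and M0: "doubly_stochastic M0"
    and a: "0 < a" and b: "0 < b"
begin

definition max_law :: "(real \<times> real) measure" where
  "max_law = distr (M0 \<Otimes>\<^sub>M M) borel (max_pow a b)"

lemma max_pow_measurable: "max_pow a b \<in> M0 \<Otimes>\<^sub>M M \<rightarrow>\<^sub>M borel"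
proof -
  note [measurable_cong] = doubly_stochasticD(1)[OF M] doubly_stochasticD(1)[OF M0]
  have "(\<lambda>(q, p). (max (fst p powr (1 / a)) (fst q powr (1 / b)), max (snd p powr (1 / a)) (snd q powr (1 / b))))
     \<in> M0 \<Otimes>\<^sub>M M \<rightarrow>\<^sub>M borel \<Otimes>\<^sub>M (borel :: real measure)"
    by measurable
  then show ?thesis unfolding max_pow_def borel_prod .
qed

lemma prob_space_max_law: "prob_space max_law"
  unfolding max_law_def
  by (intro prob_space.prob_space_distr prob_space_pair doubly_stochasticD(3) M M0 max_pow_measurable)

lemma AE_pair_unit_square: "AE z in M0 \<Otimes>\<^sub>M M. fst z \<in> unit_square \<and> snd z \<in> unit_square"
proof -
  interpret M: prob_space M by (rule doubly_stochasticD[OF M])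
  interpret M0: prob_space M0 by (rule doubly_stochasticD[OF M0])
  interpret pair_prob_space M0 M ..
  note [measurable_cong] = doubly_stochasticD(1)[OF M] doubly_stochasticD(1)[OF M0]
  have [measurable]: "unit_square \<in> sets (borel :: (real \<times> real) measure)"
    by (rule borel_Times) auto
  show ?thesis
  proof (rule AE_pair_measure)
    show "AE x in M0. AE y in M. fst (x, y) \<in> unit_square \<and> snd (x, y) \<in> unit_square"
      using doubly_stochastic_outside[OF M0]
      by eventually_elim (use doubly_stochastic_outside[OF M] in \<open>auto elim!: eventually_mono\<close>)
  qed measurable
qed

lemma emeasure_max_law:
  assumes x: "x \<in> {0..1}" and y: "y \<in> {0..1}"
  shows "emeasure max_law ({..x} \<times> {..y}) =
    emeasure M ({..x powr a} \<times> {..y powr a}) * emeasure M0 ({..x powr b} \<times> {..y powr b})"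
proof -
  interpret M: prob_space M by (rule doubly_stochasticD[OF M])
  interpret M0: prob_space M0 by (rule doubly_stochasticD[OF M0])
  note s = doubly_stochasticD(1)[OF M] doubly_stochasticD(1)[OF M0]
  have sp: "space (M0 \<Otimes>\<^sub>M M) = UNIV"
    by (simp add: space_pair_measure doubly_stochasticD(2)[OF M] doubly_stochasticD(2)[OF M0])
  have box: "{..u} \<times> {..v} \<in> sets borel" for u v :: real by (intro borel_Times) auto
  have "emeasure max_law ({..x} \<times> {..y}) = emeasure (M0 \<Otimes>\<^sub>M M) (max_pow a b -` ({..x} \<times> {..y}))"
    unfolding max_law_def using box by (simp add: emeasure_distr[OF max_pow_measurable] sp)
  \<comment> \<open>The two events can differ where a coordinate is negative and
    \<open>powr_inverse_le_iff\<close> fails, but such points carry no mass.\<close>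
  also have "\<dots> = emeasure (M0 \<Otimes>\<^sub>M M) (({..x powr b} \<times> {..y powr b}) \<times> ({..x powr a} \<times> {..y powr a}))"
  proof (rule emeasure_eq_AE)
    show "AE z in M0 \<Otimes>\<^sub>M M. (z \<in> max_pow a b -` ({..x} \<times> {..y})) =
        (z \<in> ({..x powr b} \<times> {..y powr b}) \<times> ({..x powr a} \<times> {..y powr a}))"
      using AE_pair_unit_square
    proof eventually_elim
      case (elim z)
      then show ?case using x y a b
        by (cases z) (auto simp: max_pow_def powr_inverse_le_iff)
    qed
    show "max_pow a b -` ({..x} \<times> {..y}) \<in> sets (M0 \<Otimes>\<^sub>M M)"
      using measurable_sets[OF max_pow_measurable box[of x y]] by (simp add: sp)
    show "({..x powr b} \<times> {..y powr b}) \<times> {..x powr a} \<times> {..y powr a} \<in> sets (M0 \<Otimes>\<^sub>M M)"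
      by (intro pair_measureI) (auto simp: s box)
  qed
  also have "\<dots> = emeasure M0 ({..x powr b} \<times> {..y powr b}) * emeasure M ({..x powr a} \<times> {..y powr a})"
    by (rule M.emeasure_pair_measure_Times) (auto simp: s box)
  finally show ?thesis by (simp add: mult.commute)
qed

lemma AE_max_law_le_1: "AE p in max_law. fst p \<le> 1 \<and> snd p \<le> 1"
proof -
  have "AE z in M0 \<Otimes>\<^sub>M M. fst (max_pow a b z) \<le> 1 \<and> snd (max_pow a b z) \<le> 1"
    using AE_pair_unit_square
    by eventually_elim (use a b in \<open>auto simp: max_pow_def powr_inverse_le_iff split: prod.splits\<close>)
  moreover have "{p. fst p \<le> 1 \<and> snd p \<le> 1} \<in> sets (borel :: (real \<times> real) measure)"
  proof -
    have "{p. fst p \<le> 1 \<and> snd p \<le> 1} = {..1::real} \<times> {..1::real}" by auto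
    then show ?thesis by (auto intro: borel_Times)
  qed
  ultimately show ?thesis
    unfolding max_law_def by (subst AE_distr_iff[OF max_pow_measurable]) auto
qed

text \<open>Since the exponents add up to 1, the marginal \<open>x powr a * x powr b\<close> is
  \<open>x\<close> again.\<close>

lemma doubly_stochastic_max_law:
  assumes "a + b = 1"
  shows "doubly_stochastic max_law"
proof (rule doubly_stochasticI)
  show s: "sets max_law = sets borel" by (simp add: max_law_def)
  show "prob_space max_law" by (rule prob_space_max_law)
  have one: "emeasure L ({..u} \<times> {..1}) = ennreal u" "emeasure L ({..1} \<times> {..u}) = ennreal u"
    if L: "doubly_stochastic L" and u: "u \<in> {0..1}" for L u
  proof -
    have "emeasure L ({..u} \<times> {..1}) = emeasure L ({..u} \<times> UNIV)" "emeasure L ({..1} \<times> {..u}) = emeasure L (UNIV \<times> {..u})"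
      using doubly_stochastic_outside[OF L]
      by (auto intro!: emeasure_eq_AE borel_Times elim!: eventually_mono simp: doubly_stochasticD(1)[OF L])
    then show "emeasure L ({..u} \<times> {..1}) = ennreal u" "emeasure L ({..1} \<times> {..u}) = ennreal u"
      using doubly_stochasticD(4,5)[OF L] u by (auto simp: emeasure_unit_leb_atMost)
  qed
  fix x :: real assume x: "0 \<le> x" "x \<le> 1"
  have ab: "ennreal (x powr a) * ennreal (x powr b) = ennreal x"
    using x assms by (simp add: ennreal_mult'[symmetric] powr_add[symmetric])
  have u: "x powr a \<in> {0..1}" "x powr b \<in> {0..1}" using x a b by (intro powr_unit_interval; simp)+
  have "emeasure max_law ({..x} \<times> UNIV) = emeasure max_law ({..x} \<times> {..1})"
    "emeasure max_law (UNIV \<times> {..x}) = emeasure max_law ({..1} \<times> {..x})"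
    by (rule emeasure_eq_AE, rule eventually_mono[OF AE_max_law_le_1], auto intro!: borel_Times simp: s)+
  then show "emeasure max_law ({..x} \<times> UNIV) = ennreal x" "emeasure max_law (UNIV \<times> {..x}) = ennreal x"
    using x ab by (auto simp: emeasure_max_law one[OF M u(1)] one[OF M0 u(2)])
qed

text \<open>Given \<open>q\<close>, the power of an independent \<open>p\<close> lies below that of
  \<open>q\<close> in both coordinates with positive probability, and then the maximum is the image
  of \<open>q\<close>. A set containing these images for a nonnegligible set of \<open>q\<close>
  would therefore be charged.\<close>

lemma max_law_null_imp:
  assumes B: "B \<in> sets borel" "emeasure max_law B = 0"
    and pos: "\<And>x y. x \<in> {0<..1} \<Longrightarrow> y \<in> {0<..1} \<Longrightarrow> 0 < emeasure M ({..x} \<times> {..y})"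
  shows "AE q in M0. (fst q powr (1 / b), snd q powr (1 / b)) \<notin> B"
proof -
  interpret M: prob_space M by (rule doubly_stochasticD[OF M])
  interpret M0: prob_space M0 by (rule doubly_stochasticD[OF M0])
  interpret pair_prob_space M0 M ..
  note s = doubly_stochasticD(1)[OF M] doubly_stochasticD(1)[OF M0]
  have "B \<in> null_sets max_law" using B by (auto simp: null_sets_def max_law_def)
  then have "AE p in max_law. p \<notin> B" by (rule AE_not_in)
  then have "AE z in M0 \<Otimes>\<^sub>M M. max_pow a b z \<notin> B"
    unfolding max_law_def using B by (subst (asm) AE_distr_iff[OF max_pow_measurable]) auto
  from AE_pair[OF this] have "AE q in M0. AE p in M. max_pow a b (q, p) \<notin> B" .
  moreover have "AE q in M0. fst q \<noteq> 0 \<and> snd q \<noteq> 0"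
  proof -
    have "{..0} \<times> UNIV \<in> null_sets M0" "UNIV \<times> {..0} \<in> null_sets M0"
      using doubly_stochasticD(4,5)[OF M0, of "{..0}"] emeasure_unit_leb_atMost[of 0]
      by (auto simp: null_sets_def s intro!: borel_Times)
    from AE_not_in[OF this(1)] AE_not_in[OF this(2)] show ?thesis
      by eventually_elim (auto simp: mem_Times_iff)
  qed
  ultimately show ?thesis using doubly_stochastic_outside[OF M0]
  proof eventually_elim
    case (elim q)
    let ?x = "fst q powr (1 / b)" and ?y = "snd q powr (1 / b)"
    have q: "0 < fst q" "fst q \<le> 1" "0 < snd q" "snd q \<le> 1" using elim by (auto simp: mem_Times_iff)
    then have xy: "?x \<in> {0<..1}" "?y \<in> {0<..1}" using b by (auto simp: powr_le1)
    show ?case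
    proof
      assume inB: "(?x, ?y) \<in> B"
      have xa: "?x powr a \<in> {0<..1}" "?y powr a \<in> {0<..1}" using xy a by (auto simp: powr_le1)
      have "AE p in M. p \<notin> {..?x powr a} \<times> {..?y powr a}"
        using elim(1) doubly_stochastic_outside[OF M]
      proof eventually_elim
        case (elim p)
        show ?case
        proof
          assume "p \<in> {..?x powr a} \<times> {..?y powr a}"
          then have "fst p powr (1 / a) \<le> ?x" "snd p powr (1 / a) \<le> ?y"
            using elim(2) a by (subst powr_inverse_le_iff; auto simp: mem_Times_iff)+
          then have "max_pow a b (q, p) = (?x, ?y)" by (simp add: max_pow_def)
          with elim(1) inB show False by simp
        qed
      qed
      moreover have "{..?x powr a} \<times> {..?y powr a} \<in> sets M" by (auto simp: s intro!: borel_Times)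
      ultimately have "emeasure M ({..?x powr a} \<times> {..?y powr a}) = 0"
        by (subst (asm) AE_iff_measurable[OF _ refl]) (auto simp: doubly_stochasticD(2)[OF M])
      with pos[OF xa] show False by simp
    qed
  qed
qed

end

text \<open>From \<open>c^2 \<le> d \<le> 1\<close> the distance of \<open>d\<close> and
  \<open>c\<close> is at most \<open>1 - c\<close>, and \<open>k * c ^ (k - 1)\<close> is at most a
  geometric sum whose product with \<open>1 - c\<close> is \<open>1 - c ^ k\<close>. In the
  application the two terms are the values of the geometric mean and of \<open>C\<close>.\<close>

lemma power_diff_bound:
  fixes c d :: real
  assumes c: "0 \<le> c" "c \<le> 1" and d: "c\<^sup>2 \<le> d" "d \<le> 1" and k: "0 < k"
  shows "\<bar>c ^ (k - 1) * d - c ^ k\<bar> \<le> 1 / real k"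
proof -
  have ck: "c ^ k = c ^ (k - 1) * c" using k by (metis power_minus_mult)
  have "c * (1 - c) \<le> 1 * (1 - c)" using c by (intro mult_right_mono) auto
  then have "\<bar>d - c\<bar> \<le> 1 - c" using d by (simp add: power2_eq_square algebra_simps abs_le_iff)
  have "\<bar>c ^ (k - 1) * d - c ^ k\<bar> = c ^ (k - 1) * \<bar>d - c\<bar>"
    using c by (simp add: ck abs_mult right_diff_distrib[symmetric])
  also have "\<dots> \<le> c ^ (k - 1) * (1 - c)" using c \<open>\<bar>d - c\<bar> \<le> 1 - c\<close> by (intro mult_left_mono) auto
  also have "\<dots> \<le> 1 / real k"
  proof -
    have "real k * (c ^ (k - 1) * (1 - c)) = (\<Sum>j<k. c ^ (k - 1)) * (1 - c)" by simp
    also have "\<dots> \<le> (\<Sum>j<k. c ^ j) * (1 - c)"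
      using c by (intro mult_right_mono sum_mono power_decreasing) auto
    also have "\<dots> = 1 - c ^ k" by (simp add: one_diff_power_eq mult.commute)
    also have "\<dots> \<le> 1" using c by simp
    finally show ?thesis using k by (simp add: field_simps)
  qed
  finally show ?thesis .
qed

lemma ev_copula_perturbation:
  assumes C: "C \<in> ev_copulas" and C0: "C0 \<in> ev_copulas"
    and ge: "\<forall>x\<in>{0..1}. \<forall>y\<in>{0..1}. x * y \<le> C0 (x, y)"
    and M0: "doubly_stochastic M0" "C0 = restrict (\<lambda>(x, y). measure M0 ({..x} \<times> {..y})) unit_square"
    and k: "2 \<le> k"
  obtains D M where "D \<in> ev_copulas" "mdist ev_metric C D \<le> 1 / real k"
    "doubly_stochastic M" "D = restrict (\<lambda>(x, y). measure M ({..x} \<times> {..y})) unit_square"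
    "\<And>B. B \<in> sets borel \<Longrightarrow> emeasure M B = 0 \<Longrightarrow> AE q in M0. (fst q powr real k, snd q powr real k) \<notin> B"
proof -
  \<comment> \<open>\<open>a\<close> is \<open>b\<close> times the integer \<open>k - 1\<close>, so
    by max-stability both \<open>C\<close> and its mean with \<open>C0\<close> are expressed through
    values at \<open>(x powr b, y powr b)\<close>; \<open>2 \<le> k\<close> keeps \<open>a\<close>
    positive.\<close>
  define a b where "a = (real k - 1) / real k" and "b = 1 / real k"
  have ab: "0 < a" "0 < b" "a + b = 1" using k by (auto simp: a_def b_def field_simps)
  have cC: "copula C" "copula C0" using C C0 by (auto simp: ev_copulas_def)
  obtain M1 where M1: "doubly_stochastic M1" and "C = restrict (\<lambda>(x, y). measure M1 ({..x} \<times> {..y})) unit_square"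
    and C_M1: "\<And>x y. x \<in> {0..1} \<Longrightarrow> y \<in> {0..1} \<Longrightarrow> emeasure M1 ({..x} \<times> {..y}) = ennreal (C (x, y))"
    by (rule copulaE[OF cC(1)]) (rule that)
  interpret M0: prob_space M0 by (rule doubly_stochasticD[OF M0(1)])
  have C_M0: "emeasure M0 ({..x} \<times> {..y}) = ennreal (C0 (x, y))" if "x \<in> {0..1}" "y \<in> {0..1}" for x y
    using that by (simp add: M0.emeasure_eq_measure M0(2))
  define M where "M = max_law M1 M0 a b"
  define D where "D = restrict (\<lambda>(x, y). measure M ({..x} \<times> {..y})) unit_square"
  have M: "doubly_stochastic M"
    unfolding M_def by (rule doubly_stochastic_max_law[OF M1 M0(1) ab])
  have D: "D (x, y) = C (x powr a, y powr a) * C0 (x powr b, y powr b)"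
    if x: "x \<in> {0..1}" and y: "y \<in> {0..1}" for x y
  proof -
    have u: "x powr a \<in> {0..1}" "y powr a \<in> {0..1}" "x powr b \<in> {0..1}" "y powr b \<in> {0..1}"
      using x y ab by (intro powr_unit_interval; simp)+
    then have "0 \<le> C (x powr a, y powr a)" "0 \<le> C0 (x powr b, y powr b)"
      using copula_bounds(2)[OF cC(1)] copula_bounds(2)[OF cC(2)] by auto
    then show ?thesis
      using x y u emeasure_max_law[OF M1 M0(1) ab(1,2) x y]
      by (simp add: D_def measure_def M_def[symmetric] C_M1 C_M0 ennreal_mult'[symmetric])
  qed
  have "D (x powr (1 / real n), y powr (1 / real n)) ^ n = D (x, y)"
    if "0 < n" "x \<in> {0..1}" "y \<in> {0..1}" for n x y
  proof -
    have swap: "(z powr (1 / real n)) powr c = (z powr c) powr (1 / real n)" for z c :: real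
      by (simp add: powr_powr)
    have "D (x powr (1 / real n), y powr (1 / real n)) ^ n =
        C ((x powr a) powr (1 / real n), (y powr a) powr (1 / real n)) ^ n *
        C0 ((x powr b) powr (1 / real n), (y powr b) powr (1 / real n)) ^ n"
    proof (subst D)
      show "x powr (1 / real n) \<in> {0..1}" "y powr (1 / real n) \<in> {0..1}"
        using that by (intro powr_unit_interval; simp)+
    qed (simp add: swap power_mult_distrib)
    also have "\<dots> = C (x powr a, y powr a) * C0 (x powr b, y powr b)"
      using that ab
      by (subst ev_copula_max_stable[OF C] ev_copula_max_stable[OF C0]; (intro powr_unit_interval)?; simp)+
    finally show ?thesis using that by (simp add: D)
  qed
  then have lim: "(\<lambda>n. D (x powr (1 / real n), y powr (1 / real n)) ^ n) \<longlonglongrightarrow> D (x, y)"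
    if "x \<in> {0..1}" "y \<in> {0..1}" for x y
    using that by (intro tendsto_eventually eventually_mono[OF eventually_gt_at_top[of 0]]) auto
  have "copula D" unfolding copula_def using M D_def by blast
  with lim have D_ev: "D \<in> ev_copulas" unfolding ev_copulas_def by blast
  have close: "\<bar>C (x, y) - D (x, y)\<bar> \<le> 1 / real k" if x: "x \<in> {0..1}" and y: "y \<in> {0..1}" for x y
  proof -
    let ?u = "x powr b" and ?v = "y powr b"
    have u: "?u \<in> {0..1}" "?v \<in> {0..1}" using x y ab by (intro powr_unit_interval; simp)+
    have pw: "z powr a = (z powr b) ^ (k - 1)" if "z \<in> {0..1}" for z :: real
    proof (cases "z = 0")
      case False
      then have "(z powr b) ^ (k - 1) = z powr (b * real (k - 1))"
        using that by (subst powr_realpow[symmetric]) (auto simp: powr_powr)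
      moreover have "b * real (k - 1) = a" using k by (simp add: a_def b_def of_nat_diff)
      ultimately show ?thesis by simp
    qed (use ab k in auto)
    define c d where "c = C (?u, ?v)" and "d = C0 (?u, ?v)"
    have "C (x, y) = c ^ k"
      using ev_copula_max_stable[OF C x y, of k] k by (simp add: c_def b_def)
    moreover have "D (x, y) = c ^ (k - 1) * d"
      using ev_copula_power[OF C u, of "k - 1"] pw[OF x] pw[OF y] D[OF x y] by (simp add: c_def d_def)
    moreover have "\<bar>c ^ (k - 1) * d - c ^ k\<bar> \<le> 1 / real k"
    proof (rule power_diff_bound)
      show "0 \<le> c" "c \<le> 1" "d \<le> 1"
        using copula_bounds(2)[OF cC(1), of "(?u, ?v)"] copula_bounds(2)[OF cC(2), of "(?u, ?v)"] u
        by (auto simp: c_def d_def)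
      \<comment> \<open>The product separates the two copulas: \<open>C\<close> is at most the
        minimum, so \<open>c^2\<close> is at most the product, which \<open>ge\<close> puts below
        \<open>C0\<close>.\<close>
      have "c * c \<le> ?u * ?v"
        using copula_le_min[OF cC(1) u] \<open>0 \<le> c\<close> u by (intro mult_mono) (auto simp: c_def)
      also have "\<dots> \<le> d" unfolding d_def using u ge by blast
      finally show "c\<^sup>2 \<le> d" by (simp add: power2_eq_square)
    qed (use k in auto)
    ultimately show ?thesis by (simp add: abs_minus_commute)
  qed
  have "mdist ev_metric C D \<le> 1 / real k"
    unfolding mdist_ev_metric[OF C D_ev] by (rule cSUP_least) (use close in auto)
  moreover have "AE q in M0. (fst q powr real k, snd q powr real k) \<notin> B" if "B \<in> sets borel" "emeasure M B = 0" for B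
  proof -
    have "AE q in M0. (fst q powr (1 / b), snd q powr (1 / b)) \<notin> B"
    proof (rule max_law_null_imp[OF M1 M0(1) ab(1,2) that(1)])
      show "emeasure (max_law M1 M0 a b) B = 0" using that by (simp add: M_def)
      show "0 < emeasure M1 ({..x} \<times> {..y})" if "x \<in> {0<..1}" "y \<in> {0<..1}" for x y
        using ev_copula_pos[OF C that] that by (subst C_M1) auto
    qed
    then show ?thesis by (simp add: b_def)
  qed
  ultimately show thesis using that D_ev M D_def by blast
qed

section \<open>Extreme value copulas with a spectral representation\<close>

text \<open>The bounds say that \<open>f\<close> is concave with supergradient \<open>g\<close>,
  which replaces differentiability. \<open>g\<close> is antitone, hence integrable, and the
  increments of \<open>f\<close> minus the integral of \<open>g\<close> are bounded by the drop of
  \<open>g\<close> times the step; over \<open>n\<close> equal steps the drops telescope, leaving a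
  bound of order \<open>1 / n\<close>.\<close>

lemma has_integral_of_secant_bounds:
  fixes f g :: "real \<Rightarrow> real"
  assumes ab: "a \<le> b"
    and lo: "\<And>u v. a \<le> u \<Longrightarrow> u < v \<Longrightarrow> v \<le> b \<Longrightarrow> g v * (v - u) \<le> f v - f u"
    and up: "\<And>u v. a \<le> u \<Longrightarrow> u < v \<Longrightarrow> v \<le> b \<Longrightarrow> f v - f u \<le> g u * (v - u)"
  shows "(g has_integral (f b - f a)) {a..b}"
proof -
  have anti: "g v \<le> g u" if "a \<le> u" "u \<le> v" "v \<le> b" for u v
  proof (cases "u = v")
    case False
    then have uv: "u < v" using that by simp
    have "g v * (v - u) \<le> g u * (v - u)"
      by (rule order_trans[OF lo[OF that(1) uv that(3)] up[OF that(1) uv that(3)]])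
    then show ?thesis by (rule mult_right_le_imp_le) (use uv in simp)
  qed simp
  have "(\<lambda>x. - g x) integrable_on {a..b}"
    by (rule integrable_on_mono_on) (use anti in \<open>auto simp: mono_on_def\<close>)
  then have int: "g integrable_on {a..b}" by (simp add: integrable_neg_iff)
  have sub: "g integrable_on {u..v}" if "a \<le> u" "v \<le> b" for u v
    by (rule integrable_subinterval_real[OF int]) (use that in auto)
  define h where "h u = f u - integral {a..u} g" for u
  have step: "\<bar>h v - h u\<bar> \<le> (g u - g v) * (v - u)" if uv: "a \<le> u" "u < v" "v \<le> b" for u v
  proof -
    have "integral {a..v} g = integral {a..u} g + integral {u..v} g"
      using uv by (intro Henstock_Kurzweil_Integration.integral_combine[symmetric] sub) auto
    moreover have "integral {u..v} (\<lambda>_. g v) \<le> integral {u..v} g"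
      by (rule integral_le) (use sub[of u v] uv anti in auto)
    moreover have "integral {u..v} g \<le> integral {u..v} (\<lambda>_. g u)"
      by (rule integral_le) (use sub[of u v] uv anti in auto)
    moreover have "integral {u..v} (\<lambda>_. c) = c * (v - u)" for c
      using uv by (simp add: mult.commute)
    ultimately have "h v - h u = (f v - f u) - integral {u..v} g"
      and "g v * (v - u) \<le> integral {u..v} g" "integral {u..v} g \<le> g u * (v - u)"
      by (simp_all only: h_def)
    moreover have "(g u - g v) * (v - u) = g u * (v - u) - g v * (v - u)"
      by (rule left_diff_distrib)
    ultimately show ?thesis
      using lo[OF uv] up[OF uv] unfolding abs_le_iff by linarith
  qed
  have bound: "\<bar>h b - h a\<bar> \<le> (g a - g b) * (b - a) / real n" if n: "0 < n" for n :: nat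
  proof (cases "a = b")
    case False
    define t where "t i = a + (b - a) * real i / real n" for i
    have t0: "t 0 = a" "t n = b" using n by (auto simp: t_def)
    have dt: "t (Suc i) - t i = (b - a) / real n" for i
      by (simp add: t_def add_divide_distrib[symmetric] diff_divide_distrib[symmetric] algebra_simps)
    have "(b - a) / real n > 0" using ab False n by simp
    then have t_lt: "t i < t (Suc i)" for i using dt[of i] by simp
    then have t_mono: "t i \<le> t j" if "i \<le> j" for i j
      by (metis lift_Suc_mono_le less_imp_le that)
    have t_rng: "a \<le> t i" "t i \<le> b" if "i \<le> n" for i
      using t_mono[of 0 i] t_mono[of i n] that t0 by auto
    have "\<bar>h b - h a\<bar> = \<bar>\<Sum>i<n. h (t (Suc i)) - h (t i)\<bar>"
      using sum_lessThan_telescope[of "\<lambda>i. h (t i)" n] by (simp add: t0)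
    also have "\<dots> \<le> (\<Sum>i<n. \<bar>h (t (Suc i)) - h (t i)\<bar>)" by (rule sum_abs)
    also have "\<dots> \<le> (\<Sum>i<n. (g (t i) - g (t (Suc i))) * ((b - a) / real n))"
    proof (rule sum_mono)
      fix i assume "i \<in> {..<n}"
      then show "\<bar>h (t (Suc i)) - h (t i)\<bar> \<le> (g (t i) - g (t (Suc i))) * ((b - a) / real n)"
        using step[of "t i" "t (Suc i)"] t_lt[of i] t_rng[of i] t_rng[of "Suc i"] unfolding dt by simp
    qed
    also have "\<dots> = (\<Sum>i<n. g (t i) - g (t (Suc i))) * ((b - a) / real n)"
      by (rule sum_distrib_right[symmetric])
    also have "(\<Sum>i<n. g (t i) - g (t (Suc i))) = g a - g b"
      using sum_lessThan_telescope'[of "\<lambda>i. g (t i)" n] by (simp add: t0)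
    finally show ?thesis by simp
  qed simp
  have "(\<lambda>n. (g a - g b) * (b - a) / real n) \<longlonglongrightarrow> 0" by (rule lim_const_over_n)
  then have "\<bar>h b - h a\<bar> \<le> 0"
    by (rule LIMSEQ_le_const) (use bound in \<open>auto intro!: exI[of _ 1]\<close>)
  then have "integral {a..b} g = f b - f a" by (simp add: h_def)
  with int show ?thesis by (metis integrable_integral)
qed

lemma exp_mult_le:
  fixes p z :: real
  assumes "0 \<le> p" "p \<le> 1"
  shows "exp (p * z) \<le> 1 + p * (exp z - 1)"
  using convex_onD[OF exp_convex, of p 0 z] assms by (simp add: algebra_simps)

text \<open>A spectral representation with spectral functions \<open>1\<close> and
  \<open>1 / T\<close>; the mean 1 of \<open>1 / T\<close> makes the second margin uniform, as the
  constant does for the first. \<open>tail_dep\<close> below is the resulting stable tail dependence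
  function.\<close>

locale spectral = prob_space R for R :: "'w measure" +
  fixes T :: "'w \<Rightarrow> real"
  assumes T_meas [measurable]: "T \<in> borel_measurable R"
    and T_pos: "\<And>w. 0 < T w"
    and T_int: "integrable R (\<lambda>w. 1 / T w)" "(\<integral>w. 1 / T w \<partial>R) = 1"
begin

definition tail_dep :: "real \<Rightarrow> real \<Rightarrow> real" where
  "tail_dep s r = (\<integral>w. max s (r / T w) \<partial>R)"

text \<open>The probability of \<open>r / T \<le> s\<close>, the event on which
  \<open>max s (r / T)\<close> grows with slope 1 to the right of \<open>s\<close>: the right
  derivative of \<open>tail_dep\<close> in \<open>s\<close>.\<close>

definition prob_ge :: "real \<Rightarrow> real \<Rightarrow> real" where
  "prob_ge s r = prob {w \<in> space R. r \<le> s * T w}"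

lemma integrable_div_T: "integrable R (\<lambda>w. r / T w)"
  using integrable_mult_right[OF T_int(1), of r] by simp

lemma integral_div_T: "(\<integral>w. r / T w \<partial>R) = r"
  using T_int integral_mult_right_zero[of R r "\<lambda>w. 1 / T w"] by simp

lemma integrable_max_div_T: "integrable R (\<lambda>w. max s (r / T w))"
  by (intro integrable_max integrable_div_T) simp

lemma tail_dep_ge: "s \<le> tail_dep s r" "r \<le> tail_dep s r"
proof -
  have "(\<integral>w. s \<partial>R) \<le> tail_dep s r" "(\<integral>w. r / T w \<partial>R) \<le> tail_dep s r"
    unfolding tail_dep_def by (intro integral_mono integrable_max_div_T integrable_div_T; simp)+
  then show "s \<le> tail_dep s r" "r \<le> tail_dep s r" by (simp_all add: prob_space integral_div_T)
qed

lemma tail_dep_le: "tail_dep s r \<le> s + r" if "0 \<le> s" "0 \<le> r"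
proof -
  have "tail_dep s r \<le> (\<integral>w. s + r / T w \<partial>R)"
    unfolding tail_dep_def using that T_pos
    by (intro integral_mono integrable_max_div_T Bochner_Integration.integrable_add integrable_div_T)
       (auto simp: less_imp_le)
  also have "\<dots> = s + r"
    by (subst Bochner_Integration.integral_add) (simp_all add: integrable_div_T integral_div_T prob_space)
  finally show ?thesis .
qed

lemma tail_dep_scale: "tail_dep (c * s) (c * r) = c * tail_dep s r" if "0 \<le> c"
proof -
  have "max (c * s) (c * r / T w) = c * max s (r / T w)" for w
    using max_mult_distrib_left[of c s "r / T w"] that by auto
  then show ?thesis by (simp add: tail_dep_def)
qed

lemma tail_dep_Lipschitz_snd: "tail_dep s r - tail_dep s r' \<le> r - r'" if "r' \<le> r"
proof -
  have "tail_dep s r \<le> (\<integral>w. max s (r' / T w) + (r - r') / T w \<partial>R)"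
    unfolding tail_dep_def
  proof (intro integral_mono integrable_max_div_T Bochner_Integration.integrable_add integrable_div_T)
    fix w
    have "0 \<le> (r - r') / T w" using that T_pos[of w] by simp
    then show "max s (r / T w) \<le> max s (r' / T w) + (r - r') / T w"
      by (auto simp: diff_divide_distrib max_def)
  qed
  also have "\<dots> = tail_dep s r' + (r - r')"
    unfolding tail_dep_def
    by (subst Bochner_Integration.integral_add) (simp_all add: integrable_div_T integral_div_T integrable_max_div_T)
  finally show ?thesis by simp
qed

lemma tail_dep_mono_snd: "tail_dep s r' \<le> tail_dep s r" if "r' \<le> r"
  unfolding tail_dep_def using that T_pos
  by (intro integral_mono integrable_max_div_T max.mono divide_right_mono) (auto simp: less_imp_le)

text \<open>Pointwise, the maximum grows with slope 1 over the whole step where \<open>r / T\<close>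
  is at most \<open>s'\<close>, and not at all where it exceeds \<open>s\<close>.\<close>

lemma tail_dep_diff_bounds:
  assumes "s' < s"
  shows "(s - s') * prob_ge s' r \<le> tail_dep s r - tail_dep s' r"
    and "tail_dep s r - tail_dep s' r \<le> (s - s') * prob_ge s r"
proof -
  have p: "prob_ge c r = (\<integral>w. indicator {w \<in> space R. r \<le> c * T w} w \<partial>R)"
    and i: "integrable R (indicator {w \<in> space R. r \<le> c * T w} :: 'w \<Rightarrow> real)" for c
    by (auto simp: prob_ge_def intro!: integrable_real_indicator simp: less_top[symmetric])
  have d: "tail_dep s r - tail_dep s' r = (\<integral>w. max s (r / T w) - max s' (r / T w) \<partial>R)"
    unfolding tail_dep_def by (simp add: integrable_max_div_T)
  have iff: "r \<le> c * T w \<longleftrightarrow> r / T w \<le> c" for c w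
    using T_pos[of w] by (simp add: pos_divide_le_eq)
  have "(\<integral>w. (s - s') * indicator {w \<in> space R. r \<le> s' * T w} w \<partial>R) \<le> tail_dep s r - tail_dep s' r"
    unfolding d using assms
    by (intro integral_mono Bochner_Integration.integrable_diff integrable_max_div_T integrable_mult_right i)
       (auto simp: indicator_def iff)
  then show "(s - s') * prob_ge s' r \<le> tail_dep s r - tail_dep s' r" by (simp add: p)
  have "tail_dep s r - tail_dep s' r \<le> (\<integral>w. (s - s') * indicator {w \<in> space R. r \<le> s * T w} w \<partial>R)"
    unfolding d using assms
    by (intro integral_mono Bochner_Integration.integrable_diff integrable_max_div_T integrable_mult_right i)
       (auto simp: indicator_def iff)
  then show "tail_dep s r - tail_dep s' r \<le> (s - s') * prob_ge s r" by (simp add: p)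
qed

lemma prob_ge_bounds: "0 \<le> prob_ge s r" "prob_ge s r \<le> 1"
  by (simp_all add: prob_ge_def)

section \<open>The copula and its partial derivative in the first argument\<close>

definition cop :: "real \<Rightarrow> real \<Rightarrow> real" where
  "cop x y = (if 0 < x \<and> 0 < y then exp (- tail_dep (- ln x) (- ln y)) else 0)"

lemma cop_nonneg: "0 \<le> cop x y" by (simp add: cop_def)

lemma cop_pos: "0 < x \<Longrightarrow> 0 < y \<Longrightarrow> 0 < cop x y" by (simp add: cop_def)

lemma cop_le: "0 \<le> x \<Longrightarrow> cop x y \<le> x" "0 \<le> y \<Longrightarrow> cop x y \<le> y"
proof -
  have "exp (- tail_dep (- ln x) (- ln y)) \<le> exp (ln x)" "exp (- tail_dep (- ln x) (- ln y)) \<le> exp (ln y)"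
    using tail_dep_ge[where s = "- ln x" and r = "- ln y"] by simp_all
  then show "0 \<le> x \<Longrightarrow> cop x y \<le> x" "0 \<le> y \<Longrightarrow> cop x y \<le> y"
    by (cases "0 < x \<and> 0 < y"; simp only: cop_def exp_ln simp_thms if_True if_False)+
qed

lemma cop_ge_mult: "x * y \<le> cop x y" if "x \<in> {0..1}" "y \<in> {0..1}"
proof (cases "x = 0 \<or> y = 0")
  case False
  then have xy: "0 < x" "0 < y" using that by auto
  have "tail_dep (- ln x) (- ln y) \<le> - ln x + - ln y"
    using that xy by (intro tail_dep_le) auto
  then have "exp (ln x + ln y) \<le> exp (- tail_dep (- ln x) (- ln y))" by simp
  with xy show ?thesis by (simp add: cop_def exp_add)
qed (auto simp: cop_def)

lemma cop_1_left: "cop 1 y = y" and cop_1_right: "cop y 1 = y" if "y \<in> {0..1}"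
  using cop_le[of 1 y] cop_le[of y 1]
    cop_ge_mult[of 1 y] cop_ge_mult[of y 1] that by auto

lemma cop_mono_snd: "cop x y \<le> cop x y'" if "y \<le> y'"
  using that tail_dep_mono_snd[of "- ln y'" "- ln y" "- ln x"] by (auto simp: cop_def)

text \<open>Since \<open>tail_dep\<close> is 1-Lipschitz in \<open>r\<close>, raising
  \<open>y\<close> to \<open>y'\<close> multiplies \<open>cop\<close> by at most
  \<open>y' / y\<close>; with \<open>cop x y \<le> y\<close> the increment is at most
  \<open>y' - y\<close>. This gives right continuity of \<open>cop_cdf\<close>.\<close>

lemma cop_Lipschitz_snd: "cop x y' - cop x y \<le> y' - y" if "y \<le> y'"
proof (cases "0 < x \<and> 0 < y")
  case True
  then have y: "0 < x" "0 < y" "0 < y'" using that by auto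
  have "tail_dep (- ln x) (- ln y) - tail_dep (- ln x) (- ln y') \<le> ln y' - ln y"
    using tail_dep_Lipschitz_snd[of "- ln y'" "- ln y" "- ln x"] y that by simp
  then have "exp (- tail_dep (- ln x) (- ln y')) \<le> exp (- tail_dep (- ln x) (- ln y) + (ln y' - ln y))" by simp
  then have "cop x y' \<le> cop x y * (y' / y)"
    using y by (simp only: cop_def exp_add exp_diff exp_ln simp_thms if_True)
  then have "cop x y' - cop x y \<le> cop x y * (y' / y - 1)" by (simp add: right_diff_distrib)
  also have "\<dots> \<le> y * (y' / y - 1)"
    using cop_le(2)[of y x] y that by (intro mult_right_mono) auto
  also have "\<dots> = y' - y" using y by (simp add: field_simps)
  finally show ?thesis .
next
  case False
  then have "cop x y = 0" by (auto simp: cop_def)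
  moreover have "cop x y' \<le> y' - y"
  proof (cases "0 < x \<and> 0 < y'")
    case True
    then show ?thesis using False cop_le(2)[of y' x] by auto
  qed (use that in \<open>auto simp: cop_def\<close>)
  ultimately show ?thesis by simp
qed

lemma cop_power: "cop (x powr (1 / real n)) (y powr (1 / real n)) ^ n = cop x y"
  if "0 < n" "0 \<le> x" "0 \<le> y"
proof (cases "0 < x \<and> 0 < y")
  case True
  have "tail_dep (- ln (x powr (1 / real n))) (- ln (y powr (1 / real n))) = tail_dep ((1 / real n) * (- ln x)) ((1 / real n) * (- ln y))"
    using True by (simp add: ln_powr)
  also have "\<dots> = (1 / real n) * tail_dep (- ln x) (- ln y)"
    by (rule tail_dep_scale) simp
  finally show ?thesis using True that by (simp add: cop_def exp_of_nat_mult[symmetric])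
qed (use that in \<open>auto simp: cop_def power_0_left\<close>)

lemma cop_measurable_fst: "(\<lambda>x. cop x y) \<in> borel_measurable borel"
proof -
  have "mono (\<lambda>s. tail_dep s (- ln y))"
    unfolding tail_dep_def by (intro monoI integral_mono integrable_max_div_T) auto
  from borel_measurable_mono[OF this]
  have [measurable]: "(\<lambda>s. tail_dep s (- ln y)) \<in> borel_measurable borel" .
  show ?thesis unfolding cop_def by measurable
qed

text \<open>The partial derivative of \<^term>\<open>cop u y\<close> in \<open>u\<close>, up to countably many points; the value \<open>1\<close> for
  \<open>u \<le> 0\<close> keeps the secant bounds valid at the left end point.\<close>

definition dcop :: "real \<Rightarrow> real \<Rightarrow> real" where
  "dcop y u = (if u \<le> 0 then 1 else cop u y / u * prob_ge (- ln u) (- ln y))"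

lemma dcop_nonneg: "0 \<le> dcop y u"
  using cop_nonneg[of u y] prob_ge_bounds by (auto simp: dcop_def)

text \<open>With \<open>p\<close> the value of \<open>prob_ge\<close>, the bounds on
  \<open>tail_dep\<close> compare \<open>cop v y / cop u y\<close> with
  \<open>(v / u) powr p\<close>, and convexity of \<open>exp\<close> bounds this power by
  \<open>1 + p * (v / u - 1)\<close>, which is linear in \<open>v - u\<close>.\<close>

lemma dcop_has_integral:
  assumes x: "x \<in> {0..1}" and y: "0 < y"
  shows "(dcop y has_integral cop x y) {0..x}"
proof -
  have "(dcop y has_integral (cop x y - cop 0 y)) {0..x}"
  proof (rule has_integral_of_secant_bounds)
    fix u v assume uv: "0 \<le> u" "u < v" "v \<le> x"
    then have v: "0 < v" "v \<le> 1" using x by auto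
    let ?r = "- ln y"
    have "dcop y v * (v - u) \<le> cop v y - cop u y \<and> cop v y - cop u y \<le> dcop y u * (v - u)"
    proof (cases "u = 0")
      case True
      have "cop v y * prob_ge (- ln v) ?r \<le> cop v y * 1"
        using cop_nonneg prob_ge_bounds by (intro mult_left_mono) auto
      with True v cop_le(1)[of v y] show ?thesis by (simp add: dcop_def cop_def[of 0])
    next
      case False
      then have u: "0 < u" using uv by simp
      let ?s = "- ln u" and ?s' = "- ln v"
      have ss: "?s' < ?s" using u uv by simp
      define E where "E = tail_dep ?s ?r - tail_dep ?s' ?r"
      have E: "(?s - ?s') * prob_ge ?s' ?r \<le> E" "E \<le> (?s - ?s') * prob_ge ?s ?r"
        unfolding E_def by (rule tail_dep_diff_bounds[OF ss])+
      have vE: "cop v y = cop u y * exp E" and uE: "cop u y = cop v y * exp (- E)"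
        using u v y by (simp_all add: cop_def E_def exp_add[symmetric])
      have "exp E \<le> exp (prob_ge ?s ?r * (ln v - ln u))" using E(2) by (simp add: algebra_simps)
      also have "\<dots> \<le> 1 + prob_ge ?s ?r * (exp (ln v - ln u) - 1)"
        by (rule exp_mult_le) (rule prob_ge_bounds)+
      also have "exp (ln v - ln u) = v / u" using u v by (simp add: exp_diff)
      finally have "exp E - 1 \<le> prob_ge ?s ?r * (v / u - 1)" by simp
      then have "cop u y * (exp E - 1) \<le> cop u y * (prob_ge ?s ?r * (v / u - 1))"
        using cop_nonneg by (rule mult_left_mono)
      also have "\<dots> = dcop y u * (v - u)" using u by (simp add: dcop_def field_simps)
      finally have 1: "cop v y - cop u y \<le> dcop y u * (v - u)" unfolding vE by (simp add: algebra_simps)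
      have "exp (- E) \<le> exp (prob_ge ?s' ?r * (ln u - ln v))" using E(1) by (simp add: algebra_simps)
      also have "\<dots> \<le> 1 + prob_ge ?s' ?r * (exp (ln u - ln v) - 1)"
        by (rule exp_mult_le) (rule prob_ge_bounds)+
      also have "exp (ln u - ln v) = u / v" using u v by (simp add: exp_diff)
      finally have "prob_ge ?s' ?r * (1 - u / v) \<le> 1 - exp (- E)" by (simp add: algebra_simps)
      then have "cop v y * (prob_ge ?s' ?r * (1 - u / v)) \<le> cop v y * (1 - exp (- E))"
        using cop_nonneg by (rule mult_left_mono)
      moreover have "cop v y * (prob_ge ?s' ?r * (1 - u / v)) = dcop y v * (v - u)"
        using v by (simp add: dcop_def field_simps)
      ultimately have 2: "dcop y v * (v - u) \<le> cop v y - cop u y" unfolding uE by (simp add: algebra_simps)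
      from 1 2 show ?thesis by simp
    qed
    then show "dcop y v * (v - u) \<le> cop v y - cop u y" "cop v y - cop u y \<le> dcop y u * (v - u)" by auto
  qed (use x in auto)
  then show ?thesis by (simp add: cop_def[of 0])
qed

text \<open>The kernel below only matters on \<open>{0<..<1}\<close>; \<open>clamp\<close> makes it a probability measure
  everywhere.\<close>

definition clamp :: "real \<Rightarrow> real" where
  "clamp x = (if x \<in> {0<..<1} then x else 1 / 2)"

lemma clamp: "0 < clamp x" "clamp x < 1" "x \<in> {0<..<1} \<Longrightarrow> clamp x = x"
  by (auto simp: clamp_def)

text \<open>For \<open>x\<close> inside the unit interval, the first factor of
  \<open>dcop y x\<close>; capping \<open>y\<close> at 1 makes it a distribution function, because
  \<open>cop x 1 = x\<close>.\<close>

definition cop_cdf :: "real \<Rightarrow> real \<Rightarrow> real" where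
  "cop_cdf x y = cop (clamp x) (min 1 y) / clamp x"

text \<open>The second factor of \<open>dcop\<close>, the value of \<open>prob_ge\<close>, is the
  distribution function of \<open>x powr T\<close>, so the product belongs to the maximum of
  \<open>x powr T\<close> and an independent variable with distribution function
  \<open>cop_cdf x\<close>.\<close>

definition cop_kernel :: "real \<Rightarrow> real measure" where
  "cop_kernel x = distr (R \<Otimes>\<^sub>M interval_measure (cop_cdf x)) borel (\<lambda>(w, v). max v (clamp x powr T w))"

lemma
  shows cdf_kernel_measurable: "(\<lambda>x. interval_measure (cop_cdf x)) \<in> borel \<rightarrow>\<^sub>M prob_algebra borel"
    and emeasure_cdf_kernel: "emeasure (interval_measure (cop_cdf x)) {..y} = ennreal (cop_cdf x y)"
proof -
  have mono: "cop_cdf x y \<le> cop_cdf x y'" if "y \<le> y'" for x y y'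
    unfolding cop_cdf_def using clamp[of x] that by (intro divide_right_mono cop_mono_snd) auto
  have cont: "continuous (at_right a) (cop_cdf x)" for x a
  proof (subst continuous_at_right_real_increasing)
    show "cop_cdf x y \<le> cop_cdf x y'" if "y \<le> y'" for y y' using mono[OF that] .
    show "\<forall>e>0. \<exists>d>0. cop_cdf x (a + d) - cop_cdf x a < e"
    proof (intro allI impI)
      fix e :: real assume e: "0 < e"
      define d where "d = e * clamp x / 2"
      have d: "0 < d" using e clamp[of x] by (simp add: d_def)
      have "cop (clamp x) (min 1 (a + d)) - cop (clamp x) (min 1 a) \<le> min 1 (a + d) - min 1 a"
        using d by (intro cop_Lipschitz_snd) auto
      also have "\<dots> \<le> d" using d by auto
      finally have "cop_cdf x (a + d) - cop_cdf x a \<le> d / clamp x"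
        unfolding cop_cdf_def diff_divide_distrib[symmetric] using clamp[of x] by (intro divide_right_mono) auto
      also have "\<dots> < e" using e clamp[of x] by (simp add: d_def)
      finally show "\<exists>d>0. cop_cdf x (a + d) - cop_cdf x a < e" using d by auto
    qed
  qed
  have neg: "cop_cdf x y = 0" if "y < 0" for x y using that by (auto simp: cop_cdf_def cop_def)
  have ge1: "cop_cdf x y = 1" if "1 \<le> y" for x y
    using that clamp[of x] by (auto simp: cop_cdf_def min_def cop_1_right)
  have "(\<lambda>x. cop_cdf x y) \<in> borel_measurable borel" for y
  proof -
    have [measurable]: "clamp \<in> borel_measurable borel" unfolding clamp_def by measurable
    have "(\<lambda>x. cop (clamp x) (min 1 y)) \<in> borel_measurable borel"
      by (rule measurable_compose[OF _ cop_measurable_fst]) measurable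
    then show ?thesis unfolding cop_cdf_def by measurable
  qed
  note K = interval_measure_kernel[of cop_cdf, OF mono cont neg ge1 this]
  show "(\<lambda>x. interval_measure (cop_cdf x)) \<in> borel \<rightarrow>\<^sub>M prob_algebra borel"
    "emeasure (interval_measure (cop_cdf x)) {..y} = ennreal (cop_cdf x y)"
    using K(1,2) by auto
qed

lemma max_map_measurable: "(\<lambda>(w, v). max v (clamp x powr T w)) \<in> R \<Otimes>\<^sub>M interval_measure (cop_cdf x) \<rightarrow>\<^sub>M borel"
  by measurable

lemma cop_kernel_measurable: "cop_kernel \<in> borel \<rightarrow>\<^sub>M prob_algebra borel"
  unfolding cop_kernel_def
proof (rule measurable_distr_prob_space2)
  have "R \<in> space (prob_algebra R)" by (simp add: space_prob_algebra prob_space_axioms)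
  then show "(\<lambda>x. R \<Otimes>\<^sub>M interval_measure (cop_cdf x)) \<in> borel \<rightarrow>\<^sub>M prob_algebra (R \<Otimes>\<^sub>M borel)"
    by (intro measurable_pair_prob cdf_kernel_measurable measurable_const)
  have [measurable]: "clamp \<in> borel_measurable borel" unfolding clamp_def by measurable
  show "(\<lambda>(x, wv). (\<lambda>(w, v). max v (clamp x powr T w)) wv) \<in> borel \<Otimes>\<^sub>M (R \<Otimes>\<^sub>M borel) \<rightarrow>\<^sub>M borel"
    by measurable
qed

lemma prob_space_cdf_kernel: "prob_space (interval_measure (cop_cdf x))"
  by (rule kernel_prob_space[OF cdf_kernel_measurable])

lemma emeasure_cop_kernel:
  assumes x: "x \<in> {0<..<1}" and y: "0 < y"
  shows "emeasure (cop_kernel x) {..y} = ennreal (cop_cdf x y * prob_ge (- ln x) (- ln y))"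
proof -
  interpret K: prob_space "interval_measure (cop_cdf x)" by (rule prob_space_cdf_kernel)
  have c: "clamp x = x" using x by (simp add: clamp_def)
  have "emeasure (cop_kernel x) {..y} = emeasure (R \<Otimes>\<^sub>M interval_measure (cop_cdf x))
      ((\<lambda>(w, v). max v (clamp x powr T w)) -` {..y} \<inter> space (R \<Otimes>\<^sub>M interval_measure (cop_cdf x)))"
    unfolding cop_kernel_def by (rule emeasure_distr[OF max_map_measurable]) simp
  also have "(\<lambda>(w, v). max v (clamp x powr T w)) -` {..y} \<inter> space (R \<Otimes>\<^sub>M interval_measure (cop_cdf x)) =
      {w \<in> space R. - ln y \<le> - ln x * T w} \<times> {..y}"
  proof -
    have "x powr t \<le> y \<longleftrightarrow> - ln y \<le> - ln x * t" for t
    proof -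
      have "x powr t \<le> y \<longleftrightarrow> t * ln x \<le> ln y"
        using x y by (metis exp_le_cancel_iff exp_ln greaterThanLessThan_iff powr_def less_irrefl)
      then show ?thesis by (simp add: mult.commute)
    qed
    then have "{w \<in> space R. - ln y \<le> - ln x * T w} = {w \<in> space R. x powr T w \<le> y}"
      by (simp only: refl)
    moreover have "(\<lambda>(w, v). max v (clamp x powr T w)) -` {..y} \<inter> space (R \<Otimes>\<^sub>M interval_measure (cop_cdf x)) =
        {w \<in> space R. x powr T w \<le> y} \<times> {..y}"
      by (auto simp: space_pair_measure c)
    ultimately show ?thesis by (simp only: refl)
  qed
  also have "emeasure (R \<Otimes>\<^sub>M interval_measure (cop_cdf x)) ({w \<in> space R. - ln y \<le> - ln x * T w} \<times> {..y}) =
      emeasure R {w \<in> space R. - ln y \<le> - ln x * T w} * emeasure (interval_measure (cop_cdf x)) {..y}"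
    by (rule K.emeasure_pair_measure_Times) auto
  also have "\<dots> = ennreal (prob_ge (- ln x) (- ln y)) * ennreal (cop_cdf x y)"
    by (simp add: emeasure_cdf_kernel emeasure_eq_measure prob_ge_def)
  also have "\<dots> = ennreal (cop_cdf x y * prob_ge (- ln x) (- ln y))"
    by (subst ennreal_mult'[symmetric]) (simp_all add: prob_ge_bounds mult.commute cop_cdf_def cop_nonneg clamp less_imp_le)
  finally show ?thesis .
qed

lemma emeasure_semidirect_cop_kernel:
  assumes x: "x \<in> {0..1}" and y: "y \<in> {0..1}"
  shows "emeasure (semidirect cop_kernel) ({..x} \<times> {..y}) = ennreal (cop x y)"
proof -
  have main: "emeasure (semidirect cop_kernel) ({..x} \<times> {..y}) = ennreal (cop x y)" if y: "0 < y" "y \<le> 1" for y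
  proof -
    have [measurable]: "(\<lambda>u. emeasure (cop_kernel u) {..y}) \<in> borel_measurable borel"
    proof -
      have "UNIV \<times> {..y} \<in> sets (borel :: (real \<times> real) measure)" by (intro borel_Times) auto
      moreover have "Pair u -` (UNIV \<times> {..y}) = {..y}" for u :: real by auto
      ultimately show ?thesis using measurable_kernel_section[OF cop_kernel_measurable, of "UNIV \<times> {..y}"] by simp
    qed
    have "emeasure (semidirect cop_kernel) ({..x} \<times> {..y}) = (\<integral>\<^sup>+u\<in>{..x}. emeasure (cop_kernel u) {..y} \<partial>unit_leb)"
      by (rule emeasure_semidirect_Times[OF cop_kernel_measurable]) auto
    also have "\<dots> = (\<integral>\<^sup>+u. emeasure (cop_kernel u) {..y} * indicator {..x} u * indicator {0..1} u \<partial>lborel)"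
      by (subst nn_integral_unit_leb) auto
    also have "\<dots> = (\<integral>\<^sup>+u. indicator {0..x} u * ennreal (dcop y u) \<partial>lborel)"
    proof (rule nn_integral_cong_AE)
      have ne: "AE u in lborel. u \<noteq> (0::real)" "AE u in lborel. u \<noteq> (1::real)" by (rule AE_lborel_singleton)+
      show "AE u in lborel. emeasure (cop_kernel u) {..y} * indicator {..x} u * indicator {0..1} u =
          indicator {0..x} u * ennreal (dcop y u)"
        using ne
      proof eventually_elim
        case (elim u)
        show ?case
        proof (cases "u \<in> {0..x}")
          case True
          then have u: "u \<in> {0<..<1}" using elim x by auto
          have "cop_cdf u y = cop u y / u" using y u by (simp add: cop_cdf_def clamp min_def)
          then show ?thesis using True u x emeasure_cop_kernel[OF u y(1)] by (simp add: dcop_def)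
        qed (auto simp: indicator_def)
      qed
    qed
    also have "\<dots> = (\<integral>\<^sup>+u. ennreal (indicator {0..x} u * dcop y u) \<partial>lborel)"
      by (intro nn_integral_cong) (auto simp: indicator_def)
    also have "\<dots> = ennreal (cop x y)"
      using nn_integral_has_integral_lebesgue[OF dcop_nonneg dcop_has_integral[OF x y(1)]] by simp
    finally show ?thesis .
  qed
  show ?thesis
  proof (cases "y = 0")
    case True
    have le: "emeasure (semidirect cop_kernel) ({..x} \<times> {..0}) \<le> ennreal e" if "0 < e" for e
    proof -
      have "emeasure (semidirect cop_kernel) ({..x} \<times> {..0}) \<le> emeasure (semidirect cop_kernel) ({..x} \<times> {..min 1 e})"
        using that by (intro emeasure_mono) (auto simp: sets_semidirect[OF cop_kernel_measurable] intro!: borel_Times)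
      also have "\<dots> = ennreal (cop x (min 1 e))" using that by (intro main) auto
      also have "\<dots> \<le> ennreal e" using cop_le(2)[of "min 1 e" x] that by (intro ennreal_leI) auto
      finally show ?thesis .
    qed
    have "emeasure (semidirect cop_kernel) ({..x} \<times> {..0}) \<le> 0"
      by (rule ennreal_le_epsilon) (use le in auto)
    then show ?thesis using True by (simp add: cop_def)
  qed (use main y in auto)
qed

lemma spectral_ev_copula:
  obtains C M where "C \<in> ev_copulas" "\<forall>x\<in>{0..1}. \<forall>y\<in>{0..1}. x * y \<le> C (x, y)"
    "doubly_stochastic M" "C = restrict (\<lambda>(x, y). measure M ({..x} \<times> {..y})) unit_square"
    "\<And>B. B \<in> sets borel \<Longrightarrow> emeasure M B = 0 \<Longrightarrow> AE x in unit_leb. AE w in R. (x, x powr T w) \<notin> B"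
proof -
  define M where "M = semidirect cop_kernel"
  define C where "C = restrict (\<lambda>(x, y). measure M ({..x} \<times> {..y})) unit_square"
  note sets_M = sets_semidirect[OF cop_kernel_measurable, folded M_def]
  have box: "emeasure M ({..x} \<times> {..y}) = ennreal (cop x y)" if "x \<in> {0..1}" "y \<in> {0..1}" for x y
    unfolding M_def by (rule emeasure_semidirect_cop_kernel[OF that])
  have C: "C (x, y) = cop x y" if "x \<in> {0..1}" "y \<in> {0..1}" for x y
    using that box[OF that] by (simp add: C_def measure_def cop_nonneg)
  have "distr M borel fst = unit_leb" unfolding M_def by (rule distr_fst_semidirect[OF cop_kernel_measurable])
  have M: "doubly_stochastic M"
  proof (rule doubly_stochasticI[OF sets_M])
    show prob: "prob_space M" unfolding M_def by (rule prob_space_semidirect[OF cop_kernel_measurable])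
    fix x :: real assume x: "0 \<le> x" "x \<le> 1"
    have sp: "space M = UNIV" using sets_eq_imp_space_eq[OF sets_M] by simp
    have fst: "fst \<in> M \<rightarrow>\<^sub>M (borel :: real measure)" by (simp cong: measurable_cong_sets[OF sets_M refl])
    have fst_M: "emeasure M (A \<times> UNIV) = emeasure unit_leb A" if "A \<in> sets borel" for A
    proof -
      have "emeasure unit_leb A = emeasure M (fst -` A \<inter> space M)"
        using that by (subst \<open>distr M borel fst = unit_leb\<close>[symmetric]) (rule emeasure_distr[OF fst])
      also have "fst -` A \<inter> space M = A \<times> UNIV" by (auto simp: sp)
      finally show ?thesis by simp
    qed
    then show "emeasure M ({..x} \<times> UNIV) = ennreal x"
      using x by (simp add: emeasure_unit_leb_atMost)
    have "{1<..} \<times> UNIV \<in> null_sets M"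
    proof -
      have "{1<..} \<inter> {0..1::real} = {}" by auto
      then show ?thesis
        using fst_M[of "{1<..}"] by (auto simp: null_sets_def sets_M emeasure_unit_leb intro!: borel_Times)
    qed
    from AE_not_in[OF this] have "emeasure M (UNIV \<times> {..x}) = emeasure M ({..1} \<times> {..x})"
      by (intro emeasure_eq_AE) (auto elim!: eventually_mono intro!: borel_Times simp: sets_M mem_Times_iff)
    then show "emeasure M (UNIV \<times> {..x}) = ennreal x"
      using x box[of 1 x] by (simp add: cop_1_left)
  qed
  have "copula C" unfolding copula_def using M C_def by blast
  moreover have "(\<lambda>n. C (x powr (1 / real n), y powr (1 / real n)) ^ n) \<longlonglongrightarrow> C (x, y)"
    if xy: "x \<in> {0..1}" "y \<in> {0..1}" for x y
  proof (rule tendsto_eventually, rule eventually_mono[OF eventually_gt_at_top[of 0]])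
    fix n :: nat assume "0 < n"
    then show "C (x powr (1 / real n), y powr (1 / real n)) ^ n = C (x, y)"
      using xy cop_power[of n x y] powr_unit_interval[of x "1 / real n"] powr_unit_interval[of y "1 / real n"]
      by (simp add: C)
  qed
  ultimately have "C \<in> ev_copulas" unfolding ev_copulas_def by blast
  moreover have "\<forall>x\<in>{0..1}. \<forall>y\<in>{0..1}. x * y \<le> C (x, y)"
    using cop_ge_mult C by simp
  moreover have "AE x in unit_leb. AE w in R. (x, x powr T w) \<notin> B" if B: "B \<in> sets borel" "emeasure M B = 0" for B
  proof -
    have "(\<integral>\<^sup>+x. emeasure (cop_kernel x) (Pair x -` B) \<partial>unit_leb) = 0"
      using emeasure_semidirect[OF cop_kernel_measurable B(1)] B(2) by (simp add: M_def)
    then have "AE x in unit_leb. emeasure (cop_kernel x) (Pair x -` B) = 0"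
      using measurable_kernel_section[OF cop_kernel_measurable B(1)]
      by (subst (asm) nn_integral_0_iff_AE) auto
    then show ?thesis using AE_unit_leb_interior
    proof eventually_elim
      case (elim x)
      interpret K: prob_space "interval_measure (cop_cdf x)" by (rule prob_space_cdf_kernel)
      interpret P: pair_prob_space R "interval_measure (cop_cdf x)" ..
      have c: "clamp x = x" using elim by (simp add: clamp)
      have "Pair x -` B \<in> null_sets (cop_kernel x)"
        using elim(1) borel_section[OF B(1)] by (auto simp: null_sets_def cop_kernel_def)
      then have "AE v in cop_kernel x. v \<notin> Pair x -` B" by (rule AE_not_in)
      then have "AE z in R \<Otimes>\<^sub>M interval_measure (cop_cdf x). (\<lambda>(w, v). max v (x powr T w)) z \<notin> Pair x -` B"
        unfolding cop_kernel_def c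
      proof (subst (asm) AE_distr_iff)
        have "Pair x -` (- B) \<in> sets borel" by (rule borel_section) (use B in auto)
        then show "{v \<in> space borel. v \<notin> Pair x -` B} \<in> sets borel"
          by (simp add: Collect_neg_eq vimage_Compl[symmetric] vimage_def)
      qed (use max_map_measurable[of x] in \<open>simp_all add: c\<close>)
      from P.AE_pair[OF this]
      have "AE w in R. AE v in interval_measure (cop_cdf x). max v (x powr T w) \<notin> Pair x -` B" by simp
      then show ?case
      proof eventually_elim
        case (elim w)
        let ?y = "x powr T w"
        have x: "0 < x" "x < 1" using \<open>x \<in> {0<..<1}\<close> by auto
        show ?case
        proof
          assume inB: "(x, ?y) \<in> B"
          \<comment> \<open>A \<open>v\<close> below the curve makes the maximum the curve point
            itself, which lies in \<open>B\<close>. So \<open>{..?y}\<close> would be null, whereas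
            \<open>cop_cdf x\<close> is positive at positive arguments.\<close>
          have "AE v in interval_measure (cop_cdf x). v \<notin> {..?y}"
            using elim
          proof eventually_elim
            case (elim v)
            then show ?case using inB by (auto simp: max_def split: if_splits)
          qed
          then have "emeasure (interval_measure (cop_cdf x)) {..?y} = 0"
            by (subst (asm) AE_iff_measurable[OF _ refl]) (auto simp: atMost_def)
          moreover have "0 < cop_cdf x ?y"
            using x by (auto simp: cop_cdf_def c intro!: divide_pos_pos cop_pos)
          ultimately show False by (simp add: emeasure_cdf_kernel)
        qed
      qed
    qed
  qed
  ultimately show thesis using that M C_def by blast
qed

end

section \<open>The law of the random curve\<close>

text \<open>The distribution function of a law with an atom at every rational is strictly increasing; by the
  quantile transform, the values it takes at irrational points form a null set.\<close>

lemma strict_mono_null_range: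
  obtains c :: "real \<Rightarrow> real" and N where "strict_mono c" "N \<in> null_sets lborel" "range c \<subseteq> N"
proof -
  \<comment> \<open>The geometric law charges every code and \<open>from_nat\<close> reaches every
    rational, so all rationals are atoms.\<close>
  define P where "P = distr (measure_pmf (geometric_pmf (1 / 2))) borel (\<lambda>n. real_of_rat (from_nat n))"
  interpret P: cdf_distribution P
    unfolding cdf_distribution_def P_def by (rule prob_space.real_distribution_distr[OF prob_space_measure_pmf]) simp
  define c where "c = cdf P"
  have atom: "0 < measure P {real_of_rat q}" for q
  proof -
    have "to_nat q \<in> (\<lambda>n. real_of_rat (from_nat n)) -` {real_of_rat q}" by simp
    then have "measure (geometric_pmf (1 / 2)) {to_nat q} \<le> measure P {real_of_rat q}"
      unfolding P_def by (subst measure_distr) (auto intro!: measure_pmf.finite_measure_mono)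
    moreover have "0 < measure (geometric_pmf (1 / 2)) {to_nat q}" by (simp add: measure_pmf_single)
    ultimately show ?thesis by simp
  qed
  have mono: "strict_mono c"
  proof (rule strict_monoI)
    fix x y :: real assume xy: "x < y"
    then obtain q where q: "x < real_of_rat q" "real_of_rat q < y" using of_rat_dense by blast
    have "measure P {real_of_rat q} \<le> measure P {x<..y}"
      using q by (intro P.finite_measure_mono) auto
    with atom[of q] P.cdf_diff_eq[OF xy] show "c x < c y" by (simp add: c_def)
  qed
  have c_rng: "c x \<in> {0<..<1}" for x
    using strict_monoD[OF mono, of "x - 1" x] strict_monoD[OF mono, of x "x + 1"]
      P.cdf_nonneg[of "x - 1"] P.cdf_bounded_prob[of "x + 1"] by (auto simp: c_def)
  \<comment> \<open>Strict monotonicity makes the quantile function a left inverse of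
    \<open>c\<close>, so at irrational \<open>x\<close> the value \<open>c x\<close> lies in the set
    \<open>Z\<close> below, which is null because \<open>P\<close> lives on the rationals.\<close>
  have I_c: "P.I (c x) = x" for x
  proof -
    have "{x'. c x \<le> c x'} = {x..}" using strict_mono_less_eq[OF mono] by auto
    then show ?thesis by (simp add: c_def)
  qed
  define Z where "Z = {w \<in> {0<..<1}. P.I w \<notin> \<rat>}"
  have I_meas: "P.I \<in> restrict_space lborel {0<..<1} \<rightarrow>\<^sub>M borel"
    using P.measurable_CI by (simp cong: measurable_cong_sets add: sets_restrict_space)
  have rat: "- \<rat> \<in> sets (borel :: real measure)" by (simp add: countable_rat sets.countable borel_comp)
  have Z_eq: "Z = P.I -` (- \<rat>) \<inter> space (restrict_space lborel {0<..<1})"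
    by (auto simp: Z_def space_restrict_space)
  have Zr: "Z \<in> sets (restrict_space lborel {0<..<1})"
    unfolding Z_eq by (rule measurable_sets[OF I_meas rat])
  have "emeasure (restrict_space lborel {0<..<1}) Z = emeasure P (- \<rat>)"
    unfolding Z_eq by (subst P.distr_I_eq_M[symmetric], rule emeasure_distr[OF I_meas rat, symmetric])
  also have "\<dots> = 0"
    unfolding P_def using rat by (subst emeasure_distr) (auto simp: vimage_def)
  finally have "emeasure lborel Z = 0"
    using Zr by (subst (asm) emeasure_restrict_space) (auto simp: sets_restrict_space_iff)
  moreover have "Z \<in> sets lborel"
    using Zr by (subst (asm) sets_restrict_space_iff) auto
  ultimately have "Z \<in> null_sets lborel" by (auto simp: null_sets_def)
  moreover have "c ` \<rat> \<in> null_sets lborel"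
    by (intro countable_imp_null_set_lborel countable_image countable_rat)
  ultimately have N: "Z \<union> c ` \<rat> \<in> null_sets lborel" by (rule null_sets.Un)
  have "range c \<subseteq> Z \<union> c ` \<rat>"
    using c_rng I_c by (auto simp: Z_def)
  with mono N that show thesis by blast
qed

text \<open>Passing to an equivalent measure makes \<open>1 / T\<close> integrable without changing
  null sets; scaling \<open>T\<close> by \<open>k\<close>, the mean of \<open>1 / T\<close> under
  the new measure, then makes that mean 1.\<close>

lemma spectral_normalization:
  assumes "prob_space P" and T [measurable]: "T \<in> borel_measurable P" and pos: "\<And>w. 0 < T w"
  obtains R k where "0 < k" "spectral R (\<lambda>w. k * T w)" "\<And>Q. AE w in R. Q w \<Longrightarrow> AE w in P. Q w"
proof -
  interpret P: prob_space P by fact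
  \<comment> \<open>The weight is positive, at most 1 so that it can be normalised, and at most
    \<open>T\<close> so that \<open>v / T\<close> is bounded.\<close>
  define v where "v w = min 1 (T w)" for w
  have v_pos: "0 < v w" and v_le: "v w \<le> 1" for w using pos[of w] by (auto simp: v_def)
  have [measurable]: "v \<in> borel_measurable P" unfolding v_def by measurable
  have v_int: "integrable P v"
    by (rule P.integrable_const_bound[of _ 1]) (use v_pos v_le in \<open>auto simp: less_imp_le abs_of_pos\<close>)
  have integral_pos: "0 < (\<integral>w. f w \<partial>P)" if "integrable P f" "\<And>w. 0 < f w" for f :: "_ \<Rightarrow> real"
  proof -
    have "(\<integral>w. f w \<partial>P) \<noteq> 0"
    proof
      assume "(\<integral>w. f w \<partial>P) = 0"
      then have "AE w in P. f w = 0"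
        using that by (subst (asm) integral_nonneg_eq_0_iff_AE) (auto simp: less_imp_le)
      then have "AE w in P. False" by eventually_elim (use that(2) in \<open>metis less_irrefl\<close>)
      then show False by simp
    qed
    moreover have "0 \<le> (\<integral>w. f w \<partial>P)" using that by (intro integral_nonneg_AE) (auto simp: less_imp_le)
    ultimately show ?thesis by simp
  qed
  define a where "a = (\<integral>w. v w \<partial>P)"
  have a: "0 < a" unfolding a_def by (rule integral_pos[OF v_int v_pos])
  define R where "R = density P (\<lambda>w. ennreal (v w / a))"
  have va: "0 < v w / a" for w using a v_pos by simp
  have [measurable_cong]: "sets R = sets P" by (simp add: R_def)
  have "emeasure R (space R) = (\<integral>\<^sup>+w. ennreal (v w / a) \<partial>P)"
    unfolding R_def by (subst emeasure_density) (auto intro!: nn_integral_cong)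
  also have "\<dots> = ennreal (\<integral>w. v w / a \<partial>P)"
    using v_int va by (intro nn_integral_eq_integral) (auto simp: less_imp_le)
  also have "(\<integral>w. v w / a \<partial>P) = 1" using a by (simp add: a_def)
  finally have "prob_space R" by (intro prob_spaceI) simp
  have uv: "integrable P (\<lambda>w. v w / a * (1 / T w))"
  proof (rule P.integrable_const_bound[of _ "1 / a"])
    have "v w / a * (1 / T w) \<le> 1 / a" "0 \<le> v w / a * (1 / T w)" for w
    proof -
      have "v w \<le> T w" by (simp add: v_def)
      then show "v w / a * (1 / T w) \<le> 1 / a" using a pos[of w] by (simp add: field_simps)
      show "0 \<le> v w / a * (1 / T w)" using va[of w] pos[of w] by (intro mult_nonneg_nonneg) simp_all
    qed
    then show "AE w in P. norm (v w / a * (1 / T w)) \<le> 1 / a"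
      by (intro AE_I2) (simp only: real_norm_def abs_of_nonneg)
  qed measurable
  define k where "k = (\<integral>w. v w / a * (1 / T w) \<partial>P)"
  have "0 < v w / a * (1 / T w)" for w
    using mult_pos_pos[OF va[of w], of "1 / T w"] pos[of w] by simp
  then have k: "0 < k" unfolding k_def by (rule integral_pos[OF uv])
  have intR: "integrable R (\<lambda>w. 1 / T w)" "(\<integral>w. 1 / T w \<partial>R) = k"
    unfolding R_def k_def using uv va
    by (subst integrable_real_density integral_real_density; auto simp: less_imp_le)+
  have "spectral R (\<lambda>w. k * T w)"
  proof -
    have eq: "1 / (k * T w) = (1 / k) * (1 / T w)" for w by simp
    show ?thesis
      unfolding spectral_def spectral_axioms_def
    proof (intro conjI allI)
      show "integrable R (\<lambda>w. 1 / (k * T w))" unfolding eq using intR(1) by (rule integrable_mult_right)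
      show "(\<integral>w. 1 / (k * T w) \<partial>R) = 1" using k by (simp only: eq integral_mult_right_zero intR(2)) simp
    qed (use k pos \<open>prob_space R\<close> in \<open>auto\<close>)
  qed
  moreover have "AE w in P. Q w" if "AE w in R. Q w" for Q
    using that va unfolding R_def by (subst (asm) AE_density) (auto simp: ennreal_less_zero_iff)
  ultimately show thesis using that k by blast
qed

text \<open>The random parameter is a geometric code \<open>n\<close> for a rational
  \<open>q\<close> and an index \<open>i\<close>, together with a uniform \<open>u\<close>. Each
  code has positive weight, so an almost sure statement splits into one for every multiple of every
  law; \<open>exp\<close> moves real laws to the positive axis.\<close>

lemma ev_copula_charging_curves:
  fixes e :: "nat \<Rightarrow> real \<Rightarrow> real"
  assumes e [measurable]: "\<And>i. e i \<in> borel_measurable borel"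
  obtains C M k where "C \<in> ev_copulas" "\<forall>x\<in>{0..1}. \<forall>y\<in>{0..1}. x * y \<le> C (x, y)"
    "doubly_stochastic M" "C = restrict (\<lambda>(x, y). measure M ({..x} \<times> {..y})) unit_square" "0 < k"
    "\<And>B. B \<in> sets borel \<Longrightarrow> emeasure M B = 0 \<Longrightarrow>
       AE x in unit_leb. \<forall>q>0. \<forall>i. AE u in unit_leb. (x, x powr (k * real_of_rat q * exp (e i u))) \<notin> B"
proof -
  interpret U: prob_space unit_leb by (rule prob_space_unit_leb)
  interpret GU: pair_prob_space "measure_pmf (geometric_pmf (1 / 2) :: nat pmf)" unit_leb ..
  define P where "P = measure_pmf (geometric_pmf (1 / 2) :: nat pmf) \<Otimes>\<^sub>M unit_leb"
  \<comment> \<open>The default 1 for nonpositive \<open>q\<close> keeps \<open>T\<close>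
    positive.\<close>
  define s where "s n = (let q = fst (from_nat n :: rat \<times> nat) in if 0 < q then real_of_rat q else 1)" for n
  define t where "t n = e (snd (from_nat n :: rat \<times> nat))" for n
  define T where "T = (\<lambda>(n, u). s n * exp (t n u))"
  have "T \<in> borel_measurable (count_space UNIV \<Otimes>\<^sub>M borel)"
    unfolding T_def
    by (intro measurable_pair_measure_countable1) (auto simp: t_def)
  then have "T \<in> borel_measurable P"
    unfolding P_def by (simp cong: measurable_cong_sets add: sets_pair_measure_cong[of _ "count_space UNIV" unit_leb borel])
  moreover have "0 < T w" for w by (auto simp: T_def s_def Let_def zero_less_mult_iff split: prod.splits)
  moreover have "prob_space P"
    unfolding P_def by (intro prob_space_pair prob_space_measure_pmf prob_space_unit_leb)
  ultimately obtain R k where k: "0 < k" and sp: "spectral R (\<lambda>w. k * T w)"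
    and R: "\<And>Q. AE w in R. Q w \<Longrightarrow> AE w in P. Q w"
    using spectral_normalization by metis
  interpret spectral R "\<lambda>w. k * T w" by (rule sp)
  obtain C M where C: "C \<in> ev_copulas" "\<forall>x\<in>{0..1}. \<forall>y\<in>{0..1}. x * y \<le> C (x, y)"
    "doubly_stochastic M" "C = restrict (\<lambda>(x, y). measure M ({..x} \<times> {..y})) unit_square"
    and M: "\<And>B. B \<in> sets borel \<Longrightarrow> emeasure M B = 0 \<Longrightarrow> AE x in unit_leb. AE w in R. (x, x powr (k * T w)) \<notin> B"
    by (rule spectral_ev_copula) (rule that)
  have "AE x in unit_leb. \<forall>q>0. \<forall>i. AE u in unit_leb. (x, x powr (k * real_of_rat q * exp (e i u))) \<notin> B"
    if B: "B \<in> sets borel" "emeasure M B = 0" for B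
    using M[OF B]
  proof eventually_elim
    case (elim x)
    from GU.AE_pair[OF R[OF elim, unfolded P_def]]
    have *: "AE u in unit_leb. (x, x powr (k * T (n, u))) \<notin> B" for n
      by (simp add: AE_measure_pmf_iff set_pmf_geometric)
    show ?case
    proof (intro allI impI)
      fix q :: rat and i :: nat assume "0 < q"
      then have "T (to_nat (q, i), u) = real_of_rat q * exp (e i u)" for u
        by (simp add: T_def s_def t_def Let_def)
      with *[of "to_nat (q, i)"] show "AE u in unit_leb. (x, x powr (k * real_of_rat q * exp (e i u))) \<notin> B"
        by (simp add: mult.assoc)
    qed
  qed
  then show thesis using that[OF C k] by blast
qed

text \<open>Differentiable images of null sets are negligible but need not be Borel, hence the
  enclosing Borel null set.\<close>

lemma null_sets_lborel_image:
  fixes f :: "real \<Rightarrow> real"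
  assumes N: "N \<in> null_sets lborel" and f: "f differentiable_on S"
  obtains N' where "N' \<in> null_sets lborel" "f ` (N \<inter> S) \<subseteq> N'"
proof -
  have "negligible (N \<inter> S)"
    by (rule negligible_subset[of N]) (use null_sets_completionI[OF N] in \<open>simp_all add: negligible_iff_null_sets\<close>)
  then have "negligible (f ` (N \<inter> S))"
    by (rule negligible_differentiable_image_negligible[OF order_refl]) (rule differentiable_on_subset[OF f], simp)
  then have "f ` (N \<inter> S) \<in> null_sets lebesgue" unfolding negligible_iff_null_sets .
  then obtain N' where "N' \<in> null_sets lborel" "f ` (N \<inter> S) \<subseteq> N'"
    unfolding null_sets_completion_iff2 by (rule bexE)
  then show thesis by (rule that)
qed

text \<open>The exceptional set is carried along by \<open>x powr a\<close>, which is differentiable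
  away from 0 and so preserves null sets. This undoes the change of the first coordinate caused by
  the powers in the geometric mean.\<close>

lemma AE_unit_leb_powr:
  assumes Q: "AE x in unit_leb. Q (x powr a)" and a: "0 < a"
  shows "AE x in unit_leb. Q x"
proof -
  obtain N where N: "N \<in> null_sets lborel" "{x. \<not> (x \<in> {0..1} \<longrightarrow> Q (x powr a))} \<subseteq> N"
    using Q unfolding AE_unit_leb by (auto elim!: AE_E simp: null_sets_def)
  have "(\<lambda>x. x powr a) differentiable_on {0<..}"
    using has_real_derivative_powr has_field_derivative_at_within
    unfolding differentiable_on_def real_differentiable_def by (metis greaterThan_iff)
  from null_sets_lborel_image[OF N(1) this]
  obtain N' where N': "N' \<in> null_sets lborel" "(\<lambda>x. x powr a) ` (N \<inter> {0<..}) \<subseteq> N'" by blast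
  have "AE x in unit_leb. x \<notin> N'" by (rule AE_not_in[OF null_sets_lborel_imp_unit_leb[OF N'(1)]])
  then show ?thesis using AE_unit_leb_interior
  proof eventually_elim
    case (elim x)
    let ?u = "x powr (1 / a)"
    have u: "?u \<in> {0<..1}" "?u powr a = x" using elim a by (auto simp: powr_powr intro!: powr_le1)
    have "?u \<notin> N"
    proof
      assume "?u \<in> N"
      then have "?u powr a \<in> N'" using N'(2) u(1) by auto
      with elim u show False by simp
    qed
    moreover have "?u \<in> {0..1}" using u(1) by auto
    ultimately have "Q (?u powr a)" using N(2) by blast
    with u show ?case by simp
  qed
qed

section \<open>Full supports and density\<close>

lemma ex_rat_in_scaled_open:
  fixes B :: "real set"
  assumes B: "open B" "t \<in> B" "0 < t" and s: "0 < s"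
  obtains q :: rat where "0 < q" "s * real_of_rat q \<in> B"
proof -
  have "open ((\<lambda>z. s * z) -` B \<inter> {0<..})"
    by (intro open_Int open_vimage B continuous_intros)
  moreover have "t / s \<in> (\<lambda>z. s * z) -` B \<inter> {0<..}" using B s by auto
  ultimately obtain e where e: "0 < e" "ball (t / s) e \<subseteq> (\<lambda>z. s * z) -` B \<inter> {0<..}"
    by (rule openE)
  obtain q :: rat where q: "t / s < real_of_rat q" "real_of_rat q < t / s + e"
    using of_rat_dense[of "t / s" "t / s + e"] e by auto
  then have "real_of_rat q \<in> ball (t / s) e" by (simp add: dist_real_def)
  with e have "s * real_of_rat q \<in> B" "0 < real_of_rat q" by auto
  then show thesis using that by (simp add: zero_less_of_rat_iff)
qed

lemma AE_unit_leb_ex_open: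
  assumes P: "AE x in unit_leb. P x" and A: "open A" "x0 \<in> A" "x0 \<in> {0<..<1}"
  obtains x where "x \<in> A" "x \<in> {0<..<1}" "P x"
proof (rule ccontr)
  assume "\<not> thesis"
  then have n: "\<And>x. x \<in> A \<inter> {0<..<1} \<Longrightarrow> \<not> P x" using that by blast
  have "AE x in lborel. x \<notin> A \<inter> {0<..<1}"
    using P unfolding AE_unit_leb by eventually_elim (use n in force)
  then have "A \<inter> {0<..<1} \<in> null_sets lborel"
    using A by (subst (asm) AE_iff_null_sets[symmetric]) auto
  then have "negligible (A \<inter> {0<..<1})"
    unfolding negligible_iff_null_sets by (rule null_sets_completionI)
  moreover have "open (A \<inter> {0<..<1})" "A \<inter> {0<..<1} \<noteq> {}" using A by auto
  ultimately show False using open_not_negligible by blast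
qed

text \<open>The box contains the points of \<open>y = x powr t\<close> for all \<open>t\<close>
  close to \<open>t0\<close> and \<open>x\<close> close to \<open>x0\<close>. The rational factor is
  chosen after \<open>u\<close>, so whatever value \<open>exp (e u)\<close> takes, some multiple of
  it lands close to \<open>t0\<close>.\<close>

lemma emeasure_box_Int_pos:
  fixes e :: "real \<Rightarrow> real"
  assumes k: "0 < k"
    and null: "\<And>B. B \<in> sets borel \<Longrightarrow> emeasure M B = 0 \<Longrightarrow>
       AE x in unit_leb. \<forall>q>0. AE u in unit_leb. (x, x powr (k * real_of_rat q * exp (e u))) \<notin> B"
    and S: "S \<in> sets borel"
      "AE x in unit_leb. \<forall>q>0. AE u in unit_leb. (x, x powr (k * real_of_rat q * exp (e u))) \<in> S"
    and E: "open E" "open F" "x0 \<in> E" "y0 \<in> F" "x0 \<in> {0<..<1}" "y0 \<in> {0<..<1}"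
  shows "emeasure M (E \<times> F \<inter> S) \<noteq> 0"
proof
  assume z: "emeasure M (E \<times> F \<inter> S) = 0"
  \<comment> \<open>The exponent of the curve through \<open>(x0, y0)\<close>.\<close>
  define t0 where "t0 = ln y0 / ln x0"
  have t0: "0 < t0" "x0 powr t0 = y0"
    using E by (auto simp: t0_def powr_def divide_neg_neg)
  have "continuous_on ({0<..} \<times> UNIV) (\<lambda>p :: real \<times> real. fst p powr snd p)"
    by (intro continuous_intros) auto
  then have "open (({0<..} \<times> UNIV) \<inter> (\<lambda>p :: real \<times> real. fst p powr snd p) -` F)"
    by (rule continuous_open_preimage) (auto intro: open_Times E)
  moreover have "(x0, t0) \<in> ({0<..} \<times> UNIV) \<inter> (\<lambda>p. fst p powr snd p) -` F"
    using t0 E by auto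
  ultimately obtain A B where AB: "open A" "open B" "(x0, t0) \<in> A \<times> B"
    "A \<times> B \<subseteq> ({0<..} \<times> UNIV) \<inter> (\<lambda>p. fst p powr snd p) -` F"
    by (elim open_prod_elim) blast
  have "E \<times> F \<inter> S \<in> sets borel" using E S by (auto intro!: sets.Int borel_Times)
  from null[OF this z] S(2)
  have "AE x in unit_leb. \<forall>q>0. AE u in unit_leb. (x, x powr (k * real_of_rat q * exp (e u))) \<notin> E \<times> F"
  proof eventually_elim
    case (elim x)
    show ?case
    proof (intro allI impI)
      fix q :: rat assume "0 < q"
      with elim have "AE u in unit_leb. (x, x powr (k * real_of_rat q * exp (e u))) \<notin> E \<times> F \<inter> S"
        "AE u in unit_leb. (x, x powr (k * real_of_rat q * exp (e u))) \<in> S" by auto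
      then show "AE u in unit_leb. (x, x powr (k * real_of_rat q * exp (e u))) \<notin> E \<times> F"
        by eventually_elim auto
    qed
  qed
  then obtain x where x: "x \<in> A \<inter> E"
    and no: "\<forall>q>0. AE u in unit_leb. (x, x powr (k * real_of_rat q * exp (e u))) \<notin> E \<times> F"
    using AB E by (elim AE_unit_leb_ex_open[where A = "A \<inter> E" and ?x0.0 = x0]) auto
  have "AE u in unit_leb. \<forall>q>0. (x, x powr (k * real_of_rat q * exp (e u))) \<notin> E \<times> F"
    using no by (subst AE_all_countable) auto
  then obtain u where u: "\<forall>q>0. (x, x powr (k * real_of_rat q * exp (e u))) \<notin> E \<times> F"
    by (elim AE_unit_leb_ex_open[where A = UNIV and ?x0.0 = "1 / 2"]) auto
  obtain q where q: "0 < q" "k * exp (e u) * real_of_rat q \<in> B"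
    using ex_rat_in_scaled_open[of B t0 "k * exp (e u)"] AB t0 k by auto
  then have "x powr (k * real_of_rat q * exp (e u)) \<in> F"
    using AB x by (auto simp: mult_ac)
  with u q(1) x show False by auto
qed

lemma supp_restriction_eq_unit_square:
  assumes M: "doubly_stochastic M" and S: "S \<in> sets borel"
    and pos: "\<And>E F x y. open E \<Longrightarrow> open F \<Longrightarrow> x \<in> E \<Longrightarrow> y \<in> F \<Longrightarrow> x \<in> {0<..<1} \<Longrightarrow> y \<in> {0<..<1} \<Longrightarrow>
      emeasure M (E \<times> F \<inter> S) \<noteq> 0"
  shows "supp (density M (indicator S)) = unit_square"
proof -
  note [simp] = doubly_stochasticD(1)[OF M]
  have em: "emeasure (density M (indicator S)) B = emeasure M (S \<inter> B)" if "B \<in> sets borel" for B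
    using that S by (intro emeasure_restricted) auto
  show ?thesis
  proof (intro equalityI subsetI)
    fix p assume p: "p \<in> supp (density M (indicator S))"
    have op: "open (- unit_square :: (real \<times> real) set)" by (intro open_Compl closed_Times) auto
    have "emeasure M (S \<inter> - unit_square) = emeasure M {}"
      by (rule emeasure_eq_AE) (use doubly_stochastic_outside[OF M] S op in \<open>auto elim!: eventually_mono\<close>)
    then have "emeasure (density M (indicator S)) (- unit_square) = 0" using op by (simp add: em)
    with op p show "p \<in> unit_square" unfolding supp_def by blast
  next
    fix p :: "real \<times> real" assume p: "p \<in> unit_square"
    show "p \<in> supp (density M (indicator S))"
      unfolding supp_def
    proof
      assume "p \<in> \<Union>{U. open U \<and> emeasure (density M (indicator S)) U = 0}"
      then obtain U where U: "open U" "emeasure M (S \<inter> U) = 0" "p \<in> U" by (auto simp: em)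
      then obtain E F where EF: "open E" "open F" "p \<in> E \<times> F" "E \<times> F \<subseteq> U"
        by (elim open_prod_elim) blast
      \<comment> \<open>\<open>pos\<close> asks for interior points; every neighbourhood of a
        boundary point of the square contains some.\<close>
      have "\<exists>x\<in>G. x \<in> {0<..<1}" if "open G" "z \<in> G" "z \<in> {0..1}" for G and z :: real
      proof -
        have "z \<in> closure {0<..<1}" using that by simp
        then have "G \<inter> {0<..<1} \<noteq> {}" using that by (subst (asm) closure_iff_nhds_not_empty) blast
        then show ?thesis by auto
      qed
      then obtain x y where "x \<in> E" "x \<in> {0<..<1}" "y \<in> F" "y \<in> {0<..<1}"
        using EF p by (metis mem_Times_iff)
      with pos EF have "emeasure M (E \<times> F \<inter> S) \<noteq> 0" by blast
      moreover have "emeasure M (E \<times> F \<inter> S) \<le> emeasure M (S \<inter> U)"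
        using EF U S by (intro emeasure_mono) auto
      ultimately show False using U by simp
    qed
  qed
qed

text \<open>For the atom and the singular law, the curves fill a set with small sections; by
  maximality it lies in \<open>H\<close> or \<open>N\<close> up to an \<open>M\<close>-null set,
  which \<open>null\<close> lets the curves avoid. For the absolutely continuous law, the curves hit
  the null sections of \<open>N\<close> only for a null set of \<open>u\<close>.\<close>

lemma full_supports_of_charging_curves:
  fixes c :: "real \<Rightarrow> real"
  assumes M: "doubly_stochastic M" and C: "C = restrict (\<lambda>(x, y). measure M ({..x} \<times> {..y})) unit_square"
    and k: "0 < k" and c: "strict_mono c" "Nc \<in> null_sets lborel" "range c \<subseteq> Nc"
    and null: "\<And>B e. B \<in> sets borel \<Longrightarrow> emeasure M B = 0 \<Longrightarrow> e \<in> {\<lambda>u. 0, c, \<lambda>u. u} \<Longrightarrow>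
       AE x in unit_leb. \<forall>q>0. AE u in unit_leb. (x, x powr (k * real_of_rat q * exp (e u))) \<notin> B"
  shows "supp (mu_dis C) = unit_square \<and> supp (mu_sing C) = unit_square \<and> supp (mu_abs C) = unit_square"
proof -
  obtain H N where "H \<subseteq> N" and H: "H \<in> sets borel" and N: "N \<in> sets borel"
    and Hc: "\<And>x. countable (Pair x -` H)" and N_null: "AE x in unit_leb. Pair x -` N \<in> null_sets lborel"
    and Hmax: "\<And>W. W \<in> sets borel \<Longrightarrow> \<forall>x. countable (Pair x -` W) \<Longrightarrow> emeasure M (W - H) = 0"
    and Nmax: "\<And>W. W \<in> sets borel \<Longrightarrow> AE x in unit_leb. Pair x -` W \<in> null_sets lborel \<Longrightarrow> emeasure M (W - N) = 0"
    and mu: "mu_dis C = density M (indicator H)" "mu_sing C = density M (indicator (N - H))"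
      "mu_abs C = density M (indicator (- N))"
    by (rule copula_parts[OF M C]) (rule that)
  have kq: "0 < k * real_of_rat q" if "0 < q" for q using k that by (simp add: zero_less_of_rat_iff)
  have unit_AE: "AE u in unit_leb. u \<notin> Z" if "Z \<in> null_sets lborel" for Z
    by (rule AE_not_in[OF null_sets_lborel_imp_unit_leb[OF that]])
  have AE_rat: "AE x in unit_leb. \<forall>q>0. P x q" if "\<And>q. 0 < q \<Longrightarrow> AE x in unit_leb. P x q" for P :: "real \<Rightarrow> rat \<Rightarrow> bool"
    using that by (subst AE_all_countable) auto
  have supp: "supp (density M (indicator S)) = unit_square"
    if S: "S \<in> sets borel" and e: "e \<in> {\<lambda>u. 0, c, \<lambda>u. u}"
      and AE_S: "AE x in unit_leb. \<forall>q>0. AE u in unit_leb. (x, x powr (k * real_of_rat q * exp (e u))) \<in> S" for S e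
    by (rule supp_restriction_eq_unit_square[OF M S])
       (rule emeasure_box_Int_pos[OF k null[OF _ _ e] S AE_S]; assumption)
  have dis: "supp (density M (indicator H)) = unit_square"
  proof (rule supp[of _ "\<lambda>u. 0"])
    show "AE x in unit_leb. \<forall>q>0. AE u in unit_leb. (x, x powr (k * real_of_rat q * exp 0)) \<in> H"
    proof (rule AE_rat)
      fix q :: rat assume q: "0 < q"
      \<comment> \<open>A single curve for each \<open>q\<close>: its vertical sections are
        singletons, so \<open>Hmax\<close> applies.\<close>
      define G where "G = {p :: real \<times> real. snd p = fst p powr (k * real_of_rat q)}"
      have G: "G \<in> sets borel"
      proof -
        have "{p \<in> space borel. snd p = fst p powr (k * real_of_rat q)} \<in> sets (borel :: (real \<times> real) measure)"
          by measurable
        then show ?thesis by (simp add: G_def)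
      qed
      have "Pair x -` G = {x powr (k * real_of_rat q)}" for x by (auto simp: G_def)
      then have "emeasure M (G - H) = 0" using G by (intro Hmax) auto
      then have "AE x in unit_leb. \<forall>q>0. AE u in unit_leb. (x, x powr (k * real_of_rat q * exp 0)) \<notin> G - H"
        using G H null[of "G - H" "\<lambda>u. 0"] by simp
      then show "AE x in unit_leb. AE u in unit_leb. (x, x powr (k * real_of_rat q * exp 0)) \<in> H"
      proof eventually_elim
        case (elim x)
        with q have "AE u in unit_leb. (x, x powr (k * real_of_rat q * exp 0)) \<notin> G - H" by blast
        then show ?case by eventually_elim (auto simp: G_def)
      qed
    qed
  qed (use H in auto)
  have sing: "supp (density M (indicator (N - H))) = unit_square"
  proof (rule supp[of _ c])
    show "AE x in unit_leb. \<forall>q>0. AE u in unit_leb. (x, x powr (k * real_of_rat q * exp (c u))) \<in> N - H"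
    proof (rule AE_rat)
      fix q :: rat assume q: "0 < q"
      let ?a = "k * real_of_rat q"
      \<comment> \<open>The curves \<open>y = x powr (?a * exp w)\<close> with
        \<open>w \<in> Nc\<close>, in Borel form: the double logarithm recovers \<open>w\<close>
        from a point. \<open>Nc\<close> stands in for \<open>range c\<close> because it is given as
        a Borel set.\<close>
      define G where "G = {p :: real \<times> real. fst p \<in> {0<..<1} \<and> snd p \<in> {0<..<1} \<and> ln (ln (snd p) / (?a * ln (fst p))) \<in> Nc}"
      have Nc: "Nc \<in> sets borel" using c(2) by auto
      have G: "G \<in> sets borel"
      proof -
        have "(\<lambda>p :: real \<times> real. ln (ln (snd p) / (?a * ln (fst p)))) \<in> borel_measurable borel"
          by measurable
        from measurable_sets[OF this Nc]
        have "{0<..<1} \<times> {0<..<1} \<inter> (\<lambda>p :: real \<times> real. ln (ln (snd p) / (?a * ln (fst p)))) -` Nc \<in> sets borel"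
          by (intro sets.Int borel_Times) auto
        also have "{0<..<1} \<times> {0<..<1} \<inter> (\<lambda>p :: real \<times> real. ln (ln (snd p) / (?a * ln (fst p)))) -` Nc = G"
          by (auto simp: G_def)
        finally show ?thesis .
      qed
      have curve: "ln (ln (x powr (?a * exp w)) / (?a * ln x)) = w" if "x \<in> {0<..<1}" for x w
        using that k q by simp
      have "Pair x -` G \<in> null_sets lborel" for x
      proof (cases "x \<in> {0<..<1}")
        case True
        \<comment> \<open>A section of \<open>G\<close> lies in the smooth image of the null set
          \<open>Nc\<close>.\<close>
        have "(\<lambda>w. x powr (?a * exp w)) differentiable_on UNIV"
        proof -
          have "((\<lambda>w. x powr (?a * exp w)) has_real_derivative x powr (?a * exp w) * ln x * (?a * exp w)) (at w)" for w
            using True by (auto intro!: derivative_eq_intros)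
          then show ?thesis unfolding differentiable_on_def real_differentiable_def by blast
        qed
        from null_sets_lborel_image[OF c(2) this] obtain N' where
          N': "N' \<in> null_sets lborel" "(\<lambda>w. x powr (?a * exp w)) ` Nc \<subseteq> N'" by auto
        have "Pair x -` G \<subseteq> N'"
        proof
          fix y assume "y \<in> Pair x -` G"
          then have y: "y \<in> {0<..<1}" "ln (ln y / (?a * ln x)) \<in> Nc" by (auto simp: G_def)
          have "0 < ln y / (?a * ln x)"
            using y True kq[OF q] by (intro divide_neg_neg) (auto simp: mult_pos_neg)
          then have "?a * exp (ln (ln y / (?a * ln x))) * ln x = ln y"
            using True k q by (simp add: field_simps)
          then have "x powr (?a * exp (ln (ln y / (?a * ln x)))) = y"
            using True y by (simp add: powr_def)
          with N'(2) y(2) show "y \<in> N'" by force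
        qed
        then show ?thesis using N'(1) borel_section[OF G, of x] by (auto intro: null_sets_subset)
      qed (auto simp: G_def)
      then have "emeasure M (G - N) = 0" using G by (intro Nmax) auto
      then have "AE x in unit_leb. \<forall>q>0. AE u in unit_leb. (x, x powr (k * real_of_rat q * exp (c u))) \<notin> G - N"
        using G N null[of "G - N" c] by simp
      then show "AE x in unit_leb. AE u in unit_leb. (x, x powr (?a * exp (c u))) \<in> N - H"
        using AE_unit_leb_interior
      proof eventually_elim
        case (elim x)
        with q have 1: "AE u in unit_leb. (x, x powr (?a * exp (c u))) \<notin> G - N" by blast
        have x: "0 < x" "x < 1" using elim by auto
        have inj: "inj (\<lambda>u. x powr (?a * exp (c u)))"
        proof (rule injI)
          fix u v assume "x powr (?a * exp (c u)) = x powr (?a * exp (c v))"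
          then have "c u = c v" using curve[OF elim(2)] by metis
          then show "u = v" using strict_mono_eq[OF c(1)] by simp
        qed
        \<comment> \<open>Different \<open>u\<close> give different points over \<open>x\<close>, so
          a countable section of \<open>H\<close> is hit for countably many \<open>u\<close>; here
          strict monotonicity of \<open>c\<close> excludes atoms.\<close>
        have "countable {u. x powr (?a * exp (c u)) \<in> Pair x -` H}"
          by (rule countable_image_inj_on[OF countable_subset[OF _ Hc[of x]] inj_on_subset[OF inj]]) auto
        then have 2: "AE u in unit_leb. u \<notin> {u. x powr (?a * exp (c u)) \<in> Pair x -` H}"
          by (intro unit_AE countable_imp_null_set_lborel)
        have "x powr (?a * exp w) \<in> {0<..<1}" for w
          using x kq[OF q] by (auto simp: powr_def mult_pos_neg)
        then have "(x, x powr (?a * exp (c u))) \<in> G" for u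
          using elim(2) c(3) curve[OF elim(2)] by (auto simp: G_def)
        with 1 2 show ?case by (auto elim!: eventually_elim2)
      qed
    qed
  qed (use H N in auto)
  have abs: "supp (density M (indicator (- N))) = unit_square"
  proof (rule supp[of _ "\<lambda>u. u"])
    show "AE x in unit_leb. \<forall>q>0. AE u in unit_leb. (x, x powr (k * real_of_rat q * exp u)) \<in> - N"
    proof (rule AE_rat)
      fix q :: rat assume q: "0 < q"
      let ?a = "k * real_of_rat q"
      show "AE x in unit_leb. AE u in unit_leb. (x, x powr (?a * exp u)) \<in> - N"
        using N_null AE_unit_leb_interior
      proof eventually_elim
        case (elim x)
        have a: "?a * ln x < 0" using elim(2) kq[OF q] by (auto simp: mult_pos_neg)
        \<comment> \<open>The inverse of the parametrisation by \<open>u\<close> is differentiable,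
          so it takes the null section of \<open>N\<close> to a null set of parameters.\<close>
        have "(\<lambda>y. ln (ln y / (?a * ln x))) differentiable_on {0<..<1}"
        proof -
          have "((\<lambda>y. ln (ln y / (?a * ln x))) has_real_derivative
              inverse (ln y / (?a * ln x)) * (inverse y / (?a * ln x))) (at y)" if "y \<in> {0<..<1}" for y
            using that a divide_neg_neg[of "ln y" "?a * ln x"]
            by (auto intro!: derivative_eq_intros simp: field_simps)
          then show ?thesis
            unfolding differentiable_on_def real_differentiable_def
            by (meson has_field_derivative_at_within)
        qed
        from null_sets_lborel_image[OF elim(1) this] obtain N' where
          N': "N' \<in> null_sets lborel" "(\<lambda>y. ln (ln y / (?a * ln x))) ` (Pair x -` N \<inter> {0<..<1}) \<subseteq> N'" by blast
        have "(x, x powr (?a * exp u)) \<in> - N" if "u \<notin> N'" for u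
        proof
          assume "(x, x powr (?a * exp u)) \<in> N"
          moreover have "x powr (?a * exp u) \<in> {0<..<1}"
            using elim(2) kq[OF q] by (auto simp: powr_def mult_pos_neg)
          moreover have "ln (ln (x powr (?a * exp u)) / (?a * ln x)) = u"
            using elim(2) k q by simp
          ultimately have "u \<in> N'" using N'(2) by force
          with that show False ..
        qed
        with unit_AE[OF N'(1)] show ?case by (auto elim!: eventually_mono)
      qed
    qed
  qed (use N in auto)
  from dis sing abs show ?thesis by (simp add: mu)
qed

theorem theorem4p10:
  "mtopology_of ev_metric closure_of
     {C \<in> ev_copulas. supp (mu_dis C) = unit_square \<and> supp (mu_sing C) = unit_square \<and>
                      supp (mu_abs C) = unit_square}
   = ev_copulas"
proof -
  let ?F = "{C \<in> ev_copulas. supp (mu_dis C) = unit_square \<and> supp (mu_sing C) = unit_square \<and>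
                      supp (mu_abs C) = unit_square}"
  obtain c :: "real \<Rightarrow> real" and Nc where c: "strict_mono c" "Nc \<in> null_sets lborel" "range c \<subseteq> Nc"
    by (rule strict_mono_null_range) (rule that)
  \<comment> \<open>With \<open>u\<close> uniform these have an atomic, a singular and an absolutely
    continuous law; later indices repeat the last one to fill up the sequence.\<close>
  define e where "e i = (if i = 0 then \<lambda>u. 0 else if i = Suc 0 then c else (\<lambda>u. u))" for i :: nat
  have "e i \<in> borel_measurable borel" for i
    using borel_measurable_mono[OF strict_mono_mono[OF c(1)]] by (auto simp: e_def)
  then obtain C0 M0 k where C0: "C0 \<in> ev_copulas" "\<forall>x\<in>{0..1}. \<forall>y\<in>{0..1}. x * y \<le> C0 (x, y)"
    "doubly_stochastic M0" "C0 = restrict (\<lambda>(x, y). measure M0 ({..x} \<times> {..y})) unit_square"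
    and k: "0 < k" and M0: "\<And>B. B \<in> sets borel \<Longrightarrow> emeasure M0 B = 0 \<Longrightarrow>
       AE x in unit_leb. \<forall>q>0. \<forall>i. AE u in unit_leb. (x, x powr (k * real_of_rat q * exp (e i u))) \<notin> B"
    by (rule ev_copula_charging_curves) (rule that)
  have dense: "\<exists>D\<in>?F. mdist ev_metric C D \<le> 1 / real n" if C: "C \<in> ev_copulas" and n: "2 \<le> n" for C n
  proof -
    obtain D M where D: "D \<in> ev_copulas" "mdist ev_metric C D \<le> 1 / real n"
      and M: "doubly_stochastic M" "D = restrict (\<lambda>(x, y). measure M ({..x} \<times> {..y})) unit_square"
      and MM0: "\<And>B. B \<in> sets borel \<Longrightarrow> emeasure M B = 0 \<Longrightarrow> AE p in M0. (fst p powr real n, snd p powr real n) \<notin> B"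
      by (rule ev_copula_perturbation[OF C C0 n]) (rule that)
    have null: "AE x in unit_leb. \<forall>q>0. \<forall>i. AE u in unit_leb. (x, x powr (k * real_of_rat q * exp (e i u))) \<notin> B"
      if B: "B \<in> sets borel" "emeasure M B = 0" for B
    proof (rule AE_unit_leb_powr)
      \<comment> \<open>The powers map the curve \<open>y = x powr t\<close> to itself, with
        \<open>x\<close> replaced by \<open>x powr real n\<close>. Avoiding \<open>?B\<close> along
        the curves of \<open>M0\<close> therefore means avoiding \<open>B\<close> along the same
        curves, reparametrised.\<close>
      let ?B = "{p. (fst p powr real n, snd p powr real n) \<in> B}"
      have B': "?B \<in> sets borel"
      proof -
        have "(\<lambda>p :: real \<times> real. (fst p powr real n, snd p powr real n)) \<in> borel \<rightarrow>\<^sub>M borel \<Otimes>\<^sub>M borel"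
          by measurable
        then have "(\<lambda>p :: real \<times> real. (fst p powr real n, snd p powr real n)) -` B \<inter> space borel \<in> sets borel"
          using B(1) unfolding borel_prod by (rule measurable_sets)
        then show ?thesis by (simp add: vimage_def)
      qed
      have "emeasure M0 ?B = 0"
        using MM0[OF B] B'
        by (subst (asm) AE_iff_measurable[OF _ refl]) (auto simp: doubly_stochasticD(1,2)[OF C0(3)])
      from M0[OF B' this]
      show "AE x in unit_leb. \<forall>q>0. \<forall>i. AE u in unit_leb.
          (x powr real n, (x powr real n) powr (k * real_of_rat q * exp (e i u))) \<notin> B"
        by eventually_elim (simp add: powr_powr mult_ac)
    qed (use n in simp)
    have "supp (mu_dis D) = unit_square \<and> supp (mu_sing D) = unit_square \<and> supp (mu_abs D) = unit_square"
    proof (rule full_supports_of_charging_curves[OF M k c])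
      fix B f assume B: "B \<in> sets borel" "emeasure M B = 0" and f: "f \<in> {\<lambda>u. 0, c, \<lambda>u. u}"
      have "\<exists>i. f = e i"
        using f by (auto simp: e_def intro: exI[of _ 0] exI[of _ "Suc 0"] exI[of _ "Suc (Suc 0)"])
      then obtain i where "f = e i" ..
      then show "AE x in unit_leb. \<forall>q>0. AE u in unit_leb. (x, x powr (k * real_of_rat q * exp (f u))) \<notin> B"
        using null[OF B] by (auto elim!: eventually_mono)
    qed
    with D show ?thesis by blast
  qed
  interpret Metric_space "mspace ev_metric" "mdist ev_metric" by simp
  show ?thesis
  proof (rule antisym)
    show "mtopology_of ev_metric closure_of ?F \<subseteq> ev_copulas"
      using closure_of_subset_topspace[of "mtopology_of ev_metric" ?F] by (simp add: mspace_ev_metric)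
    show "ev_copulas \<subseteq> mtopology_of ev_metric closure_of ?F"
    proof
      fix C assume C: "C \<in> ev_copulas"
      have "\<exists>D\<in>?F. D \<in> mball C r" if r: "0 < r" for r
      proof -
        obtain m where m: "1 / real (Suc m) < r" using nat_approx_posE[OF r] by blast
        \<comment> \<open>The second successor meets the bound \<open>2 \<le> n\<close> of
          \<open>dense\<close>.\<close>
        obtain D where D: "D \<in> ?F" "mdist ev_metric C D \<le> 1 / real (Suc (Suc m))"
          using dense[OF C, of "Suc (Suc m)"] by auto
        have "1 / real (Suc (Suc m)) \<le> 1 / real (Suc m)" by (simp add: frac_le)
        with m D(2) have "mdist ev_metric C D < r" by linarith
        then have "D \<in> mball C r" unfolding in_mball using D(1) C by (simp add: mspace_ev_metric)
        with D(1) show ?thesis by blast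
      qed
      then show "C \<in> mtopology_of ev_metric closure_of ?F"
        using C unfolding mtopology_of_def metric_closure_of by (simp add: mspace_ev_metric)
    qed
  qed
qed

end
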